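(* Let $G$ be a finite group and $T$ a $G$-Tambara functor. Then the frame $\mathrm{RadId}_G(T)$ of radical Tambara ideals of $T$ is spatial.
   Context: All rings are commutative with unit. A $G$-Tambara functor $T$ consists of commutative rings $T(G/H)$ for subgroups $H\le G$ with restriction ring maps, additive transfer maps, multiplicative norm maps and conjugation isomorphisms satisfying the standard Tambara axioms (Hill–Mazur). A Tambara ideal is a family of ring ideals $I(G/H)\subseteq T(G/H)$ closed under restriction, transfer, norm and conjugation. $\langle x\rangle$ denotes the Tambara ideal generated by an element $x$; the product $IJ$ is the Tambara ideal generated by the levelwise products $I(G/H)J(G/H)$. The radical $\sqrt I$ has $\sqrt I(G/H)=\{x\in T(G/H)\mid \langle x\rangle^n\subseteq I\text{ for some }n\ge1\}$; $I$ is radical if $I=\sqrt I$. $\mathrm{RadId}_G(T)$ is the set of radical Tambara ideals ordered by inclusion, a frame with meets given by intersection and joins $\bigvee_\lambda I_\lambda=\sqrt{\sum_\lambda I_\lambda}$ (levelwise sum). For a frame $A$, a point is a map $A\to\{0<1\}$ preserving arbitrary joins and finite meets; $\mathrm{pt}(A)$ carries the topology with basic opens $U(a)=\{p\mid p(a)=1\}$. $A$ is spatial if the map $a\mapsto U(a)$ from $A$ to the frame of open subsets of $\mathrm{pt}(A)$ is an isomorphism. *)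

theory Defs
  imports "HOL-Algebra.Algebra"
begin

type_synonym ('g,'x) gset = "'x set \<times> ('g \<Rightarrow> 'x \<Rightarrow> 'x)"

definition is_gset :: "('g,'b) monoid_scheme \<Rightarrow> ('g,'x) gset \<Rightarrow> bool" where
  "is_gset G Xa \<longleftrightarrow> finite (fst Xa)
     \<and> (\<forall>g\<in>carrier G. \<forall>x\<in>fst Xa. snd Xa g x \<in> fst Xa)
     \<and> (\<forall>x\<in>fst Xa. snd Xa (monoid.one G) x = x)
     \<and> (\<forall>g\<in>carrier G. \<forall>h\<in>carrier G. \<forall>x\<in>fst Xa.
          snd Xa (monoid.mult G g h) x = snd Xa g (snd Xa h x))"

definition gmap :: "('g,'b) monoid_scheme \<Rightarrow> ('g,'x) gset \<Rightarrow> ('g,'x) gset \<Rightarrow> ('x \<Rightarrow> 'x) \<Rightarrow> bool" where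
  "gmap G Xa Y f \<longleftrightarrow> is_gset G Xa \<and> is_gset G Y \<and> (\<forall>x\<in>fst Xa. f x \<in> fst Y)
     \<and> (\<forall>g\<in>carrier G. \<forall>x\<in>fst Xa. f (snd Xa g x) = snd Y g (f x))"

definition is_pullback ::
  "('g,'b) monoid_scheme \<Rightarrow> ('g,'x) gset \<Rightarrow> ('g,'x) gset \<Rightarrow> ('g,'x) gset \<Rightarrow> ('g,'x) gset
   \<Rightarrow> ('x \<Rightarrow> 'x) \<Rightarrow> ('x \<Rightarrow> 'x) \<Rightarrow> ('x \<Rightarrow> 'x) \<Rightarrow> ('x \<Rightarrow> 'x) \<Rightarrow> bool" where
  "is_pullback G Xa Y Z W f g f' g' \<longleftrightarrow>
     gmap G Xa Y f \<and> gmap G Z Y g \<and> gmap G W Z f' \<and> gmap G W Xa g' \<and>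
     bij_betw (\<lambda>w. (f' w, g' w)) (fst W) {(z, x). z \<in> fst Z \<and> x \<in> fst Xa \<and> g z = f x}"

text \<open>Exponential diagram (Tambara) for q : A \<rightarrow> Xa and p : Xa \<rightarrow> Y:
  Z = \<Pi>_p A with r : Z \<rightarrow> Y, Xp = Z \<times>_Y Xa with p' : Xp \<rightarrow> Z, \<pi> : Xp \<rightarrow> Xa, and evaluation e : Xp \<rightarrow> A.\<close>
definition is_exp_diagram ::
  "('g,'b) monoid_scheme \<Rightarrow> ('g,'x) gset \<Rightarrow> ('g,'x) gset \<Rightarrow> ('g,'x) gset \<Rightarrow> ('g,'x) gset \<Rightarrow> ('g,'x) gset
   \<Rightarrow> ('x \<Rightarrow> 'x) \<Rightarrow> ('x \<Rightarrow> 'x) \<Rightarrow> ('x \<Rightarrow> 'x) \<Rightarrow> ('x \<Rightarrow> 'x) \<Rightarrow> ('x \<Rightarrow> 'x) \<Rightarrow> ('x \<Rightarrow> 'x) \<Rightarrow> bool" where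
  "is_exp_diagram G A Xa Y Z Xp q p r p' \<pi> e \<longleftrightarrow>
     gmap G A Xa q \<and> gmap G Xa Y p \<and> gmap G Z Y r \<and>
     is_pullback G Xa Y Z Xp p r p' \<pi> \<and> gmap G Xp A e \<and>
     (\<forall>x'\<in>fst Xp. q (e x') = \<pi> x') \<and>
     bij_betw
       (\<lambda>z. (r z, restrict (\<lambda>x. e (THE x'. x' \<in> fst Xp \<and> p' x' = z \<and> \<pi> x' = x))
                        {x \<in> fst Xa. p x = r z}))
       (fst Z)
       {(y, s). y \<in> fst Y \<and> s \<in> ({x \<in> fst Xa. p x = y} \<rightarrow>\<^sub>E fst A)
                \<and> (\<forall>x \<in> {x \<in> fst Xa. p x = y}. q (s x) = x)}"

record ('g,'x,'r) tamb =
  tT   :: "('g,'x) gset \<Rightarrow> 'r ring"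
  tres :: "('g,'x) gset \<Rightarrow> ('g,'x) gset \<Rightarrow> ('x \<Rightarrow> 'x) \<Rightarrow> 'r \<Rightarrow> 'r"
    \<comment> \<open>tres Xa Y f : T(Y) \<rightarrow> T(Xa) for f : Xa \<rightarrow> Y\<close>
  ttr  :: "('g,'x) gset \<Rightarrow> ('g,'x) gset \<Rightarrow> ('x \<Rightarrow> 'x) \<Rightarrow> 'r \<Rightarrow> 'r"
    \<comment> \<open>ttr Xa Y f : T(Xa) \<rightarrow> T(Y), additive transfer\<close>
  tnm  :: "('g,'x) gset \<Rightarrow> ('g,'x) gset \<Rightarrow> ('x \<Rightarrow> 'x) \<Rightarrow> 'r \<Rightarrow> 'r"
    \<comment> \<open>tnm Xa Y f : T(Xa) \<rightarrow> T(Y), multiplicative norm\<close>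

definition tambara :: "('g,'b) monoid_scheme \<Rightarrow> ('g,'x,'r) tamb \<Rightarrow> bool" where
  "tambara G T \<longleftrightarrow>
   \<comment> \<open>commutative rings\<close>
   (\<forall>Xa. is_gset G Xa \<longrightarrow> cring (tT T Xa)) \<and>
   \<comment> \<open>restriction: ring homomorphisms, contravariant functor\<close>
   (\<forall>Xa Y f. gmap G Xa Y f \<longrightarrow> tres T Xa Y f \<in> ring_hom (tT T Y) (tT T Xa)) \<and>
   (\<forall>Xa. is_gset G Xa \<longrightarrow> (\<forall>a\<in>carrier (tT T Xa). tres T Xa Xa (\<lambda>x. x) a = a)) \<and>
   (\<forall>Xa Y Z f g. gmap G Xa Y f \<and> gmap G Y Z g \<longrightarrow>
      (\<forall>a\<in>carrier (tT T Z). tres T Xa Z (g \<circ> f) a = tres T Xa Y f (tres T Y Z g a))) \<and>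
   (\<forall>Xa Y f f'. gmap G Xa Y f \<and> (\<forall>x\<in>fst Xa. f x = f' x) \<longrightarrow>
      (\<forall>a\<in>carrier (tT T Y). tres T Xa Y f a = tres T Xa Y f' a)) \<and>
   \<comment> \<open>transfer: additive, covariant functor\<close>
   (\<forall>Xa Y f. gmap G Xa Y f \<longrightarrow>
      (\<forall>a\<in>carrier (tT T Xa). ttr T Xa Y f a \<in> carrier (tT T Y)) \<and>
      (\<forall>a\<in>carrier (tT T Xa). \<forall>b\<in>carrier (tT T Xa).
         ttr T Xa Y f (ring.add (tT T Xa) a b) = ring.add (tT T Y) (ttr T Xa Y f a) (ttr T Xa Y f b)) \<and>
      ttr T Xa Y f (ring.zero (tT T Xa)) = (ring.zero (tT T Y))) \<and>
   (\<forall>Xa. is_gset G Xa \<longrightarrow> (\<forall>a\<in>carrier (tT T Xa). ttr T Xa Xa (\<lambda>x. x) a = a)) \<and>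
   (\<forall>Xa Y Z f g. gmap G Xa Y f \<and> gmap G Y Z g \<longrightarrow>
      (\<forall>a\<in>carrier (tT T Xa). ttr T Xa Z (g \<circ> f) a = ttr T Y Z g (ttr T Xa Y f a))) \<and>
   (\<forall>Xa Y f f'. gmap G Xa Y f \<and> (\<forall>x\<in>fst Xa. f x = f' x) \<longrightarrow>
      (\<forall>a\<in>carrier (tT T Xa). ttr T Xa Y f a = ttr T Xa Y f' a)) \<and>
   \<comment> \<open>norm: multiplicative, covariant functor\<close>
   (\<forall>Xa Y f. gmap G Xa Y f \<longrightarrow>
      (\<forall>a\<in>carrier (tT T Xa). tnm T Xa Y f a \<in> carrier (tT T Y)) \<and>
      (\<forall>a\<in>carrier (tT T Xa). \<forall>b\<in>carrier (tT T Xa).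
         tnm T Xa Y f (monoid.mult (tT T Xa) a b) = monoid.mult (tT T Y) (tnm T Xa Y f a) (tnm T Xa Y f b)) \<and>
      tnm T Xa Y f (monoid.one (tT T Xa)) = (monoid.one (tT T Y))) \<and>
   (\<forall>Xa. is_gset G Xa \<longrightarrow> (\<forall>a\<in>carrier (tT T Xa). tnm T Xa Xa (\<lambda>x. x) a = a)) \<and>
   (\<forall>Xa Y Z f g. gmap G Xa Y f \<and> gmap G Y Z g \<longrightarrow>
      (\<forall>a\<in>carrier (tT T Xa). tnm T Xa Z (g \<circ> f) a = tnm T Y Z g (tnm T Xa Y f a))) \<and>
   (\<forall>Xa Y f f'. gmap G Xa Y f \<and> (\<forall>x\<in>fst Xa. f x = f' x) \<longrightarrow>
      (\<forall>a\<in>carrier (tT T Xa). tnm T Xa Y f a = tnm T Xa Y f' a)) \<and>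
   \<comment> \<open>Beck--Chevalley (double coset) formulas for pullback squares\<close>
   (\<forall>Xa Y Z W f g f' g'. is_pullback G Xa Y Z W f g f' g' \<longrightarrow>
      (\<forall>a\<in>carrier (tT T Xa).
         tres T Z Y g (ttr T Xa Y f a) = ttr T W Z f' (tres T W Xa g' a) \<and>
         tres T Z Y g (tnm T Xa Y f a) = tnm T W Z f' (tres T W Xa g' a))) \<and>
   \<comment> \<open>additivity: T(\<emptyset>) is the zero ring and T(X1 \<union> X2) = T(X1) \<times> T(X2)\<close>
   (\<forall>Xa. is_gset G Xa \<and> fst Xa = {} \<longrightarrow> card (carrier (tT T Xa)) = 1) \<and>
   (\<forall>Xa S1 S2. is_gset G Xa \<and> is_gset G (S1, snd Xa) \<and> is_gset G (S2, snd Xa) \<and>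
       S1 \<union> S2 = fst Xa \<and> S1 \<inter> S2 = {} \<longrightarrow>
      bij_betw (\<lambda>a. (tres T (S1, snd Xa) Xa (\<lambda>x. x) a, tres T (S2, snd Xa) Xa (\<lambda>x. x) a))
        (carrier (tT T Xa)) (carrier (tT T (S1, snd Xa)) \<times> carrier (tT T (S2, snd Xa)))) \<and>
   \<comment> \<open>distributive law (Tambara reciprocity) for exponential diagrams\<close>
   (\<forall>A Xa Y Z Xp q p r p' \<pi> e. is_exp_diagram G A Xa Y Z Xp q p r p' \<pi> e \<longrightarrow>
      (\<forall>a\<in>carrier (tT T A).
         tnm T Xa Y p (ttr T A Xa q a) = ttr T Z Y r (tnm T Xp Z p' (tres T Xp A e a))))"

definition emb :: "('g,'b) monoid_scheme \<Rightarrow> 'g set \<Rightarrow> 'x" where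
  "emb G = (SOME \<iota>. inj_on \<iota> (Pow (carrier G)))"

definition unemb :: "('g,'b) monoid_scheme \<Rightarrow> 'x \<Rightarrow> 'g set" where
  "unemb G = inv_into (Pow (carrier G)) (emb G)"

definition orbit :: "('g,'b) monoid_scheme \<Rightarrow> 'g set \<Rightarrow> ('g,'x) gset" where
  "orbit G H = (emb G ` {l_coset G g H | g. g \<in> carrier G},
                \<lambda>g x. emb G (l_coset G g (unemb G x)))"

text \<open>The G-map sending a coset C to C\<cdot>S; for K \<le> H, S = H gives G/K \<rightarrow> G/H;
  for S = gH it gives G/(gHg^{-1}) \<rightarrow> G/H, x gHg^{-1} \<mapsto> x g H.\<close>
definition cmap :: "('g,'b) monoid_scheme \<Rightarrow> 'g set \<Rightarrow> 'x \<Rightarrow> 'x" where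
  "cmap G S x = emb G (set_mult G (unemb G x) S)"

definition conjg :: "('g,'b) monoid_scheme \<Rightarrow> 'g \<Rightarrow> 'g set \<Rightarrow> 'g set" where
  "conjg G g H = r_coset G (l_coset G g H) (m_inv G g)"

definition TR :: "('g,'b) monoid_scheme \<Rightarrow> ('g,'x,'r) tamb \<Rightarrow> 'g set \<Rightarrow> 'r ring" where
  "TR G T H = tT T (orbit G H)"

definition sres :: "('g,'b) monoid_scheme \<Rightarrow> ('g,'x,'r) tamb \<Rightarrow> 'g set \<Rightarrow> 'g set \<Rightarrow> 'r \<Rightarrow> 'r" where
  "sres G T H K = tres T (orbit G K) (orbit G H) (cmap G H)"
definition str :: "('g,'b) monoid_scheme \<Rightarrow> ('g,'x,'r) tamb \<Rightarrow> 'g set \<Rightarrow> 'g set \<Rightarrow> 'r \<Rightarrow> 'r" where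
  "str G T K H = ttr T (orbit G K) (orbit G H) (cmap G H)"
definition snm :: "('g,'b) monoid_scheme \<Rightarrow> ('g,'x,'r) tamb \<Rightarrow> 'g set \<Rightarrow> 'g set \<Rightarrow> 'r \<Rightarrow> 'r" where
  "snm G T K H = tnm T (orbit G K) (orbit G H) (cmap G H)"
definition sconj :: "('g,'b) monoid_scheme \<Rightarrow> ('g,'x,'r) tamb \<Rightarrow> 'g \<Rightarrow> 'g set \<Rightarrow> 'r \<Rightarrow> 'r" where
  "sconj G T g H = tres T (orbit G (conjg G g H)) (orbit G H) (cmap G (l_coset G g H))"

type_synonym ('g,'r) fam = "'g set \<Rightarrow> 'r set"

definition tideal :: "('g,'b) monoid_scheme \<Rightarrow> ('g,'x,'r) tamb \<Rightarrow> ('g,'r) fam \<Rightarrow> bool" where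
  "tideal G T I \<longleftrightarrow>
     (\<forall>H. \<not> subgroup H G \<longrightarrow> I H = {}) \<and>
     (\<forall>H. subgroup H G \<longrightarrow> ideal (I H) (TR G T H)) \<and>
     (\<forall>H K. subgroup H G \<and> subgroup K G \<and> K \<subseteq> H \<longrightarrow>
        (\<forall>a\<in>I H. sres G T H K a \<in> I K) \<and>
        (\<forall>a\<in>I K. str G T K H a \<in> I H) \<and>
        (\<forall>a\<in>I K. snm G T K H a \<in> I H)) \<and>
     (\<forall>H g. subgroup H G \<and> g \<in> carrier G \<longrightarrow>
        (\<forall>a\<in>I H. sconj G T g H a \<in> I (conjg G g H)))"

definition fam_le :: "('g,'r) fam \<Rightarrow> ('g,'r) fam \<Rightarrow> bool" where
  "fam_le I J \<longleftrightarrow> (\<forall>H. I H \<subseteq> J H)"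

definition tgen :: "('g,'b) monoid_scheme \<Rightarrow> ('g,'x,'r) tamb \<Rightarrow> 'g set \<Rightarrow> 'r \<Rightarrow> ('g,'r) fam" where
  "tgen G T H0 x = (\<lambda>H. \<Inter> {I H | I. tideal G T I \<and> x \<in> I H0})"

definition tprod :: "('g,'b) monoid_scheme \<Rightarrow> ('g,'x,'r) tamb \<Rightarrow> ('g,'r) fam \<Rightarrow> ('g,'r) fam \<Rightarrow> ('g,'r) fam" where
  "tprod G T I J = (\<lambda>H. \<Inter> {K H | K. tideal G T K \<and>
      (\<forall>L. \<forall>a\<in>I L. \<forall>b\<in>J L. monoid.mult (TR G T L) a b \<in> K L)})"

definition unit_fam :: "('g,'b) monoid_scheme \<Rightarrow> ('g,'x,'r) tamb \<Rightarrow> ('g,'r) fam" where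
  "unit_fam G T = (\<lambda>H. if subgroup H G then carrier (TR G T H) else {})"

primrec tpow :: "('g,'b) monoid_scheme \<Rightarrow> ('g,'x,'r) tamb \<Rightarrow> ('g,'r) fam \<Rightarrow> nat \<Rightarrow> ('g,'r) fam" where
  "tpow G T I 0 = unit_fam G T"
| "tpow G T I (Suc n) = tprod G T (tpow G T I n) I"

definition tsqrt :: "('g,'b) monoid_scheme \<Rightarrow> ('g,'x,'r) tamb \<Rightarrow> ('g,'r) fam \<Rightarrow> ('g,'r) fam" where
  "tsqrt G T I = (\<lambda>H. if subgroup H G then
      {x \<in> carrier (TR G T H). \<exists>n\<ge>1. fam_le (tpow G T (tgen G T H x) n) I} else {})"

definition radical :: "('g,'b) monoid_scheme \<Rightarrow> ('g,'x,'r) tamb \<Rightarrow> ('g,'r) fam \<Rightarrow> bool" where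
  "radical G T I \<longleftrightarrow> tideal G T I \<and> tsqrt G T I = I"

definition RadId :: "('g,'b) monoid_scheme \<Rightarrow> ('g,'x,'r) tamb \<Rightarrow> ('g,'r) fam set" where
  "RadId G T = {I. radical G T I}"

definition rjoin :: "('g,'b) monoid_scheme \<Rightarrow> ('g,'x,'r) tamb \<Rightarrow> ('g,'r) fam set \<Rightarrow> ('g,'r) fam" where
  "rjoin G T S = tsqrt G T (\<lambda>H. if subgroup H G then genideal (TR G T H) (\<Union>I\<in>S. I H) else {})"

definition rmeet :: "('g,'r) fam \<Rightarrow> ('g,'r) fam \<Rightarrow> ('g,'r) fam" where
  "rmeet I J = (\<lambda>H. I H \<inter> J H)"

text \<open>A point: a map RadId \<rightarrow> {0<1} preserving arbitrary joins and finite meets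
  (represented as a predicate, False outside RadId).\<close>
definition is_point :: "('g,'b) monoid_scheme \<Rightarrow> ('g,'x,'r) tamb \<Rightarrow> (('g,'r) fam \<Rightarrow> bool) \<Rightarrow> bool" where
  "is_point G T p \<longleftrightarrow>
     (\<forall>I. I \<notin> RadId G T \<longrightarrow> \<not> p I) \<and>
     (\<forall>S. S \<subseteq> RadId G T \<longrightarrow> (p (rjoin G T S) \<longleftrightarrow> (\<exists>I\<in>S. p I))) \<and>
     p (unit_fam G T) \<and>
     (\<forall>I\<in>RadId G T. \<forall>J\<in>RadId G T. p (rmeet I J) \<longleftrightarrow> p I \<and> p J)"

definition Uopen :: "('g,'b) monoid_scheme \<Rightarrow> ('g,'x,'r) tamb \<Rightarrow> ('g,'r) fam \<Rightarrow> (('g,'r) fam \<Rightarrow> bool) set" where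
  "Uopen G T a = {p. is_point G T p \<and> p a}"

definition pt_opens :: "('g,'b) monoid_scheme \<Rightarrow> ('g,'x,'r) tamb \<Rightarrow> (('g,'r) fam \<Rightarrow> bool) set set" where
  "pt_opens G T = {\<Union>F | F. F \<subseteq> Uopen G T ` RadId G T}"

text \<open>Spatial: a \<mapsto> U(a) is an order isomorphism (hence frame isomorphism) onto the opens.\<close>
definition radid_spatial :: "('g,'b) monoid_scheme \<Rightarrow> ('g,'x,'r) tamb \<Rightarrow> bool" where
  "radid_spatial G T \<longleftrightarrow>
     bij_betw (Uopen G T) (RadId G T) (pt_opens G T) \<and>
     (\<forall>a\<in>RadId G T. \<forall>b\<in>RadId G T. fam_le a b \<longleftrightarrow> Uopen G T a \<subseteq> Uopen G T b)"

end

theory Submission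
  imports Defs
begin

text \<open>For a radical ideal \<open>J\<close> and \<open>x \<notin> J\<close> there is a prime Tambara ideal containing \<open>J\<close> but not \<open>x\<close>,
  and every proper prime \<open>P\<close> gives the point \<open>I \<mapsto> (I \<not>\<le> P)\<close>; hence points separate radical ideals.
  The prime is maximal among the ideals that contain \<open>J\<close> but no power of \<open>\<langle>x\<rangle>\<close>.
  Zorn's lemma applies because \<open>\<langle>x\<rangle>\<^sup>n\<close> is finitely generated: as \<open>G\<close> is finite, there are only finitely
  many elements \<open>N\<^sub>p (R\<^sub>f x)\<close> for orbit maps \<open>G/L \<leftarrow> G/K \<rightarrow> G/H\<close>, and \<open>n\<close>-fold products of these generate.

  Generation is controlled on all finite \<open>G\<close>-sets at once. If \<open>M\<close> is a family of subsets closed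
  under restriction, norms along surjections, scalars and gluing over disjoint unions, then the elements
  \<open>T\<^sub>q a\<close> with \<open>a \<in> M(A)\<close> and \<open>q : A \<rightarrow> V\<close> form a Tambara ideal: sums are transfers along
  codiagonals, and norms and products of transfers are transfers by Tambara reciprocity. This describes
  both sums of ideals, which are therefore levelwise, and powers of principal ideals.\<close>

subsection \<open>Finite G-sets\<close>

text \<open>Two features shape the proof. Norms are not additive, so it is not visible that a
  levelwise sum of ideals is closed under them; and Tambara reciprocity, which repairs this, leaves
  the world of orbits, since it needs disjoint unions, pullbacks and sets of sections. Hence the
  detour through all finite \<open>G\<close>-sets, although ideals are families on orbits only.
  Norms are restricted to surjections because the norm from the empty \<open>G\<close>-set is 1,
  which would turn any such family into the unit family. A surjection onto an orbit has nonempty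
  source, so its norm has at least one factor coming from an orbit, and an ideal absorbs the
  remaining factors. That sums are levelwise is needed for primality: if \<open>AB\<close> lies in
  \<open>P\<close>, it makes the inclusion of \<open>(P + A)(P + B)\<close> in \<open>P\<close> an
  elementwise computation.\<close>

lemma is_gsetI:
  assumes "finite S"
    and "\<And>g x. g \<in> carrier G \<Longrightarrow> x \<in> S \<Longrightarrow> act g x \<in> S"
    and "\<And>x. x \<in> S \<Longrightarrow> act \<one>\<^bsub>G\<^esub> x = x"
    and "\<And>g h x. g \<in> carrier G \<Longrightarrow> h \<in> carrier G \<Longrightarrow> x \<in> S \<Longrightarrow> act (g \<otimes>\<^bsub>G\<^esub> h) x = act g (act h x)"
  shows "is_gset G (S, act)"
  using assms by (simp add: is_gset_def)

lemma is_gsetD: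
  assumes "is_gset G V"
  shows "finite (fst V)"
    and "g \<in> carrier G \<Longrightarrow> x \<in> fst V \<Longrightarrow> snd V g x \<in> fst V"
    and "x \<in> fst V \<Longrightarrow> snd V \<one>\<^bsub>G\<^esub> x = x"
    and "g \<in> carrier G \<Longrightarrow> h \<in> carrier G \<Longrightarrow> x \<in> fst V \<Longrightarrow>
      snd V (g \<otimes>\<^bsub>G\<^esub> h) x = snd V g (snd V h x)"
  using assms by (simp_all add: is_gset_def)

lemma gmapI:
  assumes "is_gset G V" "is_gset G Y"
    and "\<And>x. x \<in> fst V \<Longrightarrow> f x \<in> fst Y"
    and "\<And>g x. g \<in> carrier G \<Longrightarrow> x \<in> fst V \<Longrightarrow> f (snd V g x) = snd Y g (f x)"
  shows "gmap G V Y f"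
  using assms by (simp add: gmap_def)

lemma gmapD:
  assumes "gmap G V Y f"
  shows "is_gset G V" "is_gset G Y"
    and "x \<in> fst V \<Longrightarrow> f x \<in> fst Y"
    and "g \<in> carrier G \<Longrightarrow> x \<in> fst V \<Longrightarrow> f (snd V g x) = snd Y g (f x)"
  using assms by (simp_all add: gmap_def)

lemma gmap_id: "is_gset G V \<Longrightarrow> gmap G V V (\<lambda>x. x)"
  by (auto intro!: gmapI dest: is_gsetD)

lemma gmap_comp: "gmap G V Y f \<Longrightarrow> gmap G Y Z g \<Longrightarrow> gmap G V Z (g \<circ> f)"
  by (auto simp: gmap_def)

lemma is_gset_subset:
  assumes "is_gset G V" "S \<subseteq> fst V" "\<And>g x. g \<in> carrier G \<Longrightarrow> x \<in> S \<Longrightarrow> snd V g x \<in> S"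
  shows "is_gset G (S, snd V)"
  using assms finite_subset[of S "fst V"] by (auto simp: is_gset_def subset_iff)

lemma gmap_inclusion:
  assumes "is_gset G V" "is_gset G (S, snd V)" "S \<subseteq> fst V"
  shows "gmap G (S, snd V) V (\<lambda>x. x)"
  using assms by (auto intro!: gmapI)

lemma is_gset_empty: "is_gset G ({}, act)"
  by (simp add: is_gset_def)

lemma gmap_empty: "is_gset G V \<Longrightarrow> gmap G ({}, act) V f"
  by (simp add: gmap_def is_gset_empty)

lemma is_gset_transport:
  assumes "is_gset G (S, act)" "inj_on k S"
  shows "is_gset G (k ` S, \<lambda>g z. k (act g (inv_into S k z)))"
  using assms by (auto simp: is_gset_def)

text \<open>Sums, pullbacks and sets of sections are built on other types; being finite, they can be
  relabelled inside the infinite type \<open>'x\<close>, over which \<open>T\<close> is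
  defined.\<close>

lemma ex_inj_on_infinite:
  assumes "finite S" "infinite (UNIV :: 'x set)"
  shows "\<exists>k :: 'y \<Rightarrow> 'x. inj_on k S"
proof -
  obtain B :: "'x set" where B: "finite B" "card B = card S"
    using infinite_arbitrarily_large[OF assms(2)] by blast
  then show ?thesis
    using assms(1) by (metis finite_same_card_bij bij_betw_def)
qed

text \<open>The coproduct of \<open>G\<close>-sets up to isomorphism: \<open>i\<close> and
  \<open>j\<close> are arbitrary embeddings, since two overlapping sets inside \<open>'x\<close>
  have to be moved apart.\<close>

definition is_sum ::
  "('g,'b) monoid_scheme \<Rightarrow> ('g,'x) gset \<Rightarrow> ('g,'x) gset \<Rightarrow> ('g,'x) gset \<Rightarrow> ('x \<Rightarrow> 'x) \<Rightarrow> ('x \<Rightarrow> 'x) \<Rightarrow> bool"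
  where "is_sum G A B C i j \<longleftrightarrow> gmap G A C i \<and> gmap G B C j
    \<and> inj_on i (fst A) \<and> inj_on j (fst B)
    \<and> i ` fst A \<inter> j ` fst B = {} \<and> i ` fst A \<union> j ` fst B = fst C"

lemma is_sum_commute: "is_sum G A B C i j \<Longrightarrow> is_sum G B A C j i"
  by (auto simp: is_sum_def)

lemma is_sumD:
  assumes "is_sum G A B C i j"
  shows "gmap G A C i" "gmap G B C j" "inj_on i (fst A)" "inj_on j (fst B)"
    "i ` fst A \<inter> j ` fst B = {}" "i ` fst A \<union> j ` fst B = fst C"
    "is_gset G A" "is_gset G B" "is_gset G C"
  using assms by (auto simp: is_sum_def dest: gmapD)

lemma is_sum_subsets:
  assumes "is_gset G V" "is_gset G (S1, snd V)" "is_gset G (S2, snd V)"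
    and "S1 \<inter> S2 = {}" "S1 \<union> S2 = fst V"
  shows "is_sum G (S1, snd V) (S2, snd V) V (\<lambda>x. x) (\<lambda>x. x)"
  using assms by (auto simp: is_sum_def intro!: gmap_inclusion)

lemma ex_sum:
  fixes A B :: "('g,'x) gset"
  assumes "is_gset G A" "is_gset G B" "infinite (UNIV :: 'x set)"
  shows "\<exists>C i j. is_sum G A B C i j"
proof -
  define S where "S = Inl ` fst A \<union> Inr ` fst B"
  define act where "act = (\<lambda>g :: 'g. map_sum (snd A g) (snd B g))"
  have gS: "is_gset G (S, act)"
    unfolding S_def act_def using is_gsetD[OF assms(1)] is_gsetD[OF assms(2)]
    by (intro is_gsetI) auto
  obtain k :: "'x + 'x \<Rightarrow> 'x" where k: "inj_on k S"
    using ex_inj_on_infinite[OF _ assms(3)] is_gsetD(1)[OF gS] by auto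
  define C where "C = (k ` S, \<lambda>g z. k (act g (inv_into S k z)))"
  have C: "is_gset G C" unfolding C_def by (rule is_gset_transport[OF gS k])
  have "is_sum G A B C (k \<circ> Inl) (k \<circ> Inr)"
    unfolding is_sum_def
  proof (intro conjI)
    show "gmap G A C (k \<circ> Inl)" "gmap G B C (k \<circ> Inr)"
      using assms(1,2) C k by (auto intro!: gmapI simp: C_def S_def act_def)
    show "inj_on (k \<circ> Inl) (fst A)" "inj_on (k \<circ> Inr) (fst B)"
      using k by (auto simp: inj_on_def S_def)
    show "(k \<circ> Inl) ` fst A \<inter> (k \<circ> Inr) ` fst B = {}"
      using k unfolding inj_on_def S_def by fastforce
    show "(k \<circ> Inl) ` fst A \<union> (k \<circ> Inr) ` fst B = fst C"
      by (auto simp: C_def S_def)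
  qed
  then show ?thesis by blast
qed

lemma ex_sum_map:
  assumes "is_sum G A B C i j" "gmap G A V f" "gmap G B V g"
  shows "\<exists>h. gmap G C V h \<and> (\<forall>a\<in>fst A. h (i a) = f a) \<and> (\<forall>b\<in>fst B. h (j b) = g b)"
proof -
  note s = is_sumD[OF assms(1)]
  define h where "h = (\<lambda>c. if c \<in> i ` fst A then f (inv_into (fst A) i c) else g (inv_into (fst B) j c))"
  have hi: "h (i a) = f a" if "a \<in> fst A" for a
    using that s by (auto simp: h_def)
  have hj: "h (j b) = g b" if "b \<in> fst B" for b
    using that s by (auto simp: h_def)
  have "gmap G C V h"
  proof (rule gmapI)
    fix c assume "c \<in> fst C"
    then have "c \<in> i ` fst A \<union> j ` fst B" using s(6) by simp
    then show "h c \<in> fst V"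
      using hi hj gmapD(3)[OF assms(2)] gmapD(3)[OF assms(3)] by auto
  next
    fix u c assume u: "u \<in> carrier G" and "c \<in> fst C"
    then consider a where "a \<in> fst A" "c = i a" | b where "b \<in> fst B" "c = j b"
      using s(6) by blast
    then show "h (snd C u c) = snd V u (h c)"
    proof cases
      case 1
      then show ?thesis
        using u hi gmapD(4)[OF s(1)] gmapD(4)[OF assms(2)] is_gsetD(2)[OF s(7)] by metis
    next
      case 2
      then show ?thesis
        using u hj gmapD(4)[OF s(2)] gmapD(4)[OF assms(3)] is_gsetD(2)[OF s(8)] by metis
    qed
  qed (use s(9) gmapD(2)[OF assms(2)] in simp_all)
  then show ?thesis using hi hj by blast
qed

lemma gmap_factor_inj:
  assumes f: "gmap G Y C f" and i: "gmap G A C i" "inj_on i (fst A)" and im: "f ` fst Y \<subseteq> i ` fst A"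
  shows "\<exists>f'. gmap G Y A f' \<and> (\<forall>y\<in>fst Y. i (f' y) = f y)"
proof -
  define f' where "f' = (\<lambda>y. inv_into (fst A) i (f y))"
  have f': "f' y \<in> fst A" "i (f' y) = f y" if "y \<in> fst Y" for y
    using that im by (auto simp: f'_def inv_into_into f_inv_into_f image_subset_iff)
  have "f' (snd Y g y) = snd A g (f' y)" if g: "g \<in> carrier G" and y: "y \<in> fst Y" for g y
  proof (rule inj_onD[OF i(2)])
    have gy: "snd Y g y \<in> fst Y" using is_gsetD(2)[OF gmapD(1)[OF f]] g y by blast
    show "i (f' (snd Y g y)) = i (snd A g (f' y))"
      using f'[OF gy] f'[OF y] gmapD(4)[OF f g y] gmapD(4)[OF i(1) g] by simp
    show "f' (snd Y g y) \<in> fst A" using f' gy by blast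
    show "snd A g (f' y) \<in> fst A"
      using f' g y is_gsetD(2)[OF gmapD(1)[OF i(1)]] by blast
  qed
  then have "gmap G Y A f'"
    using f'(1) gmapD(1)[OF f] gmapD(1)[OF i(1)] by (intro gmapI) auto
  then show ?thesis using f' by blast
qed

section \<open>Pullbacks of finite \<open>G\<close>-sets\<close>

lemma is_pullbackD:
  assumes "is_pullback G V Y Z W f g f' g'"
  shows "gmap G V Y f" "gmap G Z Y g" "gmap G W Z f'" "gmap G W V g'"
    "w \<in> fst W \<Longrightarrow> g (f' w) = f (g' w)"
    "z \<in> fst Z \<Longrightarrow> x \<in> fst V \<Longrightarrow> g z = f x \<Longrightarrow> \<exists>w\<in>fst W. f' w = z \<and> g' w = x"
proof -
  have b: "bij_betw (\<lambda>w. (f' w, g' w)) (fst W) {(z, x). z \<in> fst Z \<and> x \<in> fst V \<and> g z = f x}"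
    using assms by (simp add: is_pullback_def)
  show "w \<in> fst W \<Longrightarrow> g (f' w) = f (g' w)"
    using bij_betwE[OF b] by auto
  show "\<exists>w\<in>fst W. f' w = z \<and> g' w = x" if "z \<in> fst Z" "x \<in> fst V" "g z = f x"
  proof -
    have "(z, x) \<in> (\<lambda>w. (f' w, g' w)) ` fst W"
      using b that by (simp add: bij_betw_def)
    then show ?thesis by auto
  qed
qed (use assms in \<open>auto simp: is_pullback_def\<close>)

lemma is_pullback_surj:
  assumes "is_pullback G V Y Z W f g f' g'" "f ` fst V = fst Y"
  shows "f' ` fst W = fst Z"
proof
  show "f' ` fst W \<subseteq> fst Z" using gmapD(3)[OF is_pullbackD(3)[OF assms(1)]] by auto
  show "fst Z \<subseteq> f' ` fst W"
  proof
    fix z assume z: "z \<in> fst Z"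
    then have "g z \<in> f ` fst V" using assms(2) gmapD(3)[OF is_pullbackD(2)[OF assms(1)]] by auto
    then show "z \<in> f' ` fst W" using is_pullbackD(6)[OF assms(1) z] by auto
  qed
qed

lemma ex_pullback:
  fixes V Y Z :: "('g,'x) gset"
  assumes f: "gmap G V Y f" and g: "gmap G Z Y g" and inf: "infinite (UNIV :: 'x set)"
  shows "\<exists>W f' g'. is_pullback G V Y Z W f g f' g'"
proof -
  define S where "S = {(z, x). z \<in> fst Z \<and> x \<in> fst V \<and> g z = f x}"
  define act where "act = (\<lambda>h :: 'g. map_prod (snd Z h) (snd V h))"
  note V = gmapD(1)[OF f] and Z = gmapD(1)[OF g]
  have "finite S"
    by (rule finite_subset[of _ "fst Z \<times> fst V"])
      (use is_gsetD(1)[OF V] is_gsetD(1)[OF Z] in \<open>auto simp: S_def\<close>)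
  then have gS: "is_gset G (S, act)"
    unfolding S_def act_def using is_gsetD[OF V] is_gsetD[OF Z] gmapD[OF f] gmapD[OF g]
    by (intro is_gsetI) auto
  obtain k :: "'x \<times> 'x \<Rightarrow> 'x" where k: "inj_on k S"
    using ex_inj_on_infinite[OF \<open>finite S\<close> inf] by auto
  define W where "W = (k ` S, \<lambda>g z. k (act g (inv_into S k z)))"
  have W: "is_gset G W" unfolding W_def by (rule is_gset_transport[OF gS k])
  have actS: "act h s \<in> S" if "h \<in> carrier G" "s \<in> S" for h s
    using is_gsetD(2)[OF gS] that by simp
  have "is_pullback G V Y Z W f g (fst \<circ> inv_into S k) (snd \<circ> inv_into S k)"
    unfolding is_pullback_def
  proof (intro conjI)
    show "gmap G W Z (fst \<circ> inv_into S k)" "gmap G W V (snd \<circ> inv_into S k)"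
      using Z V W k actS
      by (auto intro!: gmapI simp: W_def)
        (auto simp: S_def act_def)
    have "bij_betw (inv_into S k) (fst W) S"
      using k by (simp add: W_def bij_betw_inv_into bij_betw_def inj_on_inv_into)
    then show "bij_betw (\<lambda>w. ((fst \<circ> inv_into S k) w, (snd \<circ> inv_into S k) w)) (fst W)
        {(z, x). z \<in> fst Z \<and> x \<in> fst V \<and> g z = f x}"
      by (simp add: S_def)
  qed (use f g in auto)
  then show ?thesis by blast
qed

text \<open>Summands are disjoint: a point of \<open>C\<close> lying over the summand
  \<open>V\<close> cannot come from \<open>B\<close>, so it comes from a unique point of
  \<open>A\<close>. Beck-Chevalley can then compute transfers and norms along a map of disjoint
  unions one summand at a time.\<close>

lemma is_pullback_sum:
  assumes s: "is_sum G A B C i j" and t: "is_sum G V Y D k l" and h: "gmap G C D h"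
    and q: "gmap G A V q" and hi: "\<And>a. a \<in> fst A \<Longrightarrow> h (i a) = k (q a)"
    and hj: "\<And>b. b \<in> fst B \<Longrightarrow> h (j b) \<in> l ` fst Y"
  shows "is_pullback G C D V A h k q i"
  unfolding is_pullback_def
proof (intro conjI)
  note s' = is_sumD[OF s] and t' = is_sumD[OF t]
  show "bij_betw (\<lambda>w. (q w, i w)) (fst A) {(z, x). z \<in> fst V \<and> x \<in> fst C \<and> k z = h x}"
    unfolding bij_betw_def
  proof
    show "inj_on (\<lambda>w. (q w, i w)) (fst A)" using s'(3) by (auto simp: inj_on_def)
    show "(\<lambda>w. (q w, i w)) ` fst A = {(z, x). z \<in> fst V \<and> x \<in> fst C \<and> k z = h x}"
    proof (intro equalityI subsetI)
      fix u assume "u \<in> (\<lambda>w. (q w, i w)) ` fst A"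
      then show "u \<in> {(z, x). z \<in> fst V \<and> x \<in> fst C \<and> k z = h x}"
        using gmapD(3)[OF q] gmapD(3)[OF s'(1)] hi by auto
    next
      fix u assume "u \<in> {(z, x). z \<in> fst V \<and> x \<in> fst C \<and> k z = h x}"
      then obtain z x where u: "u = (z, x)" "z \<in> fst V" "x \<in> fst C" "k z = h x" by auto
      have "x \<notin> j ` fst B" using u hj t'(5) by auto
      then obtain a where a: "a \<in> fst A" "x = i a" using u(3) s'(6) by auto
      then have "k z = k (q a)" using u hi by simp
      then have "z = q a" using t'(3) u(2) a gmapD(3)[OF q] by (auto dest: inj_onD)
      then show "u \<in> (\<lambda>w. (q w, i w)) ` fst A" using u a by auto
    qed
  qed
qed (use is_sumD[OF s] is_sumD[OF t] h q in auto)

section \<open>Existence of exponential diagrams\<close>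

context group
begin

lemma gset_inv_cancel:
  assumes "is_gset G V" "g \<in> carrier G" "x \<in> fst V"
  shows "snd V (inv g) (snd V g x) = x" "snd V g (snd V (inv g) x) = x"
  using assms is_gsetD(3,4)[OF assms(1)] by (metis inv_closed l_inv, metis inv_closed r_inv)

text \<open>The points of \<open>Z\<close> over \<open>y\<close> are the sections of
  \<open>q\<close> over the fibre of \<open>p\<close> at \<open>y\<close>, with the group acting by
  conjugation. Everything is finite, so \<open>Z\<close> can be relabelled in
  \<open>'x\<close>.\<close>

lemma ex_exp_diagram:
  fixes A V Y :: "('a,'x) gset"
  assumes q: "gmap G A V q" and p: "gmap G V Y p" and inf: "infinite (UNIV :: 'x set)"
  shows "\<exists>Z Xp r p' \<pi> e. is_exp_diagram G A V Y Z Xp q p r p' \<pi> e"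
proof -
  note A = gmapD(1)[OF q] and V = gmapD(1)[OF p] and Y = gmapD(2)[OF p]
  define fib where "fib = (\<lambda>y. {x \<in> fst V. p x = y})"
  define S where "S = {(y, s). y \<in> fst Y \<and> s \<in> (fib y \<rightarrow>\<^sub>E fst A) \<and> (\<forall>x \<in> fib y. q (s x) = x)}"
  \<comment> \<open>\<open>(g s)(x) = g s(g^-1 x)\<close>; restricting to the new fibre keeps
    sections in extensional form, so that equal sections are equal functions.\<close>
  define act where "act = (\<lambda>g (y, s). (snd Y g y,
     restrict (\<lambda>x. snd A g (s (snd V (inv g) x))) (fib (snd Y g y))))"
  have fibI: "snd V g x \<in> fib (snd Y g y) \<longleftrightarrow> x \<in> fib y"
    if "g \<in> carrier G" "x \<in> fst V" "y \<in> fst Y" for g x y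
  proof
    assume "snd V g x \<in> fib (snd Y g y)"
    then have "snd Y g (p x) = snd Y g y"
      unfolding fib_def gmapD(4)[OF p that(1,2), symmetric] by simp
    then have "p x = y"
      by (metis gset_inv_cancel(1)[OF Y that(1,3)] gset_inv_cancel(1)[OF Y that(1) gmapD(3)[OF p that(2)]])
    then show "x \<in> fib y" using that(2) unfolding fib_def by blast
  next
    assume "x \<in> fib y"
    then have "p x = y" by (simp add: fib_def)
    then show "snd V g x \<in> fib (snd Y g y)"
      unfolding fib_def using gmapD(4)[OF p that(1,2)] is_gsetD(2)[OF V that(1,2)] by simp
  qed
  have fibI': "snd V (inv g) x \<in> fib y"
    if "g \<in> carrier G" "x \<in> fib (snd Y g y)" "y \<in> fst Y" for g x y
    using fibI[of g "snd V (inv g) x" y] that gset_inv_cancel[OF V, of g x] is_gsetD(2)[OF V, of "inv g" x]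
    by (auto simp: fib_def)
  have "finite S"
  proof (rule finite_subset)
    show "S \<subseteq> Sigma (fst Y) (\<lambda>y. fib y \<rightarrow>\<^sub>E fst A)" by (auto simp: S_def)
    show "finite (Sigma (fst Y) (\<lambda>y. fib y \<rightarrow>\<^sub>E fst A))"
      using is_gsetD(1)[OF A] is_gsetD(1)[OF V] is_gsetD(1)[OF Y]
      by (intro finite_SigmaI finite_PiE) (auto simp: fib_def)
  qed
  have gS: "is_gset G (S, act)"
  proof (rule is_gsetI)
    fix g u assume g: "g \<in> carrier G" and "u \<in> S"
    then obtain y s where u: "u = (y, s)" "y \<in> fst Y" "s \<in> fib y \<rightarrow>\<^sub>E fst A" "\<forall>x\<in>fib y. q (s x) = x"
      by (auto simp: S_def)
    have "q (snd A g (s (snd V (inv g) x))) = x" if x: "x \<in> fib (snd Y g y)" for x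
    proof -
      have m: "snd V (inv g) x \<in> fib y" using fibI' g x u by blast
      then have "s (snd V (inv g) x) \<in> fst A" using u(3) by auto
      then have "q (snd A g (s (snd V (inv g) x))) = snd V g (snd V (inv g) x)"
        using gmapD(4)[OF q g] u(4) m by simp
      then show ?thesis using gset_inv_cancel[OF V g] x by (auto simp: fib_def)
    qed
    then show "act g u \<in> S"
      using g u is_gsetD(2)[OF Y] is_gsetD(2)[OF A] fibI'
      by (auto simp: S_def act_def PiE_def Pi_def)
  next
    fix u assume "u \<in> S"
    then obtain y s where u: "u = (y, s)" "y \<in> fst Y" "s \<in> fib y \<rightarrow>\<^sub>E fst A" by (auto simp: S_def)
    have "restrict (\<lambda>x. snd A \<one> (s (snd V (inv \<one>) x))) (fib y) = restrict s (fib y)"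
      using is_gsetD(3)[OF V] is_gsetD(3)[OF A] u(3) by (intro restrict_ext) (auto simp: fib_def PiE_def Pi_def)
    then show "act \<one> u = u"
      using u is_gsetD(3)[OF Y] by (simp add: act_def PiE_restrict)
  next
    fix g h u assume g: "g \<in> carrier G" and h: "h \<in> carrier G" and "u \<in> S"
    then obtain y s where u: "u = (y, s)" "y \<in> fst Y" "s \<in> fib y \<rightarrow>\<^sub>E fst A" by (auto simp: S_def)
    let ?y = "snd Y g (snd Y h y)"
    have hy: "snd Y h y \<in> fst Y" using is_gsetD(2)[OF Y h] u by blast
    have "restrict (\<lambda>x. snd A (g \<otimes> h) (s (snd V (inv (g \<otimes> h)) x))) (fib ?y) =
       restrict (\<lambda>x. snd A g (restrict (\<lambda>x. snd A h (s (snd V (inv h) x))) (fib (snd Y h y)) (snd V (inv g) x)))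
          (fib ?y)"
    proof (intro restrict_ext)
      fix x assume x: "x \<in> fib ?y"
      then have xX: "x \<in> fst V" by (simp add: fib_def)
      have gx: "snd V (inv g) x \<in> fib (snd Y h y)" using fibI'[OF g x hy] .
      have hgx: "snd V (inv h) (snd V (inv g) x) \<in> fib y" using fibI'[OF h gx u(2)] .
      then have sA: "s (snd V (inv h) (snd V (inv g) x)) \<in> fst A" using u(3) by auto
      have "snd V (inv (g \<otimes> h)) x = snd V (inv h) (snd V (inv g) x)"
        using g h xX is_gsetD(4)[OF V] by (simp add: inv_mult_group)
      then show "snd A (g \<otimes> h) (s (snd V (inv (g \<otimes> h)) x)) =
        snd A g (restrict (\<lambda>x. snd A h (s (snd V (inv h) x))) (fib (snd Y h y)) (snd V (inv g) x))"
        using gx sA is_gsetD(4)[OF A g h] by simp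
    qed
    then show "act (g \<otimes> h) u = act g (act h u)"
      using u g h is_gsetD(4)[OF Y] by (simp add: act_def)
  qed (rule \<open>finite S\<close>)
  obtain k :: "'x \<times> ('x \<Rightarrow> 'x) \<Rightarrow> 'x" where k: "inj_on k S"
    using ex_inj_on_infinite[OF \<open>finite S\<close> inf] by auto
  define Z where "Z = (k ` S, \<lambda>g z. k (act g (inv_into S k z)))"
  define d where "d = inv_into S k"
  have Z: "is_gset G Z" unfolding Z_def by (rule is_gset_transport[OF gS k])
  have dS: "d z \<in> S" if "z \<in> fst Z" for z
    using that by (auto simp: d_def Z_def k)
  have dact: "d (snd Z g z) = act g (d z)" if "g \<in> carrier G" "z \<in> fst Z" for g z
    using is_gsetD(2)[OF gS] that k by (auto simp: d_def Z_def)
  define r where "r = fst \<circ> d"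
  have r: "gmap G Z Y r"
  proof (rule gmapI[OF Z Y])
    show "r z \<in> fst Y" if "z \<in> fst Z" for z using dS[OF that] by (auto simp: r_def S_def)
    show "r (snd Z g z) = snd Y g (r z)" if "g \<in> carrier G" "z \<in> fst Z" for g z
      using dact[OF that] by (simp add: r_def act_def split: prod.splits)
  qed
  obtain Xp p' \<pi> where pb: "is_pullback G V Y Z Xp p r p' \<pi>"
    using ex_pullback[OF p r inf] by blast
  note pb' = is_pullbackD[OF pb]
  \<comment> \<open>Evaluation: \<open>d\<close> decodes the point of \<open>Z\<close> to a section,
    which is applied to the point of \<open>V\<close>.\<close>
  define e where "e = (\<lambda>x'. snd (d (p' x')) (\<pi> x'))"
  have fibx: "\<pi> x' \<in> fib (fst (d (p' x')))" if "x' \<in> fst Xp" for x'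
    using pb'(5)[OF that] gmapD(3)[OF pb'(4) that] by (simp add: fib_def r_def)
  have sx: "snd (d z) \<in> fib (fst (d z)) \<rightarrow>\<^sub>E fst A" "x \<in> fib (fst (d z)) \<Longrightarrow> q (snd (d z) x) = x"
    if "z \<in> fst Z" for z x
    using dS[OF that] by (auto simp: S_def)
  have e: "gmap G Xp A e"
  proof (rule gmapI[OF gmapD(1)[OF pb'(3)] A])
    show "e x \<in> fst A" if "x \<in> fst Xp" for x
      using sx(1)[OF gmapD(3)[OF pb'(3) that]] fibx[OF that] by (auto simp: e_def)
    show "e (snd Xp g x) = snd A g (e x)" if g: "g \<in> carrier G" and x: "x \<in> fst Xp" for g x
    proof -
      have px: "p' x \<in> fst Z" and pix: "\<pi> x \<in> fst V" using gmapD(3)[OF pb'(3) x] gmapD(3)[OF pb'(4) x] by auto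
      have 1: "d (p' (snd Xp g x)) = act g (d (p' x))"
        using gmapD(4)[OF pb'(3) g x] dact[OF g px] by simp
      have 2: "\<pi> (snd Xp g x) = snd V g (\<pi> x)" using gmapD(4)[OF pb'(4) g x] .
      have "fst (d (p' x)) \<in> fst Y" using dS[OF px] by (auto simp: S_def)
      then have "snd V g (\<pi> x) \<in> fib (snd Y g (fst (d (p' x))))"
        using fibI[OF g pix] fibx[OF x] by blast
      then show ?thesis
        unfolding e_def 1 2 using gset_inv_cancel(1)[OF V g pix]
        by (simp add: act_def case_prod_beta)
    qed
  qed
  have qe: "q (e x') = \<pi> x'" if "x' \<in> fst Xp" for x'
    using sx(2)[OF gmapD(3)[OF pb'(3) that] fibx[OF that]] by (simp add: e_def)
  \<comment> \<open>The bijection demanded by the definition is the decoding map \<open>d\<close> in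
    disguise: the two projections of \<open>Xp\<close> are jointly injective, which determines the
    \<open>THE\<close>.\<close>
  have key: "(r z, restrict (\<lambda>x. e (THE x'. x' \<in> fst Xp \<and> p' x' = z \<and> \<pi> x' = x)) (fib (r z))) = d z"
    if z: "z \<in> fst Z" for z
  proof -
    have "e (THE x'. x' \<in> fst Xp \<and> p' x' = z \<and> \<pi> x' = x) = snd (d z) x" if x: "x \<in> fib (r z)" for x
    proof -
      obtain w where w: "w \<in> fst Xp" "p' w = z" "\<pi> w = x"
        using pb'(6)[OF z, of x] x by (auto simp: fib_def)
      have inj: "inj_on (\<lambda>w. (p' w, \<pi> w)) (fst Xp)"
        using pb by (simp add: is_pullback_def bij_betw_def)
      have "(THE x'. x' \<in> fst Xp \<and> p' x' = z \<and> \<pi> x' = x) = w"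
        using w inj by (intro the_equality) (auto simp: inj_on_def)
      then show ?thesis using w by (simp add: e_def)
    qed
    then have "restrict (\<lambda>x. e (THE x'. x' \<in> fst Xp \<and> p' x' = z \<and> \<pi> x' = x)) (fib (r z))
        = restrict (snd (d z)) (fib (r z))"
      by (intro restrict_ext)
    also have "\<dots> = snd (d z)"
      using sx(1)[OF z] by (simp add: PiE_restrict r_def)
    finally show ?thesis by (simp add: r_def)
  qed
  have bd: "bij_betw d (fst Z) S"
    using k by (simp add: Z_def d_def bij_betw_inv_into bij_betw_def inj_on_inv_into)
  have "is_exp_diagram G A V Y Z Xp q p r p' \<pi> e"
    unfolding is_exp_diagram_def
  proof (intro conjI)
    have "bij_betw (\<lambda>z. (r z, restrict (\<lambda>x. e (THE x'. x' \<in> fst Xp \<and> p' x' = z \<and> \<pi> x' = x))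
                        (fib (r z)))) (fst Z) S"
      by (subst bij_betw_cong[OF key]) (auto intro: bd)
    then show "bij_betw
       (\<lambda>z. (r z, restrict (\<lambda>x. e (THE x'. x' \<in> fst Xp \<and> p' x' = z \<and> \<pi> x' = x))
                        {x \<in> fst V. p x = r z})) (fst Z)
       {(y, s). y \<in> fst Y \<and> s \<in> ({x \<in> fst V. p x = y} \<rightarrow>\<^sub>E fst A)
                \<and> (\<forall>x \<in> {x \<in> fst V. p x = y}. q (s x) = x)}"
      unfolding fib_def S_def .
    show "\<forall>x'\<in>fst Xp. q (e x') = \<pi> x'" using qe by blast
  qed (fact q p r pb e)+
  then show ?thesis by blast
qed

end

subsection \<open>Orbits\<close>

locale tambara_functor = group G for G :: "('g,'b) monoid_scheme" (structure) +
  fixes T :: "('g,'x,'r) tamb"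
  assumes finite_G: "finite (carrier G)"
    and infinite_x: "infinite (UNIV :: 'x set)"
    and tambara: "tambara G T"
begin

abbreviation orb :: "'g set \<Rightarrow> ('g,'x) gset" where "orb \<equiv> orbit G"
abbreviation base :: "'g set \<Rightarrow> 'x" where "base \<equiv> emb G"

text \<open>The choice in \<open>emb\<close> is sound because the power set of the finite group
  embeds into an infinite type.\<close>

lemma inj_emb: "inj_on (emb G :: 'g set \<Rightarrow> 'x) (Pow (carrier G))"
proof -
  have "\<exists>\<iota> :: 'g set \<Rightarrow> 'x. inj_on \<iota> (Pow (carrier G))"
    by (rule ex_inj_on_infinite) (simp_all add: finite_G infinite_x)
  then show ?thesis unfolding emb_def by (rule someI_ex)
qed

lemma unemb_emb: "C \<subseteq> carrier G \<Longrightarrow> unemb G (emb G C :: 'x) = C"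
  unfolding unemb_def by (rule inv_into_f_f[OF inj_emb]) simp

lemma emb_eq_iff: "C \<subseteq> carrier G \<Longrightarrow> D \<subseteq> carrier G \<Longrightarrow> (emb G C :: 'x) = emb G D \<longleftrightarrow> C = D"
  using inj_on_eq_iff[OF inj_emb] by auto

lemma orb_act: "C \<subseteq> carrier G \<Longrightarrow> snd (orb H) g (emb G C) = emb G (g <# C)"
  by (simp add: orbit_def unemb_emb)

lemma orb_elem: "x \<in> fst (orb H) \<longleftrightarrow> (\<exists>g\<in>carrier G. x = emb G (g <# H))"
  by (auto simp: orbit_def)

lemma is_gset_orb:
  assumes "subgroup H G"
  shows "is_gset G (orb H)"
proof -
  have H: "H \<subseteq> carrier G" using assms by (rule subgroup.subset)
  have "is_gset G (fst (orb H), snd (orb H))"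
  proof (rule is_gsetI)
    have "fst (orb H) = (\<lambda>g. emb G (g <# H)) ` carrier G" by (auto simp: orb_elem)
    then show "finite (fst (orb H))" using finite_G by simp
    show "snd (orb H) g x \<in> fst (orb H)" if g: "g \<in> carrier G" and x: "x \<in> fst (orb H)" for g x
    proof -
      obtain h where h: "h \<in> carrier G" "x = emb G (h <# H)" using x by (auto simp: orb_elem)
      then have "snd (orb H) g x = emb G ((g \<otimes> h) <# H)"
        using g H by (simp add: orb_act l_coset_subset_G lcos_m_assoc)
      then show ?thesis unfolding orb_elem using g h by blast
    qed
    show "snd (orb H) \<one> x = x" if "x \<in> fst (orb H)" for x
      using that H by (auto simp: orb_elem orb_act l_coset_subset_G lcos_mult_one)
    show "snd (orb H) (g \<otimes> h) x = snd (orb H) g (snd (orb H) h x)"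
      if gh: "g \<in> carrier G" "h \<in> carrier G" and x: "x \<in> fst (orb H)" for g h x
    proof -
      obtain u where u: "u \<in> carrier G" "x = emb G (u <# H)" using x by (auto simp: orb_elem)
      then show ?thesis
        using gh H by (simp add: orb_act l_coset_subset_G lcos_m_assoc[symmetric])
    qed
  qed
  then show ?thesis by simp
qed

lemma base_in_orb: "subgroup H G \<Longrightarrow> base H \<in> fst (orb H)"
  unfolding orb_elem using lcos_mult_one[OF subgroup.subset, of H] by (metis one_closed)

lemma orb_transitive:
  assumes "subgroup H G" "x \<in> fst (orb H)"
  shows "\<exists>g\<in>carrier G. x = snd (orb H) g (base H)"
  using assms orb_act[OF subgroup.subset, of H] by (auto simp: orb_elem)

lemma gmap_orb_eqI:
  assumes "subgroup H G" "gmap G (orb H) V f" "gmap G (orb H) V f'" "f (base H) = f' (base H)" "x \<in> fst (orb H)"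
  shows "f x = f' x"
proof -
  obtain g where "g \<in> carrier G" "x = snd (orb H) g (base H)"
    using orb_transitive[OF assms(1,5)] by blast
  then show ?thesis
    using gmapD(4)[OF assms(2)] gmapD(4)[OF assms(3)] base_in_orb[OF assms(1)] assms(4) by metis
qed

text \<open>Transitivity: the translates of a single value already fill the orbit.\<close>

lemma gmap_orb_surj:
  assumes H: "subgroup H G" and f: "gmap G V (orb H) f" and ne: "fst V \<noteq> {}"
  shows "f ` fst V = fst (orb H)"
proof
  show "f ` fst V \<subseteq> fst (orb H)" using gmapD(3)[OF f] by auto
  show "fst (orb H) \<subseteq> f ` fst V"
  proof
    fix y assume "y \<in> fst (orb H)"
    then obtain g where g: "g \<in> carrier G" "y = snd (orb H) g (base H)" using orb_transitive[OF H] by blast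
    obtain v where v: "v \<in> fst V" using ne by blast
    obtain h where h: "h \<in> carrier G" "f v = snd (orb H) h (base H)"
      using orb_transitive[OF H gmapD(3)[OF f v]] by blast
    note b = base_in_orb[OF H] and O = gmapD(2)[OF f] and V = gmapD(1)[OF f]
    have "snd (orb H) (inv h) (f v) = base H" using gset_inv_cancel(1)[OF O h(1) b] h by simp
    then have "y = f (snd V g (snd V (inv h) v))"
      using g gmapD(4)[OF f] v h is_gsetD(2)[OF V] by simp
    then show "y \<in> f ` fst V" using is_gsetD(2)[OF V] g h v by blast
  qed
qed

lemma stabilizer_subgroup:
  assumes "is_gset G V" "x \<in> fst V"
  shows "subgroup {g \<in> carrier G. snd V g x = x} G"
proof (rule subgroupI)
  show "{g \<in> carrier G. snd V g x = x} \<noteq> {}"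
    using is_gsetD(3)[OF assms] by (auto intro!: exI[of _ \<one>])
  show "inv a \<in> {g \<in> carrier G. snd V g x = x}" if "a \<in> {g \<in> carrier G. snd V g x = x}" for a
    using that gset_inv_cancel(1)[OF assms(1) _ assms(2), of a] by auto
  show "a \<otimes> b \<in> {g \<in> carrier G. snd V g x = x}"
    if "a \<in> {g \<in> carrier G. snd V g x = x}" "b \<in> {g \<in> carrier G. snd V g x = x}" for a b
    using that is_gsetD(4)[OF assms(1) _ _ assms(2), of a b] by auto
qed auto

text \<open>Orbit-stabilizer theorem: \<open>K\<close> is the stabilizer of \<open>x\<close>, and
  \<open>gK\<close> goes to \<open>g x\<close>.\<close>

lemma ex_orbit_map:
  fixes V :: "('g,'x) gset"
  assumes V: "is_gset G V" and x: "x \<in> fst V"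
  shows "\<exists>K \<phi>. subgroup K G \<and> gmap G (orb K) V \<phi> \<and> inj_on \<phi> (fst (orb K)) \<and> \<phi> (base K) = x
    \<and> \<phi> ` fst (orb K) = (\<lambda>g. snd V g x) ` carrier G"
proof -
  define K where "K = {g \<in> carrier G. snd V g x = x}"
  have K: "subgroup K G" unfolding K_def by (rule stabilizer_subgroup[OF assms])
  then interpret K: subgroup K G .
  have coset: "g <# K = h <# K \<longleftrightarrow> snd V g x = snd V h x" if g: "g \<in> carrier G" and h: "h \<in> carrier G" for g h
  proof
    assume "g <# K = h <# K"
    then have "g \<in> h <# K" using lcos_self[OF g K] by simp
    then obtain k where k: "k \<in> K" "g = h \<otimes> k" by (auto simp: l_coset_def)
    have "snd V k x = x" using k(1) unfolding K_def by blast
    then show "snd V g x = snd V h x"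
      using is_gsetD(4)[OF V h _ x, of k] k by simp
  next
    assume e: "snd V g x = snd V h x"
    have "snd V (inv g \<otimes> h) x = x"
      using is_gsetD(4)[OF V _ h x, of "inv g"] g e gset_inv_cancel(1)[OF V g x] by simp
    then have k: "inv g \<otimes> h \<in> K" unfolding K_def using g h by blast
    have "h = g \<otimes> (inv g \<otimes> h)" using g h by (simp add: m_assoc[symmetric])
    then have "h \<in> g <# K" using k unfolding l_coset_def by blast
    then show "g <# K = h <# K" using l_repr_independence[OF _ g K] by blast
  qed
  \<comment> \<open>The image is read off from a chosen representative of the coset;
    \<open>coset\<close> makes the choice immaterial.\<close>
  define \<phi> where "\<phi> = (\<lambda>y :: 'x. snd V (SOME g. g \<in> carrier G \<and> y = emb G (g <# K)) x)"
  have phi: "\<phi> (emb G (g <# K)) = snd V g x" if g: "g \<in> carrier G" for g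
  proof -
    define h where "h = (SOME h. h \<in> carrier G \<and> (emb G (g <# K) :: 'x) = emb G (h <# K))"
    have h: "h \<in> carrier G \<and> (emb G (g <# K) :: 'x) = emb G (h <# K)"
      unfolding h_def by (rule someI[of _ g]) (simp add: g)
    then have "g <# K = h <# K"
      using emb_eq_iff[of "g <# K" "h <# K"] g l_coset_subset_G[OF K.subset] by blast
    then have "snd V g x = snd V h x" using coset g h by blast
    then show ?thesis unfolding \<phi>_def h_def by simp
  qed
  have "gmap G (orb K) V \<phi>"
  proof (rule gmapI[OF is_gset_orb[OF K] V])
    show "\<phi> y \<in> fst V" if "y \<in> fst (orb K)" for y
      using that phi is_gsetD(2)[OF V _ x] by (auto simp: orb_elem)
    show "\<phi> (snd (orb K) g y) = snd V g (\<phi> y)" if "g \<in> carrier G" "y \<in> fst (orb K)" for g y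
    proof -
      obtain h where h: "h \<in> carrier G" "y = emb G (h <# K)" using \<open>y \<in> fst (orb K)\<close> by (auto simp: orb_elem)
      then have "snd (orb K) g y = emb G ((g \<otimes> h) <# K)"
        using that K.subset by (simp add: orb_act l_coset_subset_G lcos_m_assoc)
      then show ?thesis using that h phi is_gsetD(4)[OF V _ _ x] by simp
    qed
  qed
  moreover have "inj_on \<phi> (fst (orb K))"
  proof (rule inj_onI)
    fix y z assume "y \<in> fst (orb K)" "z \<in> fst (orb K)" and e: "\<phi> y = \<phi> z"
    then obtain g h where gh: "g \<in> carrier G" "y = emb G (g <# K)" "h \<in> carrier G" "z = emb G (h <# K)"
      by (auto simp: orb_elem)
    then have "g <# K = h <# K" using coset e phi by simp
    then show "y = z" using gh by simp
  qed
  moreover have "\<phi> (base K) = x"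
    using phi[of \<one>] is_gsetD(3)[OF V x] lcos_mult_one[OF K.subset] by simp
  moreover have "\<phi> ` fst (orb K) = (\<lambda>g. snd V g x) ` carrier G"
  proof -
    have "fst (orb K) = (\<lambda>g. emb G (g <# K)) ` carrier G" by (auto simp: orb_elem)
    then show ?thesis by (simp add: image_image phi)
  qed
  ultimately show ?thesis using K by blast
qed

text \<open>Removing one orbit lowers the cardinality, which drives induction over the orbits of a
  finite \<open>G\<close>-set.\<close>

lemma split_orbit:
  fixes V :: "('g,'x) gset"
  assumes V: "is_gset G V" and x: "x \<in> fst V"
  shows "\<exists>K B \<phi> j. subgroup K G \<and> is_sum G (orb K) B V \<phi> j \<and> card (fst B) < card (fst V)"
proof -
  obtain K \<phi> where K: "subgroup K G" and phi: "gmap G (orb K) V \<phi>" "inj_on \<phi> (fst (orb K))" "\<phi> (base K) = x"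
      "\<phi> ` fst (orb K) = (\<lambda>g. snd V g x) ` carrier G"
    using ex_orbit_map[OF assms] by blast
  define S where "S = fst V - (\<lambda>g. snd V g x) ` carrier G"
  have "snd V g y \<in> S" if g: "g \<in> carrier G" and y: "y \<in> S" for g y
  proof (rule ccontr)
    have yV: "y \<in> fst V" using y by (simp add: S_def)
    assume "snd V g y \<notin> S"
    then obtain h where h: "h \<in> carrier G" "snd V g y = snd V h x"
      using is_gsetD(2)[OF V g yV] by (auto simp: S_def)
    then have "y = snd V (inv g \<otimes> h) x"
      using gset_inv_cancel(1)[OF V g yV] is_gsetD(4)[OF V _ h(1) x, of "inv g"] g by simp
    then show False using y g h by (auto simp: S_def)
  qed
  then have gS: "is_gset G (S, snd V)"
    by (intro is_gset_subset[OF V]) (auto simp: S_def)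
  have sub: "(\<lambda>g. snd V g x) ` carrier G \<subseteq> fst V" using is_gsetD(2)[OF V _ x] by auto
  have "is_sum G (orb K) (S, snd V) V \<phi> (\<lambda>x. x)"
    unfolding is_sum_def using phi gmap_inclusion[OF V gS] sub by (auto simp: S_def)
  moreover have "x \<in> (\<lambda>g. snd V g x) ` carrier G"
    using phi(3,4) base_in_orb[OF K] by blast
  then have "card (fst (S, snd V)) < card (fst V)"
    using x is_gsetD(1)[OF V] by (intro psubset_card_mono) (auto simp: S_def)
  ultimately show ?thesis using K by blast
qed

text \<open>Orbits are connected: the summand that contains the image of the base point contains the
  whole image.\<close>

lemma gmap_orb_sum_cases:
  assumes K: "subgroup K G" and s: "is_sum G A B C i j" and f: "gmap G (orb K) C f"
  obtains f' where "gmap G (orb K) A f'" "\<And>y. y \<in> fst (orb K) \<Longrightarrow> i (f' y) = f y"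
  | f' where "gmap G (orb K) B f'" "\<And>y. y \<in> fst (orb K) \<Longrightarrow> j (f' y) = f y"
proof -
  have *: "\<exists>f'. gmap G (orb K) A f' \<and> (\<forall>y\<in>fst (orb K). i (f' y) = f y)"
    if b: "f (base K) \<in> i ` fst A" and i: "gmap G A C i" "inj_on i (fst A)" for A :: "('g,'x) gset" and i
  proof (rule gmap_factor_inj[OF f i])
    obtain a where a: "a \<in> fst A" "f (base K) = i a" using b by blast
    show "f ` fst (orb K) \<subseteq> i ` fst A"
    proof clarify
      fix y assume "y \<in> fst (orb K)"
      then obtain g where "g \<in> carrier G" "y = snd (orb K) g (base K)" using orb_transitive[OF K] by blast
      then have "f y = i (snd A g a)"
        using gmapD(4)[OF f _ base_in_orb[OF K]] gmapD(4)[OF i(1) _ a(1)] a(2) by simp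
      then show "f y \<in> i ` fst A" using is_gsetD(2)[OF gmapD(1)[OF i(1)] \<open>g \<in> carrier G\<close> a(1)] by blast
    qed
  qed
  note s' = is_sumD[OF s]
  have "f (base K) \<in> i ` fst A \<union> j ` fst B" using gmapD(3)[OF f base_in_orb[OF K]] s'(6) by simp
  then show thesis
    using *[OF _ s'(1,3)] *[OF _ s'(2,4)] that by blast
qed

subsection \<open>Additivity\<close>

abbreviation rng :: "('g,'x) gset \<Rightarrow> 'r ring" where "rng \<equiv> tT T"
abbreviation res :: "('g,'x) gset \<Rightarrow> ('g,'x) gset \<Rightarrow> ('x \<Rightarrow> 'x) \<Rightarrow> 'r \<Rightarrow> 'r" where "res \<equiv> tres T"
abbreviation tra :: "('g,'x) gset \<Rightarrow> ('g,'x) gset \<Rightarrow> ('x \<Rightarrow> 'x) \<Rightarrow> 'r \<Rightarrow> 'r" where "tra \<equiv> ttr T"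
abbreviation nrm :: "('g,'x) gset \<Rightarrow> ('g,'x) gset \<Rightarrow> ('x \<Rightarrow> 'x) \<Rightarrow> 'r \<Rightarrow> 'r" where "nrm \<equiv> tnm T"

lemmas tambara_conjs0 = tambara[unfolded tambara_def]
lemmas tambara_conjs1 = tambara_conjs0[THEN conjunct2]
lemmas tambara_conjs2 = tambara_conjs1[THEN conjunct2]
lemmas tambara_conjs3 = tambara_conjs2[THEN conjunct2]
lemmas tambara_conjs4 = tambara_conjs3[THEN conjunct2]
lemmas tambara_conjs5 = tambara_conjs4[THEN conjunct2]
lemmas tambara_conjs6 = tambara_conjs5[THEN conjunct2]
lemmas tambara_conjs7 = tambara_conjs6[THEN conjunct2]
lemmas tambara_conjs8 = tambara_conjs7[THEN conjunct2]
lemmas tambara_conjs9 = tambara_conjs8[THEN conjunct2]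
lemmas tambara_conjs10 = tambara_conjs9[THEN conjunct2]
lemmas tambara_conjs11 = tambara_conjs10[THEN conjunct2]
lemmas tambara_conjs12 = tambara_conjs11[THEN conjunct2]
lemmas tambara_conjs13 = tambara_conjs12[THEN conjunct2]
lemmas tambara_conjs14 = tambara_conjs13[THEN conjunct2]
lemmas tambara_conjs15 = tambara_conjs14[THEN conjunct2]
lemmas tambara_conjs16 = tambara_conjs15[THEN conjunct2]

lemma cring_rng: "is_gset G V \<Longrightarrow> cring (rng V)"
  using tambara_conjs0[THEN conjunct1, rule_format] by blast

lemma res_hom: "gmap G V Y f \<Longrightarrow> res V Y f \<in> ring_hom (rng Y) (rng V)"
  using tambara_conjs1[THEN conjunct1, rule_format] by blast

lemma res_ring:
  assumes "gmap G V Y f"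
  shows "a \<in> carrier (rng Y) \<Longrightarrow> res V Y f a \<in> carrier (rng V)"
    and "a \<in> carrier (rng Y) \<Longrightarrow> b \<in> carrier (rng Y) \<Longrightarrow>
      res V Y f (a \<otimes>\<^bsub>rng Y\<^esub> b) = res V Y f a \<otimes>\<^bsub>rng V\<^esub> res V Y f b"
    and "a \<in> carrier (rng Y) \<Longrightarrow> b \<in> carrier (rng Y) \<Longrightarrow>
      res V Y f (a \<oplus>\<^bsub>rng Y\<^esub> b) = res V Y f a \<oplus>\<^bsub>rng V\<^esub> res V Y f b"
    and "res V Y f \<one>\<^bsub>rng Y\<^esub> = \<one>\<^bsub>rng V\<^esub>"
  using res_hom[OF assms] by (auto simp: ring_hom_def)

lemma res_id: "is_gset G V \<Longrightarrow> a \<in> carrier (rng V) \<Longrightarrow> res V V (\<lambda>x. x) a = a"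
  using tambara_conjs2[THEN conjunct1, rule_format] by blast

lemma res_comp: "gmap G V Y f \<Longrightarrow> gmap G Y Z g \<Longrightarrow> a \<in> carrier (rng Z) \<Longrightarrow>
    res V Z (g \<circ> f) a = res V Y f (res Y Z g a)"
  using tambara_conjs3[THEN conjunct1, rule_format] by blast

lemma res_cong:
  assumes "gmap G V Y f" "\<And>x. x \<in> fst V \<Longrightarrow> f x = f' x" "a \<in> carrier (rng Y)"
  shows "res V Y f a = res V Y f' a"
proof -
  have "\<forall>x\<in>fst V. f x = f' x" using assms(2) by blast
  then show ?thesis
    using tambara_conjs4[THEN conjunct1, rule_format] assms(1,3) by blast
qed

lemma tra_closed: "gmap G V Y f \<Longrightarrow> a \<in> carrier (rng V) \<Longrightarrow> tra V Y f a \<in> carrier (rng Y)"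
  using tambara_conjs5[THEN conjunct1, rule_format] by blast

lemma tra_add: "gmap G V Y f \<Longrightarrow> a \<in> carrier (rng V) \<Longrightarrow> b \<in> carrier (rng V) \<Longrightarrow>
    tra V Y f (a \<oplus>\<^bsub>rng V\<^esub> b) = tra V Y f a \<oplus>\<^bsub>rng Y\<^esub> tra V Y f b"
  using tambara_conjs5[THEN conjunct1, rule_format] by blast

lemma tra_zero: "gmap G V Y f \<Longrightarrow> tra V Y f \<zero>\<^bsub>rng V\<^esub> = \<zero>\<^bsub>rng Y\<^esub>"
  using tambara_conjs5[THEN conjunct1, rule_format] by blast

lemma tra_id: "is_gset G V \<Longrightarrow> a \<in> carrier (rng V) \<Longrightarrow> tra V V (\<lambda>x. x) a = a"
  using tambara_conjs6[THEN conjunct1, rule_format] by blast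

lemma tra_comp: "gmap G V Y f \<Longrightarrow> gmap G Y Z g \<Longrightarrow> a \<in> carrier (rng V) \<Longrightarrow>
    tra V Z (g \<circ> f) a = tra Y Z g (tra V Y f a)"
  using tambara_conjs7[THEN conjunct1, rule_format] by blast

lemma tra_cong:
  assumes "gmap G V Y f" "\<And>x. x \<in> fst V \<Longrightarrow> f x = f' x" "a \<in> carrier (rng V)"
  shows "tra V Y f a = tra V Y f' a"
proof -
  have "\<forall>x\<in>fst V. f x = f' x" using assms(2) by blast
  then show ?thesis
    using tambara_conjs8[THEN conjunct1, rule_format] assms(1,3) by blast
qed

lemma nrm_closed: "gmap G V Y f \<Longrightarrow> a \<in> carrier (rng V) \<Longrightarrow> nrm V Y f a \<in> carrier (rng Y)"
  using tambara_conjs9[THEN conjunct1, rule_format] by blast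

lemma nrm_mult: "gmap G V Y f \<Longrightarrow> a \<in> carrier (rng V) \<Longrightarrow> b \<in> carrier (rng V) \<Longrightarrow>
    nrm V Y f (a \<otimes>\<^bsub>rng V\<^esub> b) = nrm V Y f a \<otimes>\<^bsub>rng Y\<^esub> nrm V Y f b"
  using tambara_conjs9[THEN conjunct1, rule_format] by blast

lemma nrm_one: "gmap G V Y f \<Longrightarrow> nrm V Y f \<one>\<^bsub>rng V\<^esub> = \<one>\<^bsub>rng Y\<^esub>"
  using tambara_conjs9[THEN conjunct1, rule_format] by blast

lemma nrm_id: "is_gset G V \<Longrightarrow> a \<in> carrier (rng V) \<Longrightarrow> nrm V V (\<lambda>x. x) a = a"
  using tambara_conjs10[THEN conjunct1, rule_format] by blast

lemma nrm_comp: "gmap G V Y f \<Longrightarrow> gmap G Y Z g \<Longrightarrow> a \<in> carrier (rng V) \<Longrightarrow>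
    nrm V Z (g \<circ> f) a = nrm Y Z g (nrm V Y f a)"
  using tambara_conjs11[THEN conjunct1, rule_format] by blast

lemma nrm_cong:
  assumes "gmap G V Y f" "\<And>x. x \<in> fst V \<Longrightarrow> f x = f' x" "a \<in> carrier (rng V)"
  shows "nrm V Y f a = nrm V Y f' a"
proof -
  have "\<forall>x\<in>fst V. f x = f' x" using assms(2) by blast
  then show ?thesis
    using tambara_conjs12[THEN conjunct1, rule_format] assms(1,3) by blast
qed

lemma res_tra: "is_pullback G V Y Z W f g f' g' \<Longrightarrow> a \<in> carrier (rng V) \<Longrightarrow>
    res Z Y g (tra V Y f a) = tra W Z f' (res W V g' a)"
  using tambara_conjs13[THEN conjunct1, rule_format] by blast

lemma res_nrm: "is_pullback G V Y Z W f g f' g' \<Longrightarrow> a \<in> carrier (rng V) \<Longrightarrow>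
    res Z Y g (nrm V Y f a) = nrm W Z f' (res W V g' a)"
  using tambara_conjs13[THEN conjunct1, rule_format] by blast

lemma card_rng_empty: "is_gset G V \<Longrightarrow> fst V = {} \<Longrightarrow> card (carrier (rng V)) = 1"
  using tambara_conjs14[THEN conjunct1, rule_format] by blast

lemma rng_subsets_bij:
  "is_gset G V \<Longrightarrow> is_gset G (S1, snd V) \<Longrightarrow> is_gset G (S2, snd V) \<Longrightarrow>
    S1 \<union> S2 = fst V \<Longrightarrow> S1 \<inter> S2 = {} \<Longrightarrow>
    bij_betw (\<lambda>a. (res (S1, snd V) V (\<lambda>x. x) a, res (S2, snd V) V (\<lambda>x. x) a))
        (carrier (rng V)) (carrier (rng (S1, snd V)) \<times> carrier (rng (S2, snd V)))"
  using tambara_conjs15[THEN conjunct1, rule_format] by blast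

lemma nrm_tra: "is_exp_diagram G A V Y Z Xp q p r p' \<pi> e \<Longrightarrow> a \<in> carrier (rng A) \<Longrightarrow>
    nrm V Y p (tra A V q a) = tra Z Y r (nrm Xp Z p' (res Xp A e a))"
  using tambara_conjs16[rule_format] by blast

lemma rng_empty_unique:
  assumes "is_gset G V" "fst V = {}" "a \<in> carrier (rng V)" "b \<in> carrier (rng V)"
  shows "a = b"
  using card_rng_empty[OF assms(1,2)] assms(3,4) by (auto simp: card_1_singleton_iff)

lemma pullback_inj:
  assumes i: "gmap G A C i" "inj_on i (fst A)"
  shows "is_pullback G A C A A i i (\<lambda>x. x) (\<lambda>x. x)"
  unfolding is_pullback_def
  using i gmap_id[OF gmapD(1)[OF i(1)]] by (auto simp: bij_betw_def inj_on_def)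

lemma res_tra_inj:
  assumes "gmap G A C i" "inj_on i (fst A)" "a \<in> carrier (rng A)"
  shows "res A C i (tra A C i a) = a"
  using res_tra[OF pullback_inj[OF assms(1,2)] assms(3)] gmapD(1)[OF assms(1)] assms(3)
  by (simp add: res_id tra_id)

lemma res_nrm_inj:
  assumes "gmap G A C i" "inj_on i (fst A)" "a \<in> carrier (rng A)"
  shows "res A C i (nrm A C i a) = a"
  using res_nrm[OF pullback_inj[OF assms(1,2)] assms(3)] gmapD(1)[OF assms(1)] assms(3)
  by (simp add: res_id nrm_id)

lemma pullback_disjoint:
  assumes "gmap G A C i" "gmap G B C j" "i ` fst A \<inter> j ` fst B = {}"
  shows "is_pullback G B C A ({}, snd A) j i (\<lambda>x. x) (\<lambda>x. x)"
proof -
  have "{(z, x). z \<in> fst A \<and> x \<in> fst B \<and> i z = j x} = {}"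
    using assms(3) by blast
  then show ?thesis
    unfolding is_pullback_def
    using assms(1,2) gmap_empty[OF gmapD(1)[OF assms(1)]] gmap_empty[OF gmapD(1)[OF assms(2)]]
    by (simp add: bij_betw_def)
qed

text \<open>Beck-Chevalley over the empty pullback: \<open>T\<close> of the empty set is the zero
  ring, and a transfer sends its only element, zero, to zero.\<close>

lemma res_tra_disjoint:
  assumes "gmap G A C i" "gmap G B C j" "i ` fst A \<inter> j ` fst B = {}" "b \<in> carrier (rng B)"
  shows "res A C i (tra B C j b) = \<zero>\<^bsub>rng A\<^esub>"
proof -
  let ?W = "({}, snd A) :: ('g,'x) gset"
  have W: "is_gset G ?W" by (rule is_gset_empty)
  interpret W: cring "rng ?W" by (rule cring_rng[OF W])
  have "res ?W B (\<lambda>x. x) b = \<zero>\<^bsub>rng ?W\<^esub>"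
    by (rule rng_empty_unique[OF W])
      (use res_ring(1)[OF gmap_empty[OF gmapD(1)[OF assms(2)]] assms(4)] in auto)
  then show ?thesis
    using res_tra[OF pullback_disjoint[OF assms(1-3)] assms(4)]
      tra_zero[OF gmap_empty[OF gmapD(1)[OF assms(1)]]] by simp
qed

lemma res_nrm_disjoint:
  assumes "gmap G A C i" "gmap G B C j" "i ` fst A \<inter> j ` fst B = {}" "b \<in> carrier (rng B)"
  shows "res A C i (nrm B C j b) = \<one>\<^bsub>rng A\<^esub>"
proof -
  let ?W = "({}, snd A) :: ('g,'x) gset"
  have W: "is_gset G ?W" by (rule is_gset_empty)
  interpret W: cring "rng ?W" by (rule cring_rng[OF W])
  \<comment> \<open>In the zero ring the only element is also one, and under this name the norm
    preserves it.\<close>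
  have "res ?W B (\<lambda>x. x) b = \<one>\<^bsub>rng ?W\<^esub>"
    by (rule rng_empty_unique[OF W])
      (use res_ring(1)[OF gmap_empty[OF gmapD(1)[OF assms(2)]] assms(4)] in auto)
  then show ?thesis
    using res_nrm[OF pullback_disjoint[OF assms(1-3)] assms(4)]
      nrm_one[OF gmap_empty[OF gmapD(1)[OF assms(1)]]] by simp
qed

text \<open>The closure conditions of an ideal treat conjugations as restrictions only; this turns
  transfers and norms along an isomorphism into restrictions along its inverse.\<close>

lemma tra_iso:
  assumes f: "gmap G V Y f" and f': "gmap G Y V f'"
    and inv: "\<And>x. x \<in> fst V \<Longrightarrow> f' (f x) = x" "\<And>y. y \<in> fst Y \<Longrightarrow> f (f' y) = y"
    and a: "a \<in> carrier (rng V)"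
  shows "tra V Y f a = res Y V f' a" "nrm V Y f a = res Y V f' a"
proof -
  have inj: "inj_on f (fst V)" using inv(1) by (rule inj_on_inverseI)
  have *: "res Y V f' (res V Y f b) = b" if "b \<in> carrier (rng Y)" for b
  proof -
    have "res Y V f' (res V Y f b) = res Y Y (f \<circ> f') b"
      using res_comp[OF f' f that] by simp
    also have "\<dots> = b"
      using res_cong[OF gmap_comp[OF f' f] _ that, of "\<lambda>x. x"] inv(2) res_id[OF gmapD(2)[OF f] that] by simp
    finally show ?thesis .
  qed
  show "tra V Y f a = res Y V f' a"
    using *[OF tra_closed[OF f a]] res_tra_inj[OF f inj a] by simp
  show "nrm V Y f a = res Y V f' a"
    using *[OF nrm_closed[OF f a]] res_nrm_inj[OF f inj a] by simp
qed

text \<open>The additivity axiom speaks of stable subsets and their inclusions; an embedding is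
  replaced by its image to reach it.\<close>

lemma corestrict_iso:
  assumes i: "gmap G A C i" "inj_on i (fst A)"
  shows "\<exists>i'. gmap G A (i ` fst A, snd C) i \<and> gmap G (i ` fst A, snd C) A i'
    \<and> (\<forall>a\<in>fst A. i' (i a) = a) \<and> (\<forall>c\<in>i ` fst A. i (i' c) = c)"
proof -
  have sub: "i ` fst A \<subseteq> fst C" using gmapD(3)[OF i(1)] by auto
  have gS: "is_gset G (i ` fst A, snd C)"
  proof (rule is_gset_subset[OF gmapD(2)[OF i(1)] sub])
    show "snd C g c \<in> i ` fst A" if g: "g \<in> carrier G" and c: "c \<in> i ` fst A" for g c
    proof -
      obtain a where a: "a \<in> fst A" "c = i a" using c by blast
      then have "snd C g c = i (snd A g a)" using gmapD(4)[OF i(1) g] by simp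
      then show ?thesis using is_gsetD(2)[OF gmapD(1)[OF i(1)] g a(1)] by blast
    qed
  qed
  have 1: "gmap G A (i ` fst A, snd C) i"
    using gmapD[OF i(1)] gS by (intro gmapI) auto
  obtain i' where i': "gmap G (i ` fst A, snd C) A i'" "\<forall>c\<in>i ` fst A. i (i' c) = c"
    using gmap_factor_inj[OF gmap_inclusion[OF gmapD(2)[OF i(1)] gS sub] i] by auto
  have "i' (i a) = a" if "a \<in> fst A" for a
    using i'(2) that gmapD(3)[OF i'(1), of "i a"] by (intro inj_onD[OF i(2), of "i' (i a)" a]) simp_all
  then show ?thesis using 1 i' by blast
qed

text \<open>Transport of the additivity axiom along the isomorphisms of \<open>A\<close> and
  \<open>B\<close> with their images; together the two claims say that \<open>T(C)\<close> is the
  product of \<open>T(A)\<close> and \<open>T(B)\<close>.\<close>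

lemma sum_separate_glue:
  assumes s: "is_sum G A B C i j"
  shows "c \<in> carrier (rng C) \<Longrightarrow> d \<in> carrier (rng C) \<Longrightarrow> res A C i c = res A C i d \<Longrightarrow>
      res B C j c = res B C j d \<Longrightarrow> c = d"
    and "u \<in> carrier (rng A) \<Longrightarrow> v \<in> carrier (rng B) \<Longrightarrow>
      \<exists>c\<in>carrier (rng C). res A C i c = u \<and> res B C j c = v"
proof -
  note s' = is_sumD[OF s]
  define A' where "A' = (i ` fst A, snd C)"
  define B' where "B' = (j ` fst B, snd C)"
  obtain i' where i': "gmap G A A' i" "gmap G A' A i'" "\<forall>a\<in>fst A. i' (i a) = a" "\<forall>c\<in>i ` fst A. i (i' c) = c"
    using corestrict_iso[OF s'(1,3)] unfolding A'_def by blast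
  obtain j' where j': "gmap G B B' j" "gmap G B' B j'" "\<forall>a\<in>fst B. j' (j a) = a" "\<forall>c\<in>j ` fst B. j (j' c) = c"
    using corestrict_iso[OF s'(2,4)] unfolding B'_def by blast
  have incA: "gmap G A' C (\<lambda>x. x)" and incB: "gmap G B' C (\<lambda>x. x)"
    using s'(6) gmapD(2)[OF i'(1)] gmapD(2)[OF j'(1)] unfolding A'_def B'_def
    by (auto intro!: gmap_inclusion[OF s'(9)])
  have bij: "bij_betw (\<lambda>a. (res A' C (\<lambda>x. x) a, res B' C (\<lambda>x. x) a))
        (carrier (rng C)) (carrier (rng A') \<times> carrier (rng B'))"
    unfolding A'_def B'_def
    using rng_subsets_bij[OF s'(9)] gmapD(2)[OF i'(1)] gmapD(2)[OF j'(1)] s'(5,6)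
    unfolding A'_def B'_def by blast
  have to_sub: "res A' C (\<lambda>x. x) c = res A' A i' (res A C i c)" "res B' C (\<lambda>x. x) c = res B' B j' (res B C j c)"
    if c: "c \<in> carrier (rng C)" for c
  proof -
    have "res A' C (i \<circ> i') c = res A' C (\<lambda>x. x) c" "res B' C (j \<circ> j') c = res B' C (\<lambda>x. x) c"
      using i'(4) j'(4) gmap_comp[OF i'(2) s'(1)] gmap_comp[OF j'(2) s'(2)] c
      by (auto intro!: res_cong simp: A'_def B'_def)
    then show "res A' C (\<lambda>x. x) c = res A' A i' (res A C i c)" "res B' C (\<lambda>x. x) c = res B' B j' (res B C j c)"
      using res_comp[OF i'(2) s'(1) c] res_comp[OF j'(2) s'(2) c] by simp_all
  qed
  show "c = d" if "c \<in> carrier (rng C)" "d \<in> carrier (rng C)" "res A C i c = res A C i d" "res B C j c = res B C j d"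
    using bij to_sub that unfolding bij_betw_def inj_on_def by simp
  show "\<exists>c\<in>carrier (rng C). res A C i c = u \<and> res B C j c = v"
    if u: "u \<in> carrier (rng A)" and v: "v \<in> carrier (rng B)"
  proof -
    have "(res A' A i' u, res B' B j' v) \<in> carrier (rng A') \<times> carrier (rng B')"
      using res_ring(1)[OF i'(2) u] res_ring(1)[OF j'(2) v] by simp
    then obtain c where c: "c \<in> carrier (rng C)"
        "res A' C (\<lambda>x. x) c = res A' A i' u" "res B' C (\<lambda>x. x) c = res B' B j' v"
      using bij unfolding bij_betw_def by (smt (verit, best) image_iff prod.inject)
    have "res A C i c = res A A' i (res A' A i' u)"
      using res_comp[OF i'(1) incA c(1)] c(2) by (simp add: comp_def)
    also have "\<dots> = u"
      using res_comp[OF i'(1,2) u] res_cong[OF gmap_comp[OF i'(1,2)], of "\<lambda>x. x" u] i'(3) u res_id[OF s'(7)] by simp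
    finally have 1: "res A C i c = u" .
    have "res B C j c = res B B' j (res B' B j' v)"
      using res_comp[OF j'(1) incB c(1)] c(3) by (simp add: comp_def)
    also have "\<dots> = v"
      using res_comp[OF j'(1,2) v] res_cong[OF gmap_comp[OF j'(1,2)], of "\<lambda>x. x" v] j'(3) v res_id[OF s'(8)] by simp
    finally show ?thesis using 1 c(1) by blast
  qed
qed

text \<open>\<open>c\<close> is the sum of the transfers of its two parts, as is seen after
  restricting to \<open>A\<close> and to \<open>B\<close>: the own part comes back and the other
  part gives zero.\<close>

lemma tra_sum:
  assumes s: "is_sum G A B C i j" and q: "gmap G C V q" and c: "c \<in> carrier (rng C)"
  shows "tra C V q c = tra A V (q \<circ> i) (res A C i c) \<oplus>\<^bsub>rng V\<^esub> tra B V (q \<circ> j) (res B C j c)"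
proof -
  note s' = is_sumD[OF s]
  interpret A: cring "rng A" by (rule cring_rng[OF s'(7)])
  interpret B: cring "rng B" by (rule cring_rng[OF s'(8)])
  interpret C: cring "rng C" by (rule cring_rng[OF s'(9)])
  have a: "res A C i c \<in> carrier (rng A)" and b: "res B C j c \<in> carrier (rng B)"
    using res_ring(1)[OF s'(1) c] res_ring(1)[OF s'(2) c] .
  note ta = tra_closed[OF s'(1) a] and tb = tra_closed[OF s'(2) b]
  have dis: "j ` fst B \<inter> i ` fst A = {}" using s'(5) by blast
  have "c = tra A C i (res A C i c) \<oplus>\<^bsub>rng C\<^esub> tra B C j (res B C j c)"
  proof (rule sum_separate_glue(1)[OF s c])
    show "res A C i c = res A C i (tra A C i (res A C i c) \<oplus>\<^bsub>rng C\<^esub> tra B C j (res B C j c))"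
      using res_ring(3)[OF s'(1) ta tb] res_tra_inj[OF s'(1,3) a] res_tra_disjoint[OF s'(1,2,5) b] a by simp
    show "res B C j c = res B C j (tra A C i (res A C i c) \<oplus>\<^bsub>rng C\<^esub> tra B C j (res B C j c))"
      using res_ring(3)[OF s'(2) ta tb] res_tra_inj[OF s'(2,4) b] res_tra_disjoint[OF s'(2,1) dis a] b by simp
  qed (use ta tb in simp)
  then show ?thesis
    using tra_add[OF q ta tb] tra_comp[OF s'(1) q a] tra_comp[OF s'(2) q b] by simp
qed

text \<open>As for \<open>tra_sum\<close>, with a product in place of the sum: the part on the other
  summand now restricts to one.\<close>

lemma nrm_sum:
  assumes s: "is_sum G A B C i j" and q: "gmap G C V q" and c: "c \<in> carrier (rng C)"
  shows "nrm C V q c = nrm A V (q \<circ> i) (res A C i c) \<otimes>\<^bsub>rng V\<^esub> nrm B V (q \<circ> j) (res B C j c)"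
proof -
  note s' = is_sumD[OF s]
  interpret A: cring "rng A" by (rule cring_rng[OF s'(7)])
  interpret B: cring "rng B" by (rule cring_rng[OF s'(8)])
  interpret C: cring "rng C" by (rule cring_rng[OF s'(9)])
  have a: "res A C i c \<in> carrier (rng A)" and b: "res B C j c \<in> carrier (rng B)"
    using res_ring(1)[OF s'(1) c] res_ring(1)[OF s'(2) c] .
  note ta = nrm_closed[OF s'(1) a] and tb = nrm_closed[OF s'(2) b]
  have dis: "j ` fst B \<inter> i ` fst A = {}" using s'(5) by blast
  have "c = nrm A C i (res A C i c) \<otimes>\<^bsub>rng C\<^esub> nrm B C j (res B C j c)"
  proof (rule sum_separate_glue(1)[OF s c])
    show "res A C i c = res A C i (nrm A C i (res A C i c) \<otimes>\<^bsub>rng C\<^esub> nrm B C j (res B C j c))"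
      using res_ring(2)[OF s'(1) ta tb] res_nrm_inj[OF s'(1,3) a] res_nrm_disjoint[OF s'(1,2,5) b] a by simp
    show "res B C j c = res B C j (nrm A C i (res A C i c) \<otimes>\<^bsub>rng C\<^esub> nrm B C j (res B C j c))"
      using res_ring(2)[OF s'(2) ta tb] res_nrm_inj[OF s'(2,4) b] res_nrm_disjoint[OF s'(2,1) dis a] b by simp
  qed (use ta tb in simp)
  then show ?thesis
    using nrm_mult[OF q ta tb] nrm_comp[OF s'(1) q a] nrm_comp[OF s'(2) q b] by simp
qed

subsection \<open>Tambara ideals along orbit maps\<close>

lemma coset_eq_iff:
  assumes "subgroup H G" "g \<in> carrier G" "x \<in> carrier G"
  shows "x <# H = g <# H \<longleftrightarrow> x \<in> g <# H"
  using l_repr_independence[of x g H] lcos_self[of x H] assms by auto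

text \<open>\<open>gHg^-1\<close> is the stabilizer of the coset \<open>gH\<close>; it therefore
  contains every \<open>K\<close> for which an orbit map takes the base point of \<open>G/K\<close>
  to \<open>gH\<close>.\<close>

lemma mem_conjg_iff:
  assumes H: "subgroup H G" and g: "g \<in> carrier G"
  shows "x \<in> conjg G g H \<longleftrightarrow> x \<in> carrier G \<and> x <# (g <# H) = g <# H"
proof -
  note Hc = subgroup.subset[OF H]
  have "x \<in> conjg G g H \<longleftrightarrow> x \<in> carrier G \<and> x \<otimes> g \<in> g <# H"
  proof
    assume "x \<in> conjg G g H"
    then obtain u where u: "u \<in> g <# H" "x = u \<otimes> inv g" by (auto simp: conjg_def r_coset_def)
    then have "u \<in> carrier G" using l_coset_subset_G[OF Hc g] by blast
    then show "x \<in> carrier G \<and> x \<otimes> g \<in> g <# H" using u g by (simp add: m_assoc)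
  next
    assume x: "x \<in> carrier G \<and> x \<otimes> g \<in> g <# H"
    then have "x = (x \<otimes> g) \<otimes> inv g" using g by (simp add: m_assoc)
    then show "x \<in> conjg G g H" using x unfolding conjg_def r_coset_def by blast
  qed
  also have "\<dots> \<longleftrightarrow> x \<in> carrier G \<and> x <# (g <# H) = g <# H"
    using coset_eq_iff[OF H g, of "x \<otimes> g"] lcos_m_assoc[OF Hc _ g, of x] g by auto
  finally show ?thesis .
qed

lemma conjg_subgroup:
  assumes H: "subgroup H G" and g: "g \<in> carrier G"
  shows "subgroup (conjg G g H) G"
proof -
  have gH: "g <# H \<subseteq> carrier G" using l_coset_subset_G[OF subgroup.subset[OF H] g] .
  have e: "emb G (g <# H) \<in> fst (orb H)" using g by (auto simp: orb_elem)
  have "conjg G g H = {x \<in> carrier G. snd (orb H) x (emb G (g <# H)) = emb G (g <# H)}"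
    using mem_conjg_iff[OF H g] gH by (auto simp: orb_act emb_eq_iff l_coset_subset_G)
  then show ?thesis using stabilizer_subgroup[OF is_gset_orb[OF H] e] by simp
qed

lemma conjg_inv:
  assumes H: "subgroup H G" and g: "g \<in> carrier G"
  shows "conjg G (inv g) (conjg G g H) = H"
proof -
  note Hc = subgroup.subset[OF H]
  have "inv g <# ((g <# H) #> inv g) = H #> inv g"
    using g Hc by (simp add: coset_assoc l_coset_subset_G lcos_m_assoc lcos_mult_one)
  then show ?thesis
    using g Hc by (simp add: conjg_def coset_mult_assoc)
qed

text \<open>The condition on \<open>K\<close> gives \<open>K g H = g H\<close>, so \<open>uK\<close>
  is sent to \<open>u g H\<close>.\<close>

lemma gmap_cmap:
  assumes K: "subgroup K G" and H: "subgroup H G" and g: "g \<in> carrier G"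
    and stab: "\<And>k. k \<in> K \<Longrightarrow> k <# (g <# H) = g <# H"
  shows "gmap G (orb K) (orb H) (cmap G (g <# H))" "cmap G (g <# H) (base K) = emb G (g <# H)"
proof -
  note Kc = subgroup.subset[OF K] and gH = l_coset_subset_G[OF subgroup.subset[OF H] g]
  have "K <#> (g <# H) = (\<Union>k\<in>K. k <# (g <# H))" by (auto simp: set_mult_def l_coset_def)
  also have "\<dots> = g <# H" using stab subgroup.one_closed[OF K] by auto
  finally have KS: "K <#> (g <# H) = g <# H" .
  have val: "cmap G (g <# H) (base (u <# K)) = base (u <# (g <# H))" if "u \<in> carrier G" for u
    using that by (simp add: cmap_def unemb_emb l_coset_subset_G Kc setmult_lcos_assoc gH KS)
  show "gmap G (orb K) (orb H) (cmap G (g <# H))"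
  proof (rule gmapI[OF is_gset_orb[OF K] is_gset_orb[OF H]])
    show "cmap G (g <# H) x \<in> fst (orb H)" if "x \<in> fst (orb K)" for x
      using that val g subgroup.subset[OF H] by (auto simp: orb_elem lcos_m_assoc)
    show "cmap G (g <# H) (snd (orb K) v x) = snd (orb H) v (cmap G (g <# H) x)"
      if v: "v \<in> carrier G" and x: "x \<in> fst (orb K)" for v x
    proof -
      obtain u where u: "u \<in> carrier G" "x = emb G (u <# K)" using x by (auto simp: orb_elem)
      have "snd (orb K) v x = emb G ((v \<otimes> u) <# K)"
        using u v Kc by (simp add: orb_act l_coset_subset_G lcos_m_assoc)
      then show ?thesis
        using u v val[OF u(1)] val[of "v \<otimes> u"] gH
        by (simp add: orb_act l_coset_subset_G lcos_m_assoc[symmetric])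
    qed
  qed
  show "cmap G (g <# H) (base K) = emb G (g <# H)"
    using val[of \<one>] Kc gH by (simp add: lcos_mult_one)
qed

lemma gmap_cmap_subset:
  assumes "subgroup K G" "subgroup H G" "K \<subseteq> H"
  shows "gmap G (orb K) (orb H) (cmap G H)" "cmap G H (base K) = base H"
proof -
  have H1: "\<one> <# H = H" using lcos_mult_one[OF subgroup.subset[OF assms(2)]] .
  have "k <# (\<one> <# H) = \<one> <# H" if "k \<in> K" for k
    using coset_eq_iff[OF assms(2), of \<one> k] that assms(3) subgroup.subset[OF assms(2)] H1 by auto
  then show "gmap G (orb K) (orb H) (cmap G H)" "cmap G H (base K) = base H"
    using gmap_cmap[OF assms(1,2) one_closed] H1 by auto
qed

lemma gmap_cmap_conjg:
  assumes "subgroup H G" "g \<in> carrier G"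
  shows "gmap G (orb (conjg G g H)) (orb H) (cmap G (g <# H))"
    "cmap G (g <# H) (base (conjg G g H)) = emb G (g <# H)"
  using gmap_cmap[OF conjg_subgroup[OF assms] assms] mem_conjg_iff[OF assms] by blast+

text \<open>An endomorphism of an orbit that fixes the base point is the identity.\<close>

lemma cmap_conjg_inverse:
  assumes H: "subgroup H G" and g: "g \<in> carrier G" and x: "x \<in> fst (orb (conjg G g H))"
  shows "cmap G (inv g <# conjg G g H) (cmap G (g <# H) x) = x"
proof -
  let ?L = "conjg G g H"
  note L = conjg_subgroup[OF H g]
  have c: "gmap G (orb ?L) (orb H) (cmap G (g <# H))" "cmap G (g <# H) (base ?L) = emb G (g <# H)"
    using gmap_cmap_conjg[OF H g] by blast+
  have d: "gmap G (orb H) (orb ?L) (cmap G (inv g <# ?L))" "cmap G (inv g <# ?L) (base H) = emb G (inv g <# ?L)"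
    using gmap_cmap_conjg[OF L inv_closed[OF g]] conjg_inv[OF H g] by simp_all
  have "cmap G (inv g <# ?L) (emb G (g <# H)) = snd (orb ?L) g (emb G (inv g <# ?L))"
    using gmapD(4)[OF d(1) g base_in_orb[OF H]] d(2) subgroup.subset[OF H] by (simp add: orb_act)
  also have "\<dots> = base ?L"
    using g subgroup.subset[OF L] by (simp add: orb_act l_coset_subset_G lcos_m_assoc lcos_mult_one)
  finally have "(cmap G (inv g <# ?L) \<circ> cmap G (g <# H)) (base ?L) = base ?L" using c(2) by simp
  then show ?thesis
    using gmap_orb_eqI[OF L gmap_comp[OF c(1) d(1)] gmap_id[OF is_gset_orb[OF L]] _ x] by simp
qed

lemma tidealD:
  assumes "tideal G T I"
  shows "\<not> subgroup H G \<Longrightarrow> I H = {}"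
    and "subgroup H G \<Longrightarrow> ideal (I H) (rng (orb H))"
    and "subgroup H G \<Longrightarrow> subgroup K G \<Longrightarrow> K \<subseteq> H \<Longrightarrow> a \<in> I H \<Longrightarrow> sres G T H K a \<in> I K"
    and "subgroup H G \<Longrightarrow> subgroup K G \<Longrightarrow> K \<subseteq> H \<Longrightarrow> a \<in> I K \<Longrightarrow> str G T K H a \<in> I H"
    and "subgroup H G \<Longrightarrow> subgroup K G \<Longrightarrow> K \<subseteq> H \<Longrightarrow> a \<in> I K \<Longrightarrow> snm G T K H a \<in> I H"
    and "subgroup H G \<Longrightarrow> g \<in> carrier G \<Longrightarrow> a \<in> I H \<Longrightarrow> sconj G T g H a \<in> I (conjg G g H)"
  using assms by (simp_all add: tideal_def TR_def)

lemma tideal_carrier: "tideal G T I \<Longrightarrow> a \<in> I H \<Longrightarrow> subgroup H G \<and> a \<in> carrier (rng (orb H))"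
  using tidealD(1,2)[of I H] additive_subgroup.a_subset[OF ideal.axioms(1)] by blast

text \<open>Every map of orbits \<open>G/K \<rightarrow> G/H\<close> is a projection followed by a conjugation, so the closure
  conditions of an ideal hold along all of them.\<close>

lemma tideal_orbit_maps:
  assumes I: "tideal G T I" and K: "subgroup K G" and H: "subgroup H G" and f: "gmap G (orb K) (orb H) f"
  shows "a \<in> I H \<Longrightarrow> res (orb K) (orb H) f a \<in> I K"
    and "a \<in> I K \<Longrightarrow> tra (orb K) (orb H) f a \<in> I H"
    and "a \<in> I K \<Longrightarrow> nrm (orb K) (orb H) f a \<in> I H"
proof -
  obtain g where g: "g \<in> carrier G" "f (base K) = emb G (g <# H)"
    using gmapD(3)[OF f base_in_orb[OF K]] by (auto simp: orb_elem)
  define L where "L = conjg G g H"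
  have L: "subgroup L G" unfolding L_def by (rule conjg_subgroup[OF H g(1)])
  have gH: "g <# H \<subseteq> carrier G" using l_coset_subset_G[OF subgroup.subset[OF H] g(1)] .
  \<comment> \<open>\<open>K\<close> fixes the base point of \<open>G/K\<close>, hence also its
    image \<open>gH\<close>, whose stabilizer is \<open>L\<close>.\<close>
  have KL: "K \<subseteq> L"
  proof
    fix k assume k: "k \<in> K"
    then have kG: "k \<in> carrier G" using subgroup.subset[OF K] by blast
    have "k <# K = K"
      using coset_eq_iff[OF K one_closed kG] k lcos_mult_one[OF subgroup.subset[OF K]] by simp
    then have "snd (orb K) k (base K) = base K" using subgroup.subset[OF K] by (simp add: orb_act)
    then have "snd (orb H) k (emb G (g <# H)) = emb G (g <# H)"
      using gmapD(4)[OF f kG base_in_orb[OF K]] g(2) by simp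
    then have "k <# (g <# H) = g <# H"
      using gH kG by (simp add: orb_act emb_eq_iff l_coset_subset_G)
    then show "k \<in> L" unfolding L_def mem_conjg_iff[OF H g(1)] using kG by blast
  qed
  let ?c = "cmap G (g <# H)" and ?t = "cmap G L" and ?d = "cmap G (inv g <# L)"
  have c: "gmap G (orb L) (orb H) ?c" "?c (base L) = emb G (g <# H)"
    unfolding L_def using gmap_cmap_conjg[OF H g(1)] by blast+
  have t: "gmap G (orb K) (orb L) ?t" "?t (base K) = base L"
    using gmap_cmap_subset[OF K L KL] by blast+
  have HL: "conjg G (inv g) L = H" unfolding L_def by (rule conjg_inv[OF H g(1)])
  have d: "gmap G (orb H) (orb L) ?d" using gmap_cmap_conjg(1)[OF L inv_closed[OF g(1)]] HL by simp
  have dc: "?d (?c x) = x" if "x \<in> fst (orb L)" for x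
    using cmap_conjg_inverse[OF H g(1)] that unfolding L_def .
  have cd: "?c (?d x) = x" if "x \<in> fst (orb H)" for x
    using cmap_conjg_inverse[OF L inv_closed[OF g(1)], of x] that HL g(1) by simp
  have f_eq: "f x = (?c \<circ> ?t) x" if "x \<in> fst (orb K)" for x
    by (rule gmap_orb_eqI[OF K f gmap_comp[OF t(1) c(1)] _ that]) (simp add: g(2) c(2) t(2))
  show "res (orb K) (orb H) f a \<in> I K" if a: "a \<in> I H"
  proof -
    have ac: "a \<in> carrier (rng (orb H))" using tideal_carrier[OF I a] by blast
    have "res (orb L) (orb H) ?c a \<in> I L"
      using tidealD(6)[OF I H g(1) a] by (simp add: sconj_def L_def)
    moreover have "res (orb K) (orb H) f a = res (orb K) (orb H) (?c \<circ> ?t) a"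
      by (rule res_cong[OF f f_eq ac])
    ultimately show ?thesis
      using tidealD(3)[OF I L K KL] res_comp[OF t(1) c(1) ac] by (simp add: sres_def)
  qed
  \<comment> \<open>Conjugating back by \<open>inv g\<close> is restriction along \<open>?d\<close>;
    by \<open>tra_iso\<close> this also handles the transfer and the norm along
    \<open>?c\<close>.\<close>
  have conj: "res (orb H) (orb L) ?d b \<in> I H" if "b \<in> I L" for b
    using tidealD(6)[OF I L inv_closed[OF g(1)] that] HL by (simp add: sconj_def)
  show "tra (orb K) (orb H) f a \<in> I H" if a: "a \<in> I K"
  proof -
    have ac: "a \<in> carrier (rng (orb K))" using tideal_carrier[OF I a] by blast
    have "tra (orb K) (orb H) f a = tra (orb K) (orb H) (?c \<circ> ?t) a"
      by (rule tra_cong[OF f f_eq ac])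
    also have "\<dots> = tra (orb L) (orb H) ?c (tra (orb K) (orb L) ?t a)"
      by (rule tra_comp[OF t(1) c(1) ac])
    also have "\<dots> = res (orb H) (orb L) ?d (tra (orb K) (orb L) ?t a)"
      by (rule tra_iso(1)[OF c(1) d dc cd tra_closed[OF t(1) ac]])
    finally show ?thesis using conj tidealD(4)[OF I L K KL a] by (simp add: str_def)
  qed
  show "nrm (orb K) (orb H) f a \<in> I H" if a: "a \<in> I K"
  proof -
    have ac: "a \<in> carrier (rng (orb K))" using tideal_carrier[OF I a] by blast
    have "nrm (orb K) (orb H) f a = nrm (orb K) (orb H) (?c \<circ> ?t) a"
      by (rule nrm_cong[OF f f_eq ac])
    also have "\<dots> = nrm (orb L) (orb H) ?c (nrm (orb K) (orb L) ?t a)"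
      by (rule nrm_comp[OF t(1) c(1) ac])
    also have "\<dots> = res (orb H) (orb L) ?d (nrm (orb K) (orb L) ?t a)"
      by (rule tra_iso(2)[OF c(1) d dc cd nrm_closed[OF t(1) ac]])
    finally show ?thesis using conj tidealD(5)[OF I L K KL a] by (simp add: snm_def)
  qed
qed

subsection \<open>Ideals of transfers\<close>

text \<open>Addition is absent on purpose: norms do not respect it, and sums reappear through gluing
  and transfers. Zero is demanded only over the empty set; its transfers supply the zero of every
  level.\<close>

definition msys :: "(('g,'x) gset \<Rightarrow> 'r set) \<Rightarrow> bool" where
  "msys M \<longleftrightarrow>
    (\<forall>A. is_gset G A \<longrightarrow> M A \<subseteq> carrier (rng A)) \<and>
    (\<forall>A. is_gset G A \<and> fst A = {} \<longrightarrow> \<zero>\<^bsub>rng A\<^esub> \<in> M A) \<and>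
    (\<forall>A. is_gset G A \<longrightarrow> (\<forall>c\<in>carrier (rng A). \<forall>a\<in>M A. c \<otimes>\<^bsub>rng A\<^esub> a \<in> M A)) \<and>
    (\<forall>A B f. gmap G A B f \<longrightarrow> (\<forall>b\<in>M B. res A B f b \<in> M A)) \<and>
    (\<forall>A B f. gmap G A B f \<and> f ` fst A = fst B \<longrightarrow> (\<forall>a\<in>M A. nrm A B f a \<in> M B)) \<and>
    (\<forall>A B C i j. is_sum G A B C i j \<longrightarrow>
      (\<forall>c\<in>carrier (rng C). res A C i c \<in> M A \<and> res B C j c \<in> M B \<longrightarrow> c \<in> M C))"

lemma msysD:
  assumes "msys M"
  shows "is_gset G A \<Longrightarrow> a \<in> M A \<Longrightarrow> a \<in> carrier (rng A)"
    and "is_gset G A \<Longrightarrow> fst A = {} \<Longrightarrow> \<zero>\<^bsub>rng A\<^esub> \<in> M A"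
    and "is_gset G A \<Longrightarrow> c \<in> carrier (rng A) \<Longrightarrow> a \<in> M A \<Longrightarrow> c \<otimes>\<^bsub>rng A\<^esub> a \<in> M A"
    and "gmap G A B f \<Longrightarrow> b \<in> M B \<Longrightarrow> res A B f b \<in> M A"
    and "gmap G A B f \<Longrightarrow> f ` fst A = fst B \<Longrightarrow> a \<in> M A \<Longrightarrow> nrm A B f a \<in> M B"
    and "is_sum G A B C i j \<Longrightarrow> c \<in> carrier (rng C) \<Longrightarrow> res A C i c \<in> M A \<Longrightarrow> res B C j c \<in> M B \<Longrightarrow> c \<in> M C"
proof -
  show "is_gset G A \<Longrightarrow> a \<in> M A \<Longrightarrow> a \<in> carrier (rng A)"
    using assms[unfolded msys_def, THEN conjunct1, rule_format] by blast
  show "is_gset G A \<Longrightarrow> fst A = {} \<Longrightarrow> \<zero>\<^bsub>rng A\<^esub> \<in> M A"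
    using assms[unfolded msys_def, THEN conjunct2, THEN conjunct1, rule_format] by blast
  show "is_gset G A \<Longrightarrow> c \<in> carrier (rng A) \<Longrightarrow> a \<in> M A \<Longrightarrow> c \<otimes>\<^bsub>rng A\<^esub> a \<in> M A"
    using assms[unfolded msys_def, THEN conjunct2, THEN conjunct2, THEN conjunct1, rule_format] by blast
  show "gmap G A B f \<Longrightarrow> b \<in> M B \<Longrightarrow> res A B f b \<in> M A"
    using assms[unfolded msys_def, THEN conjunct2, THEN conjunct2, THEN conjunct2, THEN conjunct1, rule_format] by blast
  show "gmap G A B f \<Longrightarrow> f ` fst A = fst B \<Longrightarrow> a \<in> M A \<Longrightarrow> nrm A B f a \<in> M B"
    using assms[unfolded msys_def, THEN conjunct2, THEN conjunct2, THEN conjunct2, THEN conjunct2, THEN conjunct1, rule_format] by blast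
  show "is_sum G A B C i j \<Longrightarrow> c \<in> carrier (rng C) \<Longrightarrow> res A C i c \<in> M A \<Longrightarrow> res B C j c \<in> M B \<Longrightarrow> c \<in> M C"
    using assms[unfolded msys_def, THEN conjunct2, THEN conjunct2, THEN conjunct2, THEN conjunct2, THEN conjunct2, rule_format] by blast
qed

text \<open>Bare products, without sums, so that restrictions and norms act factor by
  factor.\<close>

definition mprod :: "(('g,'x) gset \<Rightarrow> 'r set) \<Rightarrow> (('g,'x) gset \<Rightarrow> 'r set) \<Rightarrow> ('g,'x) gset \<Rightarrow> 'r set" where
  "mprod M N A = {a \<otimes>\<^bsub>rng A\<^esub> b | a b. a \<in> M A \<and> b \<in> N A}"

lemma msys_mprod:
  assumes M: "msys M" and N: "msys N"
  shows "msys (mprod M N)"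
  unfolding msys_def
proof (intro conjI allI impI ballI; (elim conjE)?)
  fix A :: "('g,'x) gset" assume A: "is_gset G A"
  interpret A: cring "rng A" by (rule cring_rng[OF A])
  show "mprod M N A \<subseteq> carrier (rng A)"
    using msysD(1)[OF M A] msysD(1)[OF N A] by (auto simp: mprod_def)
  show "\<zero>\<^bsub>rng A\<^esub> \<in> mprod M N A" if "fst A = {}"
    using msysD(2)[OF M A that] msysD(2)[OF N A that] A.l_null[OF A.zero_closed] unfolding mprod_def by force
  show "c \<otimes>\<^bsub>rng A\<^esub> u \<in> mprod M N A" if c: "c \<in> carrier (rng A)" and u: "u \<in> mprod M N A" for c u
  proof -
    obtain a b where ab: "u = a \<otimes>\<^bsub>rng A\<^esub> b" "a \<in> M A" "b \<in> N A" using u by (auto simp: mprod_def)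
    then have "c \<otimes>\<^bsub>rng A\<^esub> u = (c \<otimes>\<^bsub>rng A\<^esub> a) \<otimes>\<^bsub>rng A\<^esub> b"
      using c msysD(1)[OF M A] msysD(1)[OF N A] by (simp add: A.m_assoc)
    then show ?thesis unfolding mprod_def using ab msysD(3)[OF M A c] by blast
  qed
next
  fix A B :: "('g,'x) gset" and f u assume f: "gmap G A B f" and u: "u \<in> mprod M N B"
  obtain a b where ab: "u = a \<otimes>\<^bsub>rng B\<^esub> b" "a \<in> M B" "b \<in> N B" using u by (auto simp: mprod_def)
  then have "res A B f u = res A B f a \<otimes>\<^bsub>rng A\<^esub> res A B f b"
    using res_ring(2)[OF f] msysD(1)[OF M gmapD(2)[OF f]] msysD(1)[OF N gmapD(2)[OF f]] by simp
  then show "res A B f u \<in> mprod M N A"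
    unfolding mprod_def using msysD(4)[OF M f] msysD(4)[OF N f] ab by blast
next
  fix A B :: "('g,'x) gset" and f u
  assume f: "gmap G A B f" "f ` fst A = fst B" and u: "u \<in> mprod M N A"
  obtain a b where ab: "u = a \<otimes>\<^bsub>rng A\<^esub> b" "a \<in> M A" "b \<in> N A" using u by (auto simp: mprod_def)
  then have "nrm A B f u = nrm A B f a \<otimes>\<^bsub>rng B\<^esub> nrm A B f b"
    using nrm_mult[OF f(1)] msysD(1)[OF M gmapD(1)[OF f(1)]] msysD(1)[OF N gmapD(1)[OF f(1)]] by simp
  then show "nrm A B f u \<in> mprod M N B"
    unfolding mprod_def using msysD(5)[OF M f] msysD(5)[OF N f] ab by blast
next
  fix A B C :: "('g,'x) gset" and i j c
  assume s: "is_sum G A B C i j" and c: "c \<in> carrier (rng C)"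
    and u: "res A C i c \<in> mprod M N A" and v: "res B C j c \<in> mprod M N B"
  note s' = is_sumD[OF s]
  interpret C: cring "rng C" by (rule cring_rng[OF s'(9)])
  obtain a b where ab: "res A C i c = a \<otimes>\<^bsub>rng A\<^esub> b" "a \<in> M A" "b \<in> N A" using u by (auto simp: mprod_def)
  obtain a' b' where ab': "res B C j c = a' \<otimes>\<^bsub>rng B\<^esub> b'" "a' \<in> M B" "b' \<in> N B" using v by (auto simp: mprod_def)
  \<comment> \<open>The two factors are glued separately, and their product agrees with
    \<open>c\<close> on both summands.\<close>
  obtain m where m: "m \<in> carrier (rng C)" "res A C i m = a" "res B C j m = a'"
    using sum_separate_glue(2)[OF s] msysD(1)[OF M] ab(2) ab'(2) s'(7,8) by blast
  obtain n where n: "n \<in> carrier (rng C)" "res A C i n = b" "res B C j n = b'"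
    using sum_separate_glue(2)[OF s] msysD(1)[OF N] ab(3) ab'(3) s'(7,8) by blast
  have "c = m \<otimes>\<^bsub>rng C\<^esub> n"
    using sum_separate_glue(1)[OF s c, of "m \<otimes>\<^bsub>rng C\<^esub> n"] m n ab ab'
      res_ring(2)[OF s'(1)] res_ring(2)[OF s'(2)] by simp
  moreover have "m \<in> M C" "n \<in> N C"
    using msysD(6)[OF M s m(1)] msysD(6)[OF N s n(1)] m n ab ab' by simp_all
  ultimately show "c \<in> mprod M N C" unfolding mprod_def by blast
qed

lemma msys_carrier: "msys (\<lambda>A. carrier (rng A))"
  unfolding msys_def
proof (intro conjI allI impI ballI; (elim conjE)?)
  fix A :: "('g,'x) gset" assume A: "is_gset G A"
  interpret A: cring "rng A" by (rule cring_rng[OF A])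
  show "\<zero>\<^bsub>rng A\<^esub> \<in> carrier (rng A)" by simp
  show "c \<otimes>\<^bsub>rng A\<^esub> u \<in> carrier (rng A)" if "c \<in> carrier (rng A)" "u \<in> carrier (rng A)" for c u
    using that by simp
qed (auto intro: res_ring nrm_closed)

section \<open>The Tambara ideal formed by the transfers\<close>

definition transfers :: "(('g,'x) gset \<Rightarrow> 'r set) \<Rightarrow> ('g,'x) gset \<Rightarrow> 'r set" where
  "transfers M V = {tra A V q a | A q a. gmap G A V q \<and> a \<in> M A}"

lemma transfersI: "gmap G A V q \<Longrightarrow> a \<in> M A \<Longrightarrow> tra A V q a \<in> transfers M V"
  unfolding transfers_def by blast

lemma transfersE:
  assumes "u \<in> transfers M V"
  obtains A q a where "gmap G A V q" "a \<in> M A" "u = tra A V q a"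
  using assms unfolding transfers_def by blast

lemma transfers_incl:
  assumes "msys M" "is_gset G V" "a \<in> M V"
  shows "a \<in> transfers M V"
  using transfersI[where M = M, OF gmap_id[OF assms(2)] assms(3)] tra_id[OF assms(2)] msysD(1)[OF assms] by simp

lemma transfers_mono: "(\<And>A. is_gset G A \<Longrightarrow> M A \<subseteq> N A) \<Longrightarrow> transfers M V \<subseteq> transfers N V"
  unfolding transfers_def by (blast dest: gmapD(1))

lemma transfers_carrier: "msys M \<Longrightarrow> u \<in> transfers M V \<Longrightarrow> u \<in> carrier (rng V)"
  by (auto elim!: transfersE intro: tra_closed msysD(1) dest: gmapD(1))

lemma transfers_res:
  assumes M: "msys M" and f: "gmap G V Y f" and u: "u \<in> transfers M Y"
  shows "res V Y f u \<in> transfers M V"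
proof -
  obtain A q a where a: "gmap G A Y q" "a \<in> M A" "u = tra A Y q a" using u by (rule transfersE)
  obtain W f' q' where W: "is_pullback G A Y V W q f f' q'"
    using ex_pullback[OF a(1) f infinite_x] by blast
  have "res V Y f u = tra W V f' (res W A q' a)"
    using res_tra[OF W] a msysD(1)[OF M gmapD(1)[OF a(1)]] by simp
  then show ?thesis
    using transfersI[where M = M, OF is_pullbackD(3)[OF W]] msysD(4)[OF M is_pullbackD(4)[OF W] a(2)] by simp
qed

lemma transfers_tra:
  assumes M: "msys M" and f: "gmap G V Y f" and u: "u \<in> transfers M V"
  shows "tra V Y f u \<in> transfers M Y"
proof -
  obtain A q a where a: "gmap G A V q" "a \<in> M A" "u = tra A V q a" using u by (rule transfersE)
  then have "tra V Y f u = tra A Y (f \<circ> q) a"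
    using tra_comp[OF a(1) f] msysD(1)[OF M gmapD(1)[OF a(1)]] by simp
  then show ?thesis using transfersI[where M = M, OF gmap_comp[OF a(1) f] a(2)] by simp
qed

text \<open>Reciprocity turns the norm of a transfer into a transfer of a norm; the latter norm runs
  along a pullback of the surjection \<open>f\<close>, so it stays in \<open>M\<close>.\<close>

lemma transfers_nrm:
  assumes M: "msys M" and f: "gmap G V Y f" "f ` fst V = fst Y" and u: "u \<in> transfers M V"
  shows "nrm V Y f u \<in> transfers M Y"
proof -
  obtain A q a where a: "gmap G A V q" "a \<in> M A" "u = tra A V q a" using u by (rule transfersE)
  obtain Z Xp r p' \<pi> e where E: "is_exp_diagram G A V Y Z Xp q f r p' \<pi> e"
    using ex_exp_diagram[OF a(1) f(1) infinite_x] by blast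
  then have r: "gmap G Z Y r" and pb: "is_pullback G V Y Z Xp f r p' \<pi>" and e: "gmap G Xp A e"
    by (simp_all add: is_exp_diagram_def)
  have "nrm V Y f u = tra Z Y r (nrm Xp Z p' (res Xp A e a))"
    using nrm_tra[OF E] a msysD(1)[OF M gmapD(1)[OF a(1)]] by simp
  moreover have "nrm Xp Z p' (res Xp A e a) \<in> M Z"
    using msysD(5)[OF M is_pullbackD(3)[OF pb] is_pullback_surj[OF pb f(2)]] msysD(4)[OF M e a(2)] .
  ultimately show ?thesis using transfersI[where M = M, OF r] by simp
qed

lemma transfers_zero:
  assumes M: "msys M" and V: "is_gset G V"
  shows "\<zero>\<^bsub>rng V\<^esub> \<in> transfers M V"
proof -
  let ?W = "({}, snd V) :: ('g,'x) gset"
  have "gmap G ?W V (\<lambda>x. x)" by (rule gmap_empty[OF V])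
  then show ?thesis
    using transfersI[where M = M, of ?W V "\<lambda>x. x" "\<zero>\<^bsub>rng ?W\<^esub>"] msysD(2)[OF M is_gset_empty] tra_zero by fastforce
qed

lemma transfers_add:
  assumes M: "msys M" and V: "is_gset G V" and u: "u \<in> transfers M V" and v: "v \<in> transfers M V"
  shows "u \<oplus>\<^bsub>rng V\<^esub> v \<in> transfers M V"
proof -
  obtain A q a where a: "gmap G A V q" "a \<in> M A" "u = tra A V q a" using u by (rule transfersE)
  obtain B q' b where b: "gmap G B V q'" "b \<in> M B" "v = tra B V q' b" using v by (rule transfersE)
  note ac = msysD(1)[OF M gmapD(1)[OF a(1)] a(2)] and bc = msysD(1)[OF M gmapD(1)[OF b(1)] b(2)]
  obtain C i j where s: "is_sum G A B C i j"
    using ex_sum[OF gmapD(1)[OF a(1)] gmapD(1)[OF b(1)] infinite_x] by blast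
  note s' = is_sumD[OF s]
  obtain h where h: "gmap G C V h" "\<forall>a\<in>fst A. h (i a) = q a" "\<forall>b\<in>fst B. h (j b) = q' b"
    using ex_sum_map[OF s a(1) b(1)] by blast
  obtain c where c: "c \<in> carrier (rng C)" "res A C i c = a" "res B C j c = b"
    using sum_separate_glue(2)[OF s ac bc] by blast
  have "c \<in> M C" using msysD(6)[OF M s c(1)] c a b by simp
  moreover have "tra A V (h \<circ> i) a = u"
    using tra_cong[OF gmap_comp[OF s'(1) h(1)] _ ac, of q] h(2) a(3) by simp
  moreover have "tra B V (h \<circ> j) b = v"
    using tra_cong[OF gmap_comp[OF s'(2) h(1)] _ bc, of q'] h(3) b(3) by simp
  ultimately have "tra C V h c = u \<oplus>\<^bsub>rng V\<^esub> v"
    using tra_sum[OF s h(1) c(1)] c by simp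
  then show ?thesis using transfersI[where M = M, OF h(1) \<open>c \<in> M C\<close>] by simp
qed

text \<open>Multiplication is the norm along the fold map \<open>V \<squnion> V \<rightarrow> V\<close>, so Tambara reciprocity for the
  fold map expresses a product of two transfers as a single transfer.\<close>

lemma transfers_mult:
  assumes M: "msys M" and N: "msys N" and V: "is_gset G V" and u: "u \<in> transfers M V" and v: "v \<in> transfers N V"
  shows "u \<otimes>\<^bsub>rng V\<^esub> v \<in> transfers (mprod M N) V"
proof -
  obtain A q a where a: "gmap G A V q" "a \<in> M A" "u = tra A V q a" using u by (rule transfersE)
  obtain B q' b where b: "gmap G B V q'" "b \<in> N B" "v = tra B V q' b" using v by (rule transfersE)
  note ac = msysD(1)[OF M gmapD(1)[OF a(1)] a(2)] and bc = msysD(1)[OF N gmapD(1)[OF b(1)] b(2)]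
  obtain C i j where s: "is_sum G A B C i j"
    using ex_sum[OF gmapD(1)[OF a(1)] gmapD(1)[OF b(1)] infinite_x] by blast
  obtain D k l where t: "is_sum G V V D k l"
    using ex_sum[OF V V infinite_x] by blast
  note s' = is_sumD[OF s] and t' = is_sumD[OF t]
  \<comment> \<open>\<open>h\<close> is the disjoint union of \<open>q\<close> and
    \<open>q'\<close>, and \<open>n\<close> below is the fold map.\<close>
  obtain h where h: "gmap G C D h" "\<forall>a\<in>fst A. h (i a) = (k \<circ> q) a" "\<forall>b\<in>fst B. h (j b) = (l \<circ> q') b"
    using ex_sum_map[OF s gmap_comp[OF a(1) t'(1)] gmap_comp[OF b(1) t'(2)]] by blast
  obtain n where n: "gmap G D V n" "\<forall>a\<in>fst V. n (k a) = a" "\<forall>a\<in>fst V. n (l a) = a"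
    using ex_sum_map[OF t gmap_id[OF V] gmap_id[OF V]] by blast
  obtain c where c: "c \<in> carrier (rng C)" "res A C i c = a" "res B C j c = b"
    using sum_separate_glue(2)[OF s ac bc] by blast
  have qV: "q x \<in> fst V" if "x \<in> fst A" for x using gmapD(3)[OF a(1) that] .
  have qV': "q' x \<in> fst V" if "x \<in> fst B" for x using gmapD(3)[OF b(1) that] .
  \<comment> \<open>Over each copy of \<open>V\<close>, the transfer along \<open>h\<close>
    restricts to the original transfer, \<open>u\<close> or \<open>v\<close>.\<close>
  have pk: "is_pullback G C D V A h k q i"
    by (rule is_pullback_sum[OF s t h(1) a(1)]) (use h qV' in auto)
  have pl: "is_pullback G C D V B h l q' j"
    by (rule is_pullback_sum[OF is_sum_commute[OF s] is_sum_commute[OF t] h(1) b(1)]) (use h qV in auto)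
  have hc: "tra C D h c \<in> carrier (rng D)" by (rule tra_closed[OF h(1) c(1)])
  have uc: "u \<in> carrier (rng V)" and vc: "v \<in> carrier (rng V)"
    using tra_closed[OF a(1) ac] tra_closed[OF b(1) bc] a b by simp_all
  have ru: "res V D k (tra C D h c) = u" using res_tra[OF pk c(1)] c a by simp
  have rv: "res V D l (tra C D h c) = v" using res_tra[OF pl c(1)] c b by simp
  have "nrm V V (n \<circ> k) u = u"
    using nrm_cong[OF gmap_comp[OF t'(1) n(1)] _ uc, of "\<lambda>x. x"] n(2) nrm_id[OF V uc] by simp
  moreover have "nrm V V (n \<circ> l) v = v"
    using nrm_cong[OF gmap_comp[OF t'(2) n(1)] _ vc, of "\<lambda>x. x"] n(3) nrm_id[OF V vc] by simp
  ultimately have uv: "nrm D V n (tra C D h c) = u \<otimes>\<^bsub>rng V\<^esub> v"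
    using nrm_sum[OF t n(1) hc] ru rv by simp
  obtain Z W r p \<pi> e where E: "is_exp_diagram G C D V Z W h n r p \<pi> e"
    using ex_exp_diagram[OF h(1) n(1) infinite_x] by blast
  then have r: "gmap G Z V r" and pb: "is_pullback G D V Z W n r p \<pi>" and e: "gmap G W C e"
    and he: "\<forall>w\<in>fst W. h (e w) = \<pi> w"
    by (simp_all add: is_exp_diagram_def)
  have p: "gmap G W Z p" by (rule is_pullbackD(3)[OF pb])
  note W = gmapD(1)[OF e]
  \<comment> \<open>\<open>W\<close> splits by whether evaluation lands in \<open>A\<close> or in
    \<open>B\<close>; the first part will carry the factor from \<open>M\<close>, the second the one
    from \<open>N\<close>.\<close>
  define W1 where "W1 = {w \<in> fst W. e w \<in> i ` fst A}"
  define W2 where "W2 = {w \<in> fst W. e w \<in> j ` fst B}"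
  have stable: "is_gset G ({w \<in> fst W. e w \<in> m ` fst Y}, snd W)" if m: "gmap G Y C m" for m Y
  proof (rule is_gset_subset[OF W])
    fix g w assume g: "g \<in> carrier G" and "w \<in> {w \<in> fst W. e w \<in> m ` fst Y}"
    then obtain y where w: "w \<in> fst W" and y: "y \<in> fst Y" "e w = m y" by blast
    have "e (snd W g w) = m (snd Y g y)"
      using gmapD(4)[OF e g w] gmapD(4)[OF m g y(1)] y(2) by simp
    then show "snd W g w \<in> {w \<in> fst W. e w \<in> m ` fst Y}"
      using is_gsetD(2)[OF W g w] is_gsetD(2)[OF gmapD(1)[OF m] g y(1)] by blast
  qed auto
  have gW: "is_gset G (W1, snd W)" "is_gset G (W2, snd W)"
    unfolding W1_def W2_def using stable[OF s'(1)] stable[OF s'(2)] .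
  have sW: "is_sum G (W1, snd W) (W2, snd W) W (\<lambda>x. x) (\<lambda>x. x)"
    by (rule is_sum_subsets[OF W gW])
      (use s'(5,6) gmapD(3)[OF e] in \<open>auto simp: W1_def W2_def\<close>)
  have inc: "gmap G (W1, snd W) W (\<lambda>x. x)" "gmap G (W2, snd W) W (\<lambda>x. x)"
    using is_sumD[OF sW] by auto
  define w where "w = res W C e c"
  have wc: "w \<in> carrier (rng W)" unfolding w_def by (rule res_ring(1)[OF e c(1)])
  \<comment> \<open>On its part, \<open>e\<close> factors through \<open>A\<close> (or
    \<open>B\<close>), so \<open>w\<close> is there a restriction of \<open>a\<close> (or
    \<open>b\<close>).\<close>
  have part: "res (S, snd W) W (\<lambda>x. x) w \<in> M' (S, snd W)"
    if M': "msys M'" and S: "gmap G (S, snd W) W (\<lambda>x. x)" "S = {w \<in> fst W. e w \<in> m ` fst Y}"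
      and m: "gmap G Y C m" "inj_on m (fst Y)" "res Y C m c \<in> M' Y" for S m Y M'
  proof -
    obtain e' where e': "gmap G (S, snd W) Y e'" "\<forall>y\<in>S. m (e' y) = e y"
      using gmap_factor_inj[OF gmap_comp[OF S(1) e] m(1,2)] S(2) by auto
    have "res (S, snd W) W (\<lambda>x. x) w = res (S, snd W) C (e \<circ> (\<lambda>x. x)) c"
      unfolding w_def using res_comp[OF S(1) e c(1)] by simp
    also have "\<dots> = res (S, snd W) C (m \<circ> e') c"
      by (rule res_cong[OF gmap_comp[OF S(1) e] _ c(1)]) (use e' in simp)
    also have "\<dots> = res (S, snd W) Y e' (res Y C m c)"
      by (rule res_comp[OF e'(1) m(1) c(1)])
    finally show ?thesis using msysD(4)[OF M' e'(1) m(3)] by simp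
  qed
  \<comment> \<open>The fibre of the fold map over \<open>r z\<close> meets both copies of
    \<open>V\<close>, so each part of \<open>W\<close> still covers \<open>Z\<close>. This is the
    surjectivity that norms in \<open>M\<close> and \<open>N\<close> require.\<close>
  have surj: "p ` {w \<in> fst W. e w \<in> m ` fst Y} = fst Z"
    if kl: "gmap G V D k'" "\<forall>a\<in>fst V. n (k' a) = a"
      and dis: "\<And>w. w \<in> fst W \<Longrightarrow> \<pi> w \<in> k' ` fst V \<Longrightarrow> e w \<in> m ` fst Y" for m k' Y
  proof
    show "p ` {w \<in> fst W. e w \<in> m ` fst Y} \<subseteq> fst Z" using gmapD(3)[OF p] by auto
    show "fst Z \<subseteq> p ` {w \<in> fst W. e w \<in> m ` fst Y}"
    proof
      fix z assume z: "z \<in> fst Z"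
      then have rz: "r z \<in> fst V" using gmapD(3)[OF r] by blast
      then obtain w where "w \<in> fst W" "p w = z" "\<pi> w = k' (r z)"
        using is_pullbackD(6)[OF pb z, of "k' (r z)"] kl gmapD(3)[OF kl(1)] by auto
      then show "z \<in> p ` {w \<in> fst W. e w \<in> m ` fst Y}" using dis rz by blast
    qed
  qed
  have eC: "e w \<in> i ` fst A \<union> j ` fst B" if "w \<in> fst W" for w
    using gmapD(3)[OF e that] s'(6) by simp
  have s1: "(p \<circ> (\<lambda>x. x)) ` fst (W1, snd W) = fst Z"
  proof -
    \<comment> \<open>\<open>h\<close> sends \<open>B\<close> into the second copy of
      \<open>V\<close>, so a point over the first copy can only evaluate into
      \<open>A\<close>.\<close>
    have d: "e w \<in> i ` fst A" if ww: "w \<in> fst W" "\<pi> w \<in> k ` fst V" for w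
    proof (rule ccontr)
      assume "e w \<notin> i ` fst A"
      then obtain y where "y \<in> fst B" "e w = j y" using eC[OF ww(1)] by blast
      then have "\<pi> w \<in> l ` fst V" using he ww(1) h(3) qV' by force
      then show False using ww(2) t'(5) by blast
    qed
    show ?thesis using surj[OF t'(1) n(2) d] unfolding W1_def by simp
  qed
  have s2: "(p \<circ> (\<lambda>x. x)) ` fst (W2, snd W) = fst Z"
  proof -
    have d: "e w \<in> j ` fst B" if ww: "w \<in> fst W" "\<pi> w \<in> l ` fst V" for w
    proof (rule ccontr)
      assume "e w \<notin> j ` fst B"
      then obtain y where "y \<in> fst A" "e w = i y" using eC[OF ww(1)] by blast
      then have "\<pi> w \<in> k ` fst V" using he ww(1) h(2) qV by force
      then show False using ww(2) t'(5) by blast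
    qed
    show ?thesis using surj[OF t'(2) n(3) d] unfolding W2_def by simp
  qed
  have "nrm W Z p w = nrm (W1, snd W) Z (p \<circ> (\<lambda>x. x)) (res (W1, snd W) W (\<lambda>x. x) w)
      \<otimes>\<^bsub>rng Z\<^esub> nrm (W2, snd W) Z (p \<circ> (\<lambda>x. x)) (res (W2, snd W) W (\<lambda>x. x) w)"
    by (rule nrm_sum[OF sW p wc])
  moreover have "nrm (W1, snd W) Z (p \<circ> (\<lambda>x. x)) (res (W1, snd W) W (\<lambda>x. x) w) \<in> M Z"
    by (rule msysD(5)[OF M gmap_comp[OF inc(1) p] s1 part[OF M inc(1) W1_def s'(1,3)]]) (simp add: c a)
  moreover have "nrm (W2, snd W) Z (p \<circ> (\<lambda>x. x)) (res (W2, snd W) W (\<lambda>x. x) w) \<in> N Z"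
    by (rule msysD(5)[OF N gmap_comp[OF inc(2) p] s2 part[OF N inc(2) W2_def s'(2,4)]]) (simp add: c b)
  ultimately have "nrm W Z p w \<in> mprod M N Z" unfolding mprod_def by blast
  moreover have "u \<otimes>\<^bsub>rng V\<^esub> v = tra Z V r (nrm W Z p w)"
    using nrm_tra[OF E c(1)] uv by (simp add: w_def)
  ultimately show ?thesis using transfersI[where M = "mprod M N", OF r] by simp
qed

text \<open>The product lemma with all elements as the first family: \<open>M\<close> absorbs
  scalars, so the products fall back into \<open>M\<close>.\<close>

lemma transfers_scalar:
  assumes M: "msys M" and V: "is_gset G V" and c: "c \<in> carrier (rng V)" and u: "u \<in> transfers M V"
  shows "c \<otimes>\<^bsub>rng V\<^esub> u \<in> transfers M V"
proof -
  have "c \<otimes>\<^bsub>rng V\<^esub> u \<in> transfers (mprod (\<lambda>A. carrier (rng A)) M) V"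
    by (rule transfers_mult[OF msys_carrier M V transfers_incl[OF msys_carrier V c] u])
  moreover have "mprod (\<lambda>A. carrier (rng A)) M A \<subseteq> M A" if "is_gset G A" for A
    using msysD(3)[OF M that] by (auto simp: mprod_def)
  ultimately show ?thesis using transfers_mono by blast
qed

lemma ideal_transfers:
  assumes M: "msys M" and V: "is_gset G V"
  shows "ideal (transfers M V) (rng V)"
proof -
  interpret cring "rng V" by (rule cring_rng[OF V])
  note carr = transfers_carrier[OF M] and scal = transfers_scalar[OF M V]
  show ?thesis
  proof (rule idealI)
    show "subgroup (transfers M V) (add_monoid (rng V))"
    proof (rule add.subgroupI)
      show "transfers M V \<noteq> {}" using transfers_zero[OF M V] by blast
      show "\<ominus>\<^bsub>rng V\<^esub> a \<in> transfers M V" if "a \<in> transfers M V" for a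
        using scal[OF a_inv_closed[OF one_closed] that] carr[OF that] by (simp add: l_minus)
      show "transfers M V \<subseteq> carrier (rng V)" using carr by blast
    qed (rule transfers_add[OF M V])
    show "x \<otimes>\<^bsub>rng V\<^esub> a \<in> transfers M V" "a \<otimes>\<^bsub>rng V\<^esub> x \<in> transfers M V"
      if "a \<in> transfers M V" "x \<in> carrier (rng V)" for a x
      using scal[OF that(2,1)] m_comm[OF carr[OF that(1)] that(2)] by simp_all
  qed (rule ring_axioms)
qed

lemma cmap_surj:
  assumes "subgroup K G" "subgroup H G" "K \<subseteq> H"
  shows "cmap G H ` fst (orb K) = fst (orb H)"
  using gmap_orb_surj[OF assms(2) gmap_cmap_subset(1)[OF assms]] base_in_orb[OF assms(1)] by blast

text \<open>The norms in the definition of a Tambara ideal run along maps between orbits, which are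
  onto; hence closure under surjective norms is enough.\<close>

lemma tideal_transfers:
  assumes M: "msys M"
  shows "tideal G T (\<lambda>H. if subgroup H G then transfers M (orb H) else {})"
  unfolding tideal_def
proof (intro conjI allI impI ballI; (elim conjE)?)
  fix H assume "subgroup H G"
  then show "ideal (if subgroup H G then transfers M (orb H) else {}) (TR G T H)"
    using ideal_transfers[OF M is_gset_orb] by (simp add: TR_def)
next
  fix H K a assume HK: "subgroup H G" "subgroup K G" "K \<subseteq> H"
  note c = gmap_cmap_subset(1)[OF HK(2,1,3)]
  show "sres G T H K a \<in> (if subgroup K G then transfers M (orb K) else {})"
    if "a \<in> (if subgroup H G then transfers M (orb H) else {})"
    using that HK transfers_res[OF M c] by (simp add: sres_def)
  show "str G T K H a \<in> (if subgroup H G then transfers M (orb H) else {})"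
    if "a \<in> (if subgroup K G then transfers M (orb K) else {})"
    using that HK transfers_tra[OF M c] by (simp add: str_def)
  show "snm G T K H a \<in> (if subgroup H G then transfers M (orb H) else {})"
    if "a \<in> (if subgroup K G then transfers M (orb K) else {})"
    using that HK transfers_nrm[OF M c cmap_surj[OF HK(2,1,3)]] by (simp add: snm_def)
next
  fix H g a assume H: "subgroup H G" "g \<in> carrier G"
    and "a \<in> (if subgroup H G then transfers M (orb H) else {})"
  then show "sconj G T g H a \<in> (if subgroup (conjg G g H) G then transfers M (orb (conjg G g H)) else {})"
    using transfers_res[OF M gmap_cmap_conjg(1)[OF H]] conjg_subgroup[OF H] by (simp add: sconj_def)
qed auto

subsection \<open>Sums of ideals\<close>

text \<open>On an orbit this amounts to the union of the \<open>I H\<close>, not their sum.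
  Different orbits of \<open>A\<close> may use different ideals, so a transfer from \<open>A\<close>
  can add members of several ideals.\<close>

definition loc :: "('g,'r) fam set \<Rightarrow> ('g,'x) gset \<Rightarrow> 'r set" where
  "loc S A = {a \<in> carrier (rng A). \<forall>H f. subgroup H G \<and> gmap G (orb H) A f \<longrightarrow>
     (\<exists>I\<in>S. res (orb H) A f a \<in> I H)}"

lemma locD:
  assumes "a \<in> loc S A"
  shows "a \<in> carrier (rng A)"
    and "subgroup H G \<Longrightarrow> gmap G (orb H) A f \<Longrightarrow> \<exists>I\<in>S. res (orb H) A f a \<in> I H"
  using assms by (auto simp: loc_def)

lemma locI:
  assumes "a \<in> carrier (rng A)"
    and "\<And>H f. subgroup H G \<Longrightarrow> gmap G (orb H) A f \<Longrightarrow> \<exists>I\<in>S. res (orb H) A f a \<in> I H"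
  shows "a \<in> loc S A"
  using assms by (auto simp: loc_def)

text \<open>Splitting off one orbit of \<open>W\<close> makes the norm a product; \<open>c\<close>
  collects what the remaining orbits contribute.\<close>

lemma nrm_orbit_factor:
  assumes H: "subgroup H G" and p: "gmap G W (orb H) p" and ne: "fst W \<noteq> {}" and a: "a \<in> carrier (rng W)"
  shows "\<exists>K \<phi> c. subgroup K G \<and> gmap G (orb K) W \<phi> \<and> c \<in> carrier (rng (orb H)) \<and>
    nrm W (orb H) p a = nrm (orb K) (orb H) (p \<circ> \<phi>) (res (orb K) W \<phi> a) \<otimes>\<^bsub>rng (orb H)\<^esub> c"
proof -
  obtain x where "x \<in> fst W" using ne by blast
  then obtain K B \<phi> j where K: "subgroup K G" and s: "is_sum G (orb K) B W \<phi> j"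
    using split_orbit[OF gmapD(1)[OF p]] by blast
  note s' = is_sumD[OF s]
  have "nrm B (orb H) (p \<circ> j) (res B W j a) \<in> carrier (rng (orb H))"
    by (rule nrm_closed[OF gmap_comp[OF s'(2) p] res_ring(1)[OF s'(2) a]])
  then show ?thesis using nrm_sum[OF s p a] K s'(1) by blast
qed

text \<open>For norms, surjectivity makes the pullback over an orbit nonempty, so one orbit
  contributes a factor in some \<open>I H\<close>, and this ideal absorbs the other factors.\<close>

lemma msys_loc:
  assumes S: "\<And>I. I \<in> S \<Longrightarrow> tideal G T I"
  shows "msys (loc S)"
  unfolding msys_def
proof (intro conjI allI impI ballI; (elim conjE)?)
  fix A :: "('g,'x) gset" assume A: "is_gset G A"
  interpret A: cring "rng A" by (rule cring_rng[OF A])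
  show "loc S A \<subseteq> carrier (rng A)" by (auto simp: loc_def)
  show "\<zero>\<^bsub>rng A\<^esub> \<in> loc S A" if "fst A = {}"
  proof (rule locI)
    show "\<exists>I\<in>S. res (orb H) A f \<zero>\<^bsub>rng A\<^esub> \<in> I H" if "subgroup H G" "gmap G (orb H) A f" for H f
      using gmapD(3)[OF that(2) base_in_orb[OF that(1)]] \<open>fst A = {}\<close> by simp
  qed simp
  show "c \<otimes>\<^bsub>rng A\<^esub> a \<in> loc S A" if c: "c \<in> carrier (rng A)" and a: "a \<in> loc S A" for c a
  proof (rule locI)
    note ac = locD(1)[OF a]
    show "c \<otimes>\<^bsub>rng A\<^esub> a \<in> carrier (rng A)" using c ac by simp
    fix H f assume H: "subgroup H G" and f: "gmap G (orb H) A f"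
    obtain I where I: "I \<in> S" "res (orb H) A f a \<in> I H" using locD(2)[OF a H f] by blast
    then have "res (orb H) A f c \<otimes>\<^bsub>rng (orb H)\<^esub> res (orb H) A f a \<in> I H"
      using ideal.I_l_closed[OF tidealD(2)[OF S H]] res_ring(1)[OF f c] by blast
    then show "\<exists>I\<in>S. res (orb H) A f (c \<otimes>\<^bsub>rng A\<^esub> a) \<in> I H"
      using res_ring(2)[OF f c ac] I(1) by auto
  qed
next
  fix A B :: "('g,'x) gset" and h b assume h: "gmap G A B h" and b: "b \<in> loc S B"
  show "res A B h b \<in> loc S A"
  proof (rule locI)
    show "res A B h b \<in> carrier (rng A)" by (rule res_ring(1)[OF h locD(1)[OF b]])
    fix H f assume H: "subgroup H G" and f: "gmap G (orb H) A f"
    then show "\<exists>I\<in>S. res (orb H) A f (res A B h b) \<in> I H"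
      using locD(2)[OF b H gmap_comp[OF f h]] res_comp[OF f h locD(1)[OF b]] by simp
  qed
next
  fix A B :: "('g,'x) gset" and h a
  assume h: "gmap G A B h" "h ` fst A = fst B" and a: "a \<in> loc S A"
  show "nrm A B h a \<in> loc S B"
  proof (rule locI)
    note ac = locD(1)[OF a]
    show "nrm A B h a \<in> carrier (rng B)" by (rule nrm_closed[OF h(1) ac])
    fix H f assume H: "subgroup H G" and f: "gmap G (orb H) B f"
    obtain W p q where W: "is_pullback G A B (orb H) W h f p q"
      using ex_pullback[OF h(1) f infinite_x] by blast
    note p = is_pullbackD(3)[OF W] and q = is_pullbackD(4)[OF W]
    have "fst W \<noteq> {}" using is_pullback_surj[OF W h(2)] base_in_orb[OF H] by blast
    moreover have wc: "res W A q a \<in> carrier (rng W)" by (rule res_ring(1)[OF q ac])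
    ultimately obtain K \<phi> c where K: "subgroup K G" and phi: "gmap G (orb K) W \<phi>" and c: "c \<in> carrier (rng (orb H))"
        "nrm W (orb H) p (res W A q a) =
          nrm (orb K) (orb H) (p \<circ> \<phi>) (res (orb K) W \<phi> (res W A q a)) \<otimes>\<^bsub>rng (orb H)\<^esub> c"
      using nrm_orbit_factor[OF H p] by blast
    obtain I where I: "I \<in> S" "res (orb K) W \<phi> (res W A q a) \<in> I K"
      using locD(2)[OF a K gmap_comp[OF phi q]] res_comp[OF phi q ac] by auto
    have "nrm (orb K) (orb H) (p \<circ> \<phi>) (res (orb K) W \<phi> (res W A q a)) \<in> I H"
      by (rule tideal_orbit_maps(3)[OF S[OF I(1)] K H gmap_comp[OF phi p] I(2)])
    then have "nrm W (orb H) p (res W A q a) \<in> I H"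
      unfolding c(2) by (rule ideal.I_r_closed[OF tidealD(2)[OF S[OF I(1)] H] _ c(1)])
    then show "\<exists>I\<in>S. res (orb H) B f (nrm A B h a) \<in> I H"
      using res_nrm[OF W ac] I(1) by auto
  qed
next
  fix A B C :: "('g,'x) gset" and i j c
  assume s: "is_sum G A B C i j" and c: "c \<in> carrier (rng C)"
    and u: "res A C i c \<in> loc S A" and v: "res B C j c \<in> loc S B"
  note s' = is_sumD[OF s]
  show "c \<in> loc S C"
  proof (rule locI[OF c])
    fix H f assume H: "subgroup H G" and f: "gmap G (orb H) C f"
    \<comment> \<open>A map from an orbit into a disjoint union lands in one summand, where the
      hypothesis on that summand applies.\<close>
    have *: "\<exists>I\<in>S. res (orb H) C f c \<in> I H"
      if m: "gmap G Y C m" "res Y C m c \<in> loc S Y" and f': "gmap G (orb H) Y f'" "\<And>y. y \<in> fst (orb H) \<Longrightarrow> m (f' y) = f y"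
      for Y m f'
    proof -
      have "res (orb H) C f c = res (orb H) C (m \<circ> f') c"
        by (rule res_cong[OF f _ c]) (simp add: f'(2))
      also have "\<dots> = res (orb H) Y f' (res Y C m c)" by (rule res_comp[OF f'(1) m(1) c])
      finally show ?thesis using locD(2)[OF m(2) H f'(1)] by simp
    qed
    show "\<exists>I\<in>S. res (orb H) C f c \<in> I H"
      by (rule gmap_orb_sum_cases[OF H s f]) (use *[OF s'(1) u] *[OF s'(2) v] in blast)+
  qed
qed

text \<open>Orbit by orbit, \<open>A\<close> contributes transfers lying in members of
  \<open>S\<close>, possibly different ones; their sum lies in the generated ideal.\<close>

lemma tra_loc:
  assumes S: "\<And>I. I \<in> S \<Longrightarrow> tideal G T I" and H: "subgroup H G"
    and q: "gmap G A (orb H) q" and a: "a \<in> loc S A"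
  shows "tra A (orb H) q a \<in> genideal (rng (orb H)) (\<Union>I\<in>S. I H)"
  using q a
proof (induction "card (fst A)" arbitrary: A q a rule: less_induct)
  case less
  note q = \<open>gmap G A (orb H) q\<close> and a = \<open>a \<in> loc S A\<close>
  note A = gmapD(1)[OF q] and ac = locD(1)[OF a]
  interpret R: cring "rng (orb H)" by (rule cring_rng[OF is_gset_orb[OF H]])
  have sub: "(\<Union>I\<in>S. I H) \<subseteq> carrier (rng (orb H))" using tideal_carrier S by blast
  interpret ideal "genideal (rng (orb H)) (\<Union>I\<in>S. I H)" "rng (orb H)" by (rule R.genideal_ideal[OF sub])
  show ?case
  proof (cases "fst A = {}")
    case True
    interpret A: cring "rng A" by (rule cring_rng[OF A])
    have "a = \<zero>\<^bsub>rng A\<^esub>" by (rule rng_empty_unique[OF A True ac]) simp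
    then show ?thesis using tra_zero[OF q] by simp
  next
    case False
    then obtain x where "x \<in> fst A" by blast
    then obtain K B \<phi> j where K: "subgroup K G" and s: "is_sum G (orb K) B A \<phi> j" and B: "card (fst B) < card (fst A)"
      using split_orbit[OF A] by blast
    note s' = is_sumD[OF s]
    obtain I where I: "I \<in> S" "res (orb K) A \<phi> a \<in> I K" using locD(2)[OF a K s'(1)] by blast
    have "tra (orb K) (orb H) (q \<circ> \<phi>) (res (orb K) A \<phi> a) \<in> I H"
      by (rule tideal_orbit_maps(2)[OF S[OF I(1)] K H gmap_comp[OF s'(1) q] I(2)])
    then have 1: "tra (orb K) (orb H) (q \<circ> \<phi>) (res (orb K) A \<phi> a) \<in> genideal (rng (orb H)) (\<Union>I\<in>S. I H)"
      using R.genideal_self[OF sub] I(1) by blast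
    have 2: "tra B (orb H) (q \<circ> j) (res B A j a) \<in> genideal (rng (orb H)) (\<Union>I\<in>S. I H)"
      by (rule less.hyps[OF B gmap_comp[OF s'(2) q] msysD(4)[OF msys_loc[OF S] s'(2) a]])
    show ?thesis using tra_sum[OF s q ac] 1 2 by simp
  qed
qed

text \<open>This is the family under the radical in \<open>rjoin\<close>, named so that its closure
  properties can be stated.\<close>

definition tsum :: "('g,'r) fam set \<Rightarrow> ('g,'r) fam" where
  "tsum S = (\<lambda>H. if subgroup H G then genideal (TR G T H) (\<Union>I\<in>S. I H) else {})"

lemma loc_orb:
  assumes S: "\<And>I. I \<in> S \<Longrightarrow> tideal G T I" and H: "subgroup H G" and I: "I \<in> S" "a \<in> I H"
  shows "a \<in> loc S (orb H)"
proof (rule locI)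
  show "a \<in> carrier (rng (orb H))" using tideal_carrier[OF S[OF I(1)] I(2)] by blast
  show "\<exists>I\<in>S. res (orb K) (orb H) f a \<in> I K" if "subgroup K G" "gmap G (orb K) (orb H) f" for K f
    using tideal_orbit_maps(1)[OF S[OF I(1)] that(1) H that(2) I(2)] I(1) by blast
qed

text \<open>The right-hand side is closed under norms by reciprocity, the left-hand side is
  generated levelwise; their equality makes the levelwise sum a Tambara ideal.\<close>

lemma tsum_eq_transfers:
  assumes S: "\<And>I. I \<in> S \<Longrightarrow> tideal G T I"
  shows "tsum S = (\<lambda>H. if subgroup H G then transfers (loc S) (orb H) else {})"
proof
  fix H
  show "tsum S H = (if subgroup H G then transfers (loc S) (orb H) else {})"
  proof (cases "subgroup H G")
    case H: True
    note O = is_gset_orb[OF H]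
    interpret R: cring "rng (orb H)" by (rule cring_rng[OF O])
    have m: "msys (loc S)" by (rule msys_loc) (rule S)
    have "a \<in> transfers (loc S) (orb H)" if "I \<in> S" "a \<in> I H" for I a
      by (rule transfers_incl[OF m O loc_orb[OF _ H that]]) (rule S)
    then have "genideal (rng (orb H)) (\<Union>I\<in>S. I H) \<subseteq> transfers (loc S) (orb H)"
      by (intro R.genideal_minimal ideal_transfers[OF m O]) blast
    moreover have "transfers (loc S) (orb H) \<subseteq> genideal (rng (orb H)) (\<Union>I\<in>S. I H)"
      using tra_loc[OF S H] by (auto elim!: transfersE)
    ultimately show ?thesis using H by (simp add: tsum_def TR_def)
  qed (simp add: tsum_def)
qed

lemma tideal_tsum: "(\<And>I. I \<in> S \<Longrightarrow> tideal G T I) \<Longrightarrow> tideal G T (tsum S)"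
  using tideal_transfers[OF msys_loc] tsum_eq_transfers by simp

lemma tsum_upper:
  assumes "\<And>I. I \<in> S \<Longrightarrow> tideal G T I" "I \<in> S"
  shows "fam_le I (tsum S)"
  unfolding fam_le_def
proof
  fix H
  show "I H \<subseteq> tsum S H"
  proof (cases "subgroup H G")
    case True
    interpret R: cring "rng (orb H)" by (rule cring_rng[OF is_gset_orb[OF True]])
    have "(\<Union>I\<in>S. I H) \<subseteq> carrier (rng (orb H))" using tideal_carrier assms(1) by blast
    then show ?thesis using R.genideal_self assms(2) True by (auto simp: tsum_def TR_def)
  next
    case False
    then show ?thesis using tidealD(1)[OF assms(1)[OF assms(2)]] by simp
  qed
qed

lemma tsum_least:
  assumes Q: "tideal G T Q" and S: "\<And>I. I \<in> S \<Longrightarrow> fam_le I Q"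
  shows "fam_le (tsum S) Q"
  unfolding fam_le_def
proof
  fix H
  show "tsum S H \<subseteq> Q H"
  proof (cases "subgroup H G")
    case True
    interpret R: cring "rng (orb H)" by (rule cring_rng[OF is_gset_orb[OF True]])
    have "genideal (rng (orb H)) (\<Union>I\<in>S. I H) \<subseteq> Q H"
      using S by (intro R.genideal_minimal tidealD(2)[OF Q True]) (auto simp: fam_le_def)
    then show ?thesis using True by (simp add: tsum_def TR_def)
  qed (simp add: tsum_def)
qed

subsection \<open>Powers of principal ideals\<close>

text \<open>Every operation demanded by \<open>msys\<close> keeps the shape
  \<open>c N_p(R_f x)\<close>. The source \<open>B\<close> is an arbitrary finite
  \<open>G\<close>-set because pullbacks and unions of orbits need not be orbits.\<close>

definition norm_multiples :: "'g set \<Rightarrow> 'r \<Rightarrow> ('g,'x) gset \<Rightarrow> 'r set" where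
  "norm_multiples H0 x A = {c \<otimes>\<^bsub>rng A\<^esub> nrm B A p (res B (orb H0) f x) | B p f c.
     gmap G B A p \<and> p ` fst B = fst A \<and> gmap G B (orb H0) f \<and> c \<in> carrier (rng A)}"

lemma norm_multiplesI:
  "gmap G B A p \<Longrightarrow> p ` fst B = fst A \<Longrightarrow> gmap G B (orb H0) f \<Longrightarrow> c \<in> carrier (rng A) \<Longrightarrow>
    c \<otimes>\<^bsub>rng A\<^esub> nrm B A p (res B (orb H0) f x) \<in> norm_multiples H0 x A"
  unfolding norm_multiples_def by blast

lemma norm_multiplesE:
  assumes "a \<in> norm_multiples H0 x A"
  obtains B p f c where "gmap G B A p" "p ` fst B = fst A" "gmap G B (orb H0) f" "c \<in> carrier (rng A)"
    "a = c \<otimes>\<^bsub>rng A\<^esub> nrm B A p (res B (orb H0) f x)"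
  using assms unfolding norm_multiples_def by blast

lemma msys_norm_multiples:
  assumes H0: "subgroup H0 G" and x: "x \<in> carrier (rng (orb H0))"
  shows "msys (norm_multiples H0 x)"
  unfolding msys_def
proof (intro conjI allI impI ballI; (elim conjE)?)
  fix A :: "('g,'x) gset" assume A: "is_gset G A"
  interpret A: cring "rng A" by (rule cring_rng[OF A])
  have nc: "nrm B A p (res B (orb H0) f x) \<in> carrier (rng A)"
    if "gmap G B A p" "gmap G B (orb H0) f" for B p f
    by (rule nrm_closed[OF that(1) res_ring(1)[OF that(2) x]])
  show sub: "norm_multiples H0 x A \<subseteq> carrier (rng A)"
    using nc by (auto elim!: norm_multiplesE)
  show "\<zero>\<^bsub>rng A\<^esub> \<in> norm_multiples H0 x A" if e: "fst A = {}"
  proof -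
    have "A = ({}, snd A)" using e by (simp add: prod_eq_iff)
    then have "gmap G A (orb H0) (\<lambda>x. x)" using gmap_empty[OF is_gset_orb[OF H0]] by metis
    then have m: "\<zero>\<^bsub>rng A\<^esub> \<otimes>\<^bsub>rng A\<^esub> nrm A A (\<lambda>x. x) (res A (orb H0) (\<lambda>x. x) x) \<in> norm_multiples H0 x A"
      by (intro norm_multiplesI gmap_id[OF A]) auto
    show ?thesis using rng_empty_unique[OF A e A.zero_closed] m sub by (metis subsetD)
  qed
  show "c \<otimes>\<^bsub>rng A\<^esub> a \<in> norm_multiples H0 x A"
    if c: "c \<in> carrier (rng A)" and a: "a \<in> norm_multiples H0 x A" for c a
    using a
  proof (rule norm_multiplesE)
    fix B p f d assume b: "gmap G B A p" "p ` fst B = fst A" "gmap G B (orb H0) f" "d \<in> carrier (rng A)"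
      "a = d \<otimes>\<^bsub>rng A\<^esub> nrm B A p (res B (orb H0) f x)"
    have "c \<otimes>\<^bsub>rng A\<^esub> a = (c \<otimes>\<^bsub>rng A\<^esub> d) \<otimes>\<^bsub>rng A\<^esub> nrm B A p (res B (orb H0) f x)"
      using c b(4) nc[OF b(1,3)] unfolding b(5) by (simp add: A.m_assoc)
    then show ?thesis using norm_multiplesI[OF b(1-3) A.m_closed[OF c b(4)]] by simp
  qed
next
  fix A B :: "('g,'x) gset" and h a assume h: "gmap G A B h" and a: "a \<in> norm_multiples H0 x B"
  from a show "res A B h a \<in> norm_multiples H0 x A"
  proof (rule norm_multiplesE)
    fix Y p f c assume b: "gmap G Y B p" "p ` fst Y = fst B" "gmap G Y (orb H0) f" "c \<in> carrier (rng B)"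
      "a = c \<otimes>\<^bsub>rng B\<^esub> nrm Y B p (res Y (orb H0) f x)"
    have rc: "res Y (orb H0) f x \<in> carrier (rng Y)" by (rule res_ring(1)[OF b(3) x])
    obtain W p' h' where W: "is_pullback G Y B A W p h p' h'"
      using ex_pullback[OF b(1) h infinite_x] by blast
    note W' = is_pullbackD[OF W]
    have "res A B h a = res A B h c \<otimes>\<^bsub>rng A\<^esub> nrm W A p' (res W Y h' (res Y (orb H0) f x))"
      unfolding b(5) using res_ring(2)[OF h b(4) nrm_closed[OF b(1) rc]] res_nrm[OF W rc] by simp
    also have "res W Y h' (res Y (orb H0) f x) = res W (orb H0) (f \<circ> h') x"
      using res_comp[OF W'(4) b(3) x] by simp
    finally show ?thesis
      using norm_multiplesI[OF W'(3) is_pullback_surj[OF W b(2)] gmap_comp[OF W'(4) b(3)] res_ring(1)[OF h b(4)]]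
      by simp
  qed
next
  fix A B :: "('g,'x) gset" and h a
  assume h: "gmap G A B h" "h ` fst A = fst B" and a: "a \<in> norm_multiples H0 x A"
  from a show "nrm A B h a \<in> norm_multiples H0 x B"
  proof (rule norm_multiplesE)
    fix Y p f c assume b: "gmap G Y A p" "p ` fst Y = fst A" "gmap G Y (orb H0) f" "c \<in> carrier (rng A)"
      "a = c \<otimes>\<^bsub>rng A\<^esub> nrm Y A p (res Y (orb H0) f x)"
    have rc: "res Y (orb H0) f x \<in> carrier (rng Y)" by (rule res_ring(1)[OF b(3) x])
    have "nrm A B h a = nrm A B h c \<otimes>\<^bsub>rng B\<^esub> nrm Y B (h \<circ> p) (res Y (orb H0) f x)"
      unfolding b(5) using nrm_mult[OF h(1) b(4) nrm_closed[OF b(1) rc]] nrm_comp[OF b(1) h(1) rc] by simp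
    moreover have "(h \<circ> p) ` fst Y = fst B" using b(2) h(2) by (metis image_comp)
    ultimately show ?thesis
      using norm_multiplesI[OF gmap_comp[OF b(1) h(1)] _ b(3) nrm_closed[OF h(1) b(4)]] by simp
  qed
next
  fix A B C :: "('g,'x) gset" and i j c
  assume s: "is_sum G A B C i j" and c: "c \<in> carrier (rng C)"
    and u: "res A C i c \<in> norm_multiples H0 x A" and v: "res B C j c \<in> norm_multiples H0 x B"
  note s' = is_sumD[OF s]
  interpret C: cring "rng C" by (rule cring_rng[OF s'(9)])
  obtain Y p f a where Y: "gmap G Y A p" "p ` fst Y = fst A" "gmap G Y (orb H0) f" "a \<in> carrier (rng A)"
      "res A C i c = a \<otimes>\<^bsub>rng A\<^esub> nrm Y A p (res Y (orb H0) f x)"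
    using u by (rule norm_multiplesE)
  obtain Z q g b where Z: "gmap G Z B q" "q ` fst Z = fst B" "gmap G Z (orb H0) g" "b \<in> carrier (rng B)"
      "res B C j c = b \<otimes>\<^bsub>rng B\<^esub> nrm Z B q (res Z (orb H0) g x)"
    using v by (rule norm_multiplesE)
  \<comment> \<open>To glue, the two source sets are joined to \<open>D\<close>: below,
    \<open>h\<close> is the union of the two norm maps and \<open>e\<close> the union of the two
    maps to \<open>G/H0\<close>.\<close>
  obtain D k l where t: "is_sum G Y Z D k l"
    using ex_sum[OF gmapD(1)[OF Y(1)] gmapD(1)[OF Z(1)] infinite_x] by blast
  note t' = is_sumD[OF t]
  obtain h where h: "gmap G D C h" "\<forall>y\<in>fst Y. h (k y) = (i \<circ> p) y" "\<forall>z\<in>fst Z. h (l z) = (j \<circ> q) z"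
    using ex_sum_map[OF t gmap_comp[OF Y(1) s'(1)] gmap_comp[OF Z(1) s'(2)]] by blast
  obtain e where e: "gmap G D (orb H0) e" "\<forall>y\<in>fst Y. e (k y) = f y" "\<forall>z\<in>fst Z. e (l z) = g z"
    using ex_sum_map[OF t Y(3) Z(3)] by blast
  obtain d where d: "d \<in> carrier (rng C)" "res A C i d = a" "res B C j d = b"
    using sum_separate_glue(2)[OF s Y(4) Z(4)] by blast
  have surj: "h ` fst D = fst C"
  proof -
    have "h ` fst D = (h \<circ> k) ` fst Y \<union> (h \<circ> l) ` fst Z"
      using t'(6) by (metis image_Un image_comp)
    also have "(h \<circ> k) ` fst Y = i ` fst A"
      using h(2) Y(2) by (metis (no_types, lifting) comp_apply image_comp image_cong)
    also have "(h \<circ> l) ` fst Z = j ` fst B"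
      using h(3) Z(2) by (metis (no_types, lifting) comp_apply image_comp image_cong)
    finally show ?thesis using s'(6) by simp
  qed
  have rc: "res D (orb H0) e x \<in> carrier (rng D)" by (rule res_ring(1)[OF e(1) x])
  have nc: "nrm D C h (res D (orb H0) e x) \<in> carrier (rng C)" by (rule nrm_closed[OF h(1) rc])
  \<comment> \<open>These squares identify the restrictions of the joint norm with the two given
    norms.\<close>
  have pA: "is_pullback G D C A Y h i p k"
    by (rule is_pullback_sum[OF t s h(1) Y(1)]) (use h gmapD(3)[OF Z(1)] in auto)
  have pB: "is_pullback G D C B Z h j q l"
    by (rule is_pullback_sum[OF is_sum_commute[OF t] is_sum_commute[OF s] h(1) Z(1)])
      (use h gmapD(3)[OF Y(1)] in auto)
  have "res Y D k (res D (orb H0) e x) = res Y (orb H0) f x"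
    using res_comp[OF t'(1) e(1) x] res_cong[OF gmap_comp[OF t'(1) e(1)] _ x, of f] e(2) by simp
  then have rA: "res A C i (nrm D C h (res D (orb H0) e x)) = nrm Y A p (res Y (orb H0) f x)"
    using res_nrm[OF pA rc] by simp
  have "res Z D l (res D (orb H0) e x) = res Z (orb H0) g x"
    using res_comp[OF t'(2) e(1) x] res_cong[OF gmap_comp[OF t'(2) e(1)] _ x, of g] e(3) by simp
  then have rB: "res B C j (nrm D C h (res D (orb H0) e x)) = nrm Z B q (res Z (orb H0) g x)"
    using res_nrm[OF pB rc] by simp
  have "c = d \<otimes>\<^bsub>rng C\<^esub> nrm D C h (res D (orb H0) e x)"
    by (rule sum_separate_glue(1)[OF s c C.m_closed[OF d(1) nc]])
      (simp_all add: res_ring(2)[OF s'(1) d(1) nc] res_ring(2)[OF s'(2) d(1) nc] d rA rB Y(5) Z(5))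
  then show "c \<in> norm_multiples H0 x C"
    using norm_multiplesI[OF h(1) surj e(1) d(1)] by simp
qed

text \<open>Exponent zero gives all elements, in step with \<open>tpow\<close>.\<close>

primrec mpow :: "(('g,'x) gset \<Rightarrow> 'r set) \<Rightarrow> nat \<Rightarrow> ('g,'x) gset \<Rightarrow> 'r set" where
  "mpow M 0 = (\<lambda>A. carrier (rng A))"
| "mpow M (Suc n) = mprod (mpow M n) M"

lemma msys_mpow: "msys M \<Longrightarrow> msys (mpow M n)"
  by (induction n) (simp_all add: msys_carrier msys_mprod)

lemma tgen_least: "tideal G T I \<Longrightarrow> x \<in> I H0 \<Longrightarrow> fam_le (tgen G T H0 x) I"
  by (auto simp: fam_le_def tgen_def)

lemma tprod_least: "tideal G T K \<Longrightarrow> (\<And>L a b. a \<in> I L \<Longrightarrow> b \<in> J L \<Longrightarrow> a \<otimes>\<^bsub>TR G T L\<^esub> b \<in> K L) \<Longrightarrow>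
    fam_le (tprod G T I J) K"
  unfolding fam_le_def tprod_def by blast

text \<open>By \<open>transfers_mult\<close>, the ideal on the right contains the products that
  generate the next power, and the power is the least such ideal.\<close>

lemma tpow_tgen_le_transfers:
  assumes H0: "subgroup H0 G" and x: "x \<in> carrier (rng (orb H0))"
  shows "fam_le (tpow G T (tgen G T H0 x) n)
    (\<lambda>H. if subgroup H G then transfers (mpow (norm_multiples H0 x) n) (orb H) else {})"
proof (induction n)
  case 0
  show ?case
    using transfers_incl[OF msys_carrier is_gset_orb] by (auto simp: fam_le_def unit_fam_def TR_def)
next
  case (Suc n)
  let ?M = "norm_multiples H0 x"
  note M = msys_norm_multiples[OF H0 x] and O = is_gset_orb[OF H0]
  interpret R: cring "rng (orb H0)" by (rule cring_rng[OF O])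
  have "x \<in> ?M (orb H0)"
    using norm_multiplesI[OF gmap_id[OF O] _ gmap_id[OF O] R.one_closed, where x = x] res_id[OF O x] nrm_id[OF O x] x by simp
  then have "x \<in> transfers ?M (orb H0)" by (rule transfers_incl[OF M O])
  then have gen: "fam_le (tgen G T H0 x) (\<lambda>H. if subgroup H G then transfers ?M (orb H) else {})"
    using H0 by (intro tgen_least tideal_transfers[OF M]) simp
  have "a \<otimes>\<^bsub>TR G T L\<^esub> b \<in> (if subgroup L G then transfers (mpow ?M (Suc n)) (orb L) else {})"
    if "a \<in> tpow G T (tgen G T H0 x) n L" "b \<in> tgen G T H0 x L" for L a b
  proof -
    have "a \<in> (if subgroup L G then transfers (mpow ?M n) (orb L) else {})"
      using Suc that(1) unfolding fam_le_def by blast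
    then have L: "subgroup L G" and a: "a \<in> transfers (mpow ?M n) (orb L)" by (auto split: if_splits)
    have "b \<in> (if subgroup L G then transfers ?M (orb L) else {})"
      using gen that(2) unfolding fam_le_def by blast
    then have "b \<in> transfers ?M (orb L)" using L by simp
    then show ?thesis
      using transfers_mult[OF msys_mpow[OF M] M is_gset_orb[OF L] a] L by (simp add: TR_def)
  qed
  then show ?case
    unfolding tpow.simps by (intro tprod_least tideal_transfers[OF msys_mpow[OF M]])
qed

section \<open>Finitely many generators on orbits\<close>

definition orbit_norms :: "'g set \<Rightarrow> 'r \<Rightarrow> 'g set \<Rightarrow> 'r set" where
  "orbit_norms H0 x L = {nrm (orb K) (orb L) p (res (orb K) (orb H0) f x) | K p f.
     subgroup K G \<and> gmap G (orb K) (orb L) p \<and> gmap G (orb K) (orb H0) f}"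

text \<open>Each factor is a norm from a single orbit, without coefficients; this leaves finitely
  many elements.\<close>

primrec orbit_norm_prods :: "'g set \<Rightarrow> 'r \<Rightarrow> nat \<Rightarrow> 'g set \<Rightarrow> 'r set" where
  "orbit_norm_prods H0 x 0 L = {\<one>\<^bsub>rng (orb L)\<^esub>}"
| "orbit_norm_prods H0 x (Suc n) L =
     {a \<otimes>\<^bsub>rng (orb L)\<^esub> b | a b. a \<in> orbit_norm_prods H0 x n L \<and> b \<in> orbit_norms H0 x L}"

lemma orbit_norms_carrier:
  assumes "x \<in> carrier (rng (orb H0))" "b \<in> orbit_norms H0 x L"
  shows "b \<in> carrier (rng (orb L))"
  using assms by (auto simp: orbit_norms_def intro: nrm_closed res_ring(1))

lemma orbit_norm_prods_carrier:
  assumes L: "subgroup L G" and x: "x \<in> carrier (rng (orb H0))"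
  shows "a \<in> orbit_norm_prods H0 x n L \<Longrightarrow> a \<in> carrier (rng (orb L))"
proof (induction n arbitrary: a)
  case 0
  interpret R: cring "rng (orb L)" by (rule cring_rng[OF is_gset_orb[OF L]])
  show ?case using 0 by simp
next
  case (Suc n)
  interpret R: cring "rng (orb L)" by (rule cring_rng[OF is_gset_orb[OF L]])
  show ?case using Suc orbit_norms_carrier[OF x] by auto
qed

text \<open>Regrouping of the factors; it supplies the exponent \<open>m + n\<close> in the proof of
  primality.\<close>

lemma orbit_norm_prods_add:
  assumes L: "subgroup L G" and x: "x \<in> carrier (rng (orb H0))"
  shows "a \<in> orbit_norm_prods H0 x (m + n) L \<Longrightarrow>
    \<exists>b\<in>orbit_norm_prods H0 x m L. \<exists>c\<in>orbit_norm_prods H0 x n L. a = b \<otimes>\<^bsub>rng (orb L)\<^esub> c"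
proof (induction n arbitrary: a)
  case 0
  interpret R: cring "rng (orb L)" by (rule cring_rng[OF is_gset_orb[OF L]])
  show ?case using 0 orbit_norm_prods_carrier[OF L x, of a m] by (auto intro!: bexI[of _ a])
next
  case (Suc n)
  interpret R: cring "rng (orb L)" by (rule cring_rng[OF is_gset_orb[OF L]])
  obtain u v where u: "u \<in> orbit_norm_prods H0 x (m + n) L" "v \<in> orbit_norms H0 x L" "a = u \<otimes>\<^bsub>rng (orb L)\<^esub> v"
    using Suc.prems by auto
  obtain b c where b: "b \<in> orbit_norm_prods H0 x m L" "c \<in> orbit_norm_prods H0 x n L" "u = b \<otimes>\<^bsub>rng (orb L)\<^esub> c"
    using Suc.IH[OF u(1)] by blast
  have "a = b \<otimes>\<^bsub>rng (orb L)\<^esub> (c \<otimes>\<^bsub>rng (orb L)\<^esub> v)"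
    using u(3) b orbit_norm_prods_carrier[OF L x] orbit_norms_carrier[OF x u(2)] by (simp add: R.m_assoc)
  moreover have "c \<otimes>\<^bsub>rng (orb L)\<^esub> v \<in> orbit_norm_prods H0 x (Suc n) L" using b(2) u(2) by auto
  ultimately show ?case using b(1) by blast
qed

text \<open>Norms and restrictions depend only on the values of the maps on the source orbit. After
  restricting \<open>p\<close> and \<open>f\<close> to it, finitely many triples
  \<open>(K, p, f)\<close> remain.\<close>

lemma finite_orbit_norms:
  assumes L: "subgroup L G" and H0: "subgroup H0 G" and x: "x \<in> carrier (rng (orb H0))"
  shows "finite (orbit_norms H0 x L)"
proof (rule finite_subset)
  let ?I = "Sigma {K. subgroup K G} (\<lambda>K. (fst (orb K) \<rightarrow>\<^sub>E fst (orb L)) \<times> (fst (orb K) \<rightarrow>\<^sub>E fst (orb H0)))"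
  let ?F = "\<lambda>(K, p, f). nrm (orb K) (orb L) p (res (orb K) (orb H0) f x)"
  show "finite (?F ` ?I)"
  proof (intro finite_imageI finite_SigmaI finite_cartesian_product finite_PiE)
    show "finite {K. subgroup K G}"
      by (rule finite_subset[of _ "Pow (carrier G)"]) (auto dest: subgroup.subset simp: finite_G)
  qed (use is_gsetD(1)[OF is_gset_orb] L H0 in auto)
  show "orbit_norms H0 x L \<subseteq> ?F ` ?I"
  proof
    fix a assume "a \<in> orbit_norms H0 x L"
    then obtain K p f where K: "subgroup K G" and p: "gmap G (orb K) (orb L) p" and f: "gmap G (orb K) (orb H0) f"
      and a: "a = nrm (orb K) (orb L) p (res (orb K) (orb H0) f x)"
      by (auto simp: orbit_norms_def)
    define p' where "p' = restrict p (fst (orb K))"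
    define f' where "f' = restrict f (fst (orb K))"
    have "a = nrm (orb K) (orb L) p' (res (orb K) (orb H0) f x)"
      unfolding a by (rule nrm_cong[OF p _ res_ring(1)[OF f x]]) (simp add: p'_def)
    also have "res (orb K) (orb H0) f x = res (orb K) (orb H0) f' x"
      by (rule res_cong[OF f _ x]) (simp add: f'_def)
    finally have "a = ?F (K, p', f')" by simp
    moreover have "(K, p', f') \<in> ?I" using K gmapD(3)[OF p] gmapD(3)[OF f] by (auto simp: p'_def f'_def)
    ultimately show "a \<in> ?F ` ?I" by blast
  qed
qed

lemma finite_orbit_norm_prods:
  assumes L: "subgroup L G" and H0: "subgroup H0 G" and x: "x \<in> carrier (rng (orb H0))"
  shows "finite (orbit_norm_prods H0 x n L)"
proof (induction n)
  case (Suc n)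
  have "orbit_norm_prods H0 x (Suc n) L =
      (\<lambda>(a, b). a \<otimes>\<^bsub>rng (orb L)\<^esub> b) ` (orbit_norm_prods H0 x n L \<times> orbit_norms H0 x L)"
    by auto
  then show ?case using Suc finite_orbit_norms[OF assms] by simp
qed simp

text \<open>The source of each norm is nonempty because it covers the orbit; one of its orbits
  supplies a factor in \<open>orbit_norms\<close>, the others join the coefficient.\<close>

lemma mpow_norm_multiples_orb:
  assumes L: "subgroup L G" and H0: "subgroup H0 G" and x: "x \<in> carrier (rng (orb H0))"
  shows "a \<in> mpow (norm_multiples H0 x) n (orb L) \<Longrightarrow>
    \<exists>c\<in>carrier (rng (orb L)). \<exists>b\<in>orbit_norm_prods H0 x n L. a = c \<otimes>\<^bsub>rng (orb L)\<^esub> b"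
proof (induction n arbitrary: a)
  case 0
  interpret R: cring "rng (orb L)" by (rule cring_rng[OF is_gset_orb[OF L]])
  show ?case using 0 by (auto intro!: bexI[of _ a])
next
  case (Suc n)
  interpret R: cring "rng (orb L)" by (rule cring_rng[OF is_gset_orb[OF L]])
  obtain u v where u: "u \<in> mpow (norm_multiples H0 x) n (orb L)" "v \<in> norm_multiples H0 x (orb L)"
      "a = u \<otimes>\<^bsub>rng (orb L)\<^esub> v"
    using Suc.prems by (auto simp: mprod_def)
  obtain c b where cb: "c \<in> carrier (rng (orb L))" "b \<in> orbit_norm_prods H0 x n L" "u = c \<otimes>\<^bsub>rng (orb L)\<^esub> b"
    using Suc.IH[OF u(1)] by blast
  obtain B p f d where B: "gmap G B (orb L) p" "p ` fst B = fst (orb L)" "gmap G B (orb H0) f"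
      "d \<in> carrier (rng (orb L))" "v = d \<otimes>\<^bsub>rng (orb L)\<^esub> nrm B (orb L) p (res B (orb H0) f x)"
    using u(2) by (rule norm_multiplesE)
  have "fst B \<noteq> {}" using B(2) base_in_orb[OF L] by blast
  then obtain K \<phi> e where K: "subgroup K G" "gmap G (orb K) B \<phi>" "e \<in> carrier (rng (orb L))"
      "nrm B (orb L) p (res B (orb H0) f x) =
        nrm (orb K) (orb L) (p \<circ> \<phi>) (res (orb K) B \<phi> (res B (orb H0) f x)) \<otimes>\<^bsub>rng (orb L)\<^esub> e"
    using nrm_orbit_factor[OF L B(1) _ res_ring(1)[OF B(3) x]] by blast
  define w where "w = nrm (orb K) (orb L) (p \<circ> \<phi>) (res (orb K) (orb H0) (f \<circ> \<phi>) x)"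
  have w: "w \<in> orbit_norms H0 x L"
    unfolding w_def orbit_norms_def using K(1) gmap_comp[OF K(2) B(1)] gmap_comp[OF K(2) B(3)] by blast
  have "v = d \<otimes>\<^bsub>rng (orb L)\<^esub> (w \<otimes>\<^bsub>rng (orb L)\<^esub> e)"
    unfolding B(5) K(4) w_def using res_comp[OF K(2) B(3) x] by simp
  then have "a = (c \<otimes>\<^bsub>rng (orb L)\<^esub> b) \<otimes>\<^bsub>rng (orb L)\<^esub> (d \<otimes>\<^bsub>rng (orb L)\<^esub> (w \<otimes>\<^bsub>rng (orb L)\<^esub> e))"
    using u(3) cb(3) by simp
  also have "\<dots> = (c \<otimes>\<^bsub>rng (orb L)\<^esub> (d \<otimes>\<^bsub>rng (orb L)\<^esub> e)) \<otimes>\<^bsub>rng (orb L)\<^esub> (b \<otimes>\<^bsub>rng (orb L)\<^esub> w)"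
    using cb(1) B(4) K(3) orbit_norm_prods_carrier[OF L x cb(2)] orbit_norms_carrier[OF x w]
    by (simp add: R.m_ac)
  finally show ?case
    using cb(1,2) w K(3) B(4) by (metis (mono_tags, lifting) R.m_closed mem_Collect_eq orbit_norm_prods.simps(2))
qed

lemma tprodI: "a \<in> I L \<Longrightarrow> b \<in> J L \<Longrightarrow> a \<otimes>\<^bsub>TR G T L\<^esub> b \<in> tprod G T I J L"
  unfolding tprod_def by blast

lemma orbit_norm_prods_in_tpow:
  assumes L: "subgroup L G" and H0: "subgroup H0 G"
  shows "orbit_norm_prods H0 x n L \<subseteq> tpow G T (tgen G T H0 x) n L"
proof (induction n)
  case 0
  interpret R: cring "rng (orb L)" by (rule cring_rng[OF is_gset_orb[OF L]])
  show ?case using L by (simp add: unit_fam_def TR_def)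
next
  case (Suc n)
  have "orbit_norms H0 x L \<subseteq> tgen G T H0 x L"
    using tideal_orbit_maps(1,3) L H0 by (auto simp: orbit_norms_def tgen_def)
  then show ?case using Suc tprodI[of _ "tpow G T (tgen G T H0 x) n" L _ "tgen G T H0 x"]
    by (auto simp: TR_def)
qed

text \<open>The right-hand side tests finitely many elements in all. In the harder direction,
  \<open>Q\<close> contains the multiples of these elements on orbits, so the family
  \<open>?M\<close> lies in \<open>loc {Q}\<close>, whose transfers return to
  \<open>Q\<close>.\<close>

lemma tpow_tgen_le_iff:
  assumes H0: "subgroup H0 G" and x: "x \<in> carrier (rng (orb H0))" and Q: "tideal G T Q"
  shows "fam_le (tpow G T (tgen G T H0 x) n) Q \<longleftrightarrow> (\<forall>L. subgroup L G \<longrightarrow> orbit_norm_prods H0 x n L \<subseteq> Q L)"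
proof
  assume "fam_le (tpow G T (tgen G T H0 x) n) Q"
  then show "\<forall>L. subgroup L G \<longrightarrow> orbit_norm_prods H0 x n L \<subseteq> Q L"
    using orbit_norm_prods_in_tpow[OF _ H0, of _ x n] unfolding fam_le_def by blast
next
  assume P: "\<forall>L. subgroup L G \<longrightarrow> orbit_norm_prods H0 x n L \<subseteq> Q L"
  let ?M = "mpow (norm_multiples H0 x) n"
  have M: "msys ?M" by (rule msys_mpow[OF msys_norm_multiples[OF H0 x]])
  have inQ: "?M (orb L) \<subseteq> Q L" if L: "subgroup L G" for L
    using mpow_norm_multiples_orb[OF L H0 x] P L ideal.I_l_closed[OF tidealD(2)[OF Q L]] by blast
  have "transfers ?M (orb H) \<subseteq> Q H" if H: "subgroup H G" for H
  proof
    fix u assume "u \<in> transfers ?M (orb H)"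
    then obtain A q a where a: "gmap G A (orb H) q" "a \<in> ?M A" "u = tra A (orb H) q a" by (rule transfersE)
    have "a \<in> loc {Q} A"
    proof (rule locI)
      show "a \<in> carrier (rng A)" by (rule msysD(1)[OF M gmapD(1)[OF a(1)] a(2)])
      show "\<exists>I\<in>{Q}. res (orb K) A f a \<in> I K" if "subgroup K G" "gmap G (orb K) A f" for K f
        using inQ[OF that(1)] msysD(4)[OF M that(2) a(2)] by blast
    qed
    then have "u \<in> genideal (rng (orb H)) (\<Union>I\<in>{Q}. I H)"
      unfolding a(3) using Q by (intro tra_loc[OF _ H a(1)]) auto
    then have "u \<in> tsum {Q} H" using H by (simp add: tsum_def TR_def)
    then show "u \<in> Q H" using tsum_least[OF Q, of "{Q}"] by (auto simp: fam_le_def)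
  qed
  then have "(if subgroup H G then transfers ?M (orb H) else {}) \<subseteq> Q H" for H by simp
  then show "fam_le (tpow G T (tgen G T H0 x) n) Q"
    using tpow_tgen_le_transfers[OF H0 x, of n] unfolding fam_le_def by blast
qed

subsection \<open>Primes, radicals and points\<close>

text \<open>Taking all elements as the family reduces this to
  \<open>tideal_transfers\<close>.\<close>

lemma tideal_unit_fam: "tideal G T (unit_fam G T)"
proof -
  have "unit_fam G T = (\<lambda>H. if subgroup H G then transfers (\<lambda>A. carrier (rng A)) (orb H) else {})"
    using transfers_incl[OF msys_carrier is_gset_orb] transfers_carrier[OF msys_carrier, of _ "orb H" for H]
    by (auto simp: unit_fam_def TR_def fun_eq_iff)
  then show ?thesis using tideal_transfers[OF msys_carrier] by simp
qed

lemma tideal_le_unit_fam: "tideal G T I \<Longrightarrow> fam_le I (unit_fam G T)"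
  using tideal_carrier[of I] by (auto simp: fam_le_def unit_fam_def TR_def)

lemma tideal_INT:
  assumes S: "\<And>I. I \<in> S \<Longrightarrow> tideal G T I" and ne: "S \<noteq> {}"
  shows "tideal G T (\<lambda>H. \<Inter>I\<in>S. I H)"
  unfolding tideal_def
proof (intro conjI allI impI ballI; (elim conjE)?)
  show "(\<Inter>I\<in>S. I H) = {}" if "\<not> subgroup H G" for H
    using tidealD(1)[OF S that] ne by auto
  show "ideal (\<Inter>I\<in>S. I H) (TR G T H)" if H: "subgroup H G" for H
  proof -
    interpret R: cring "rng (orb H)" by (rule cring_rng[OF is_gset_orb[OF H]])
    have "ideal (\<Inter>((\<lambda>I. I H) ` S)) (rng (orb H))"
      by (rule R.i_Intersect) (use tidealD(2)[OF S H] ne in auto)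
    then show ?thesis by (simp add: TR_def)
  qed
qed (auto intro: tidealD(3-6)[OF S])

lemma tideal_tgen: "subgroup H0 G \<Longrightarrow> x \<in> carrier (rng (orb H0)) \<Longrightarrow> tideal G T (tgen G T H0 x)"
proof -
  assume *: "subgroup H0 G" "x \<in> carrier (rng (orb H0))"
  have "tgen G T H0 x = (\<lambda>H. \<Inter>I\<in>{I. tideal G T I \<and> x \<in> I H0}. I H)"
    unfolding tgen_def by (rule ext) blast
  moreover have "unit_fam G T \<in> {I. tideal G T I \<and> x \<in> I H0}"
    using tideal_unit_fam * by (simp add: unit_fam_def TR_def)
  ultimately show ?thesis using tideal_INT[of "{I. tideal G T I \<and> x \<in> I H0}"] by auto
qed

lemma tgen_self: "x \<in> tgen G T H0 x H0"
  by (auto simp: tgen_def)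

lemma tideal_tprod:
  assumes I: "tideal G T I" and J: "tideal G T J"
  shows "tideal G T (tprod G T I J)"
proof -
  let ?S = "{K. tideal G T K \<and> (\<forall>L. \<forall>a\<in>I L. \<forall>b\<in>J L. a \<otimes>\<^bsub>TR G T L\<^esub> b \<in> K L)}"
  have "a \<otimes>\<^bsub>TR G T L\<^esub> b \<in> unit_fam G T L" if "a \<in> I L" "b \<in> J L" for L a b
  proof -
    have L: "subgroup L G" "a \<in> carrier (rng (orb L))" "b \<in> carrier (rng (orb L))"
      using tideal_carrier[OF I that(1)] tideal_carrier[OF J that(2)] by auto
    interpret R: cring "rng (orb L)" by (rule cring_rng[OF is_gset_orb[OF L(1)]])
    show ?thesis using L by (simp add: unit_fam_def TR_def)
  qed
  then have "unit_fam G T \<in> ?S" using tideal_unit_fam by blast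
  moreover have "tprod G T I J = (\<lambda>H. \<Inter>K\<in>?S. K H)"
    unfolding tprod_def by (rule ext) blast
  ultimately show ?thesis using tideal_INT[of ?S] by auto
qed

lemma tideal_tpow: "tideal G T I \<Longrightarrow> tideal G T (tpow G T I n)"
  by (induction n) (simp_all add: tideal_unit_fam tideal_tprod)

section \<open>Chains of ideals and prime ideals\<close>

lemma tideal_UN_chain:
  assumes S: "\<And>I. I \<in> C \<Longrightarrow> tideal G T I" and ne: "C \<noteq> {}"
    and chain: "\<And>I J. I \<in> C \<Longrightarrow> J \<in> C \<Longrightarrow> fam_le I J \<or> fam_le J I"
  shows "tideal G T (\<lambda>H. \<Union>I\<in>C. I H)"
  unfolding tideal_def
proof (intro conjI allI impI ballI; (elim conjE)?)
  show "(\<Union>I\<in>C. I H) = {}" if "\<not> subgroup H G" for H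
    using tidealD(1)[OF S that] by auto
  show "ideal (\<Union>I\<in>C. I H) (TR G T H)" if H: "subgroup H G" for H
  proof -
    interpret R: cring "rng (orb H)" by (rule cring_rng[OF is_gset_orb[OF H]])
    note id = tidealD(2)[OF S H]
    have "ideal (\<Union>I\<in>C. I H) (rng (orb H))"
    proof (rule idealI[OF R.ring_axioms])
      show "subgroup (\<Union>I\<in>C. I H) (add_monoid (rng (orb H)))"
      proof (rule R.add.subgroupI)
        show "(\<Union>I\<in>C. I H) \<subseteq> carrier (rng (orb H))" using tideal_carrier S by blast
        show "(\<Union>I\<in>C. I H) \<noteq> {}"
          using ne additive_subgroup.zero_closed[OF ideal.axioms(1)[OF id]] by blast
        show "\<ominus>\<^bsub>rng (orb H)\<^esub> a \<in> (\<Union>I\<in>C. I H)" if "a \<in> (\<Union>I\<in>C. I H)" for a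
          using that additive_subgroup.a_inv_closed[OF ideal.axioms(1)[OF id]] by blast
        show "a \<oplus>\<^bsub>rng (orb H)\<^esub> b \<in> (\<Union>I\<in>C. I H)"
          if ab: "a \<in> (\<Union>I\<in>C. I H)" "b \<in> (\<Union>I\<in>C. I H)" for a b
        proof -
          obtain I J where "I \<in> C" "a \<in> I H" "J \<in> C" "b \<in> J H" using ab by blast
          then obtain K where "K \<in> C" "a \<in> K H" "b \<in> K H" using chain[of I J] unfolding fam_le_def by blast
          then show ?thesis using additive_subgroup.a_closed[OF ideal.axioms(1)[OF id]] by blast
        qed
      qed
      show "y \<otimes>\<^bsub>rng (orb H)\<^esub> a \<in> (\<Union>I\<in>C. I H)" "a \<otimes>\<^bsub>rng (orb H)\<^esub> y \<in> (\<Union>I\<in>C. I H)"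
        if "a \<in> (\<Union>I\<in>C. I H)" "y \<in> carrier (rng (orb H))" for a y
      proof -
        note y = that(2)
        obtain I where I: "I \<in> C" "a \<in> I H" using \<open>a \<in> (\<Union>I\<in>C. I H)\<close> by blast
        then show "y \<otimes>\<^bsub>rng (orb H)\<^esub> a \<in> (\<Union>I\<in>C. I H)" "a \<otimes>\<^bsub>rng (orb H)\<^esub> y \<in> (\<Union>I\<in>C. I H)"
          using ideal.I_l_closed[OF id[OF I(1)] I(2) y] ideal.I_r_closed[OF id[OF I(1)] I(2) y] I(1)
          by blast+
      qed
    qed
    then show ?thesis by (simp add: TR_def)
  qed
qed (auto intro: tidealD(3-6)[OF S])

text \<open>The hypothesis on levelwise products amounts to \<open>tprod G T A B\<close> lying in
  \<open>P\<close>. Properness is not included; it is imposed only where a point is formed.\<close>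

definition tprime :: "('g,'r) fam \<Rightarrow> bool" where
  "tprime P \<longleftrightarrow> tideal G T P \<and> (\<forall>A B. tideal G T A \<and> tideal G T B \<and>
     (\<forall>L. \<forall>a\<in>A L. \<forall>b\<in>B L. a \<otimes>\<^bsub>TR G T L\<^esub> b \<in> P L) \<longrightarrow> fam_le A P \<or> fam_le B P)"

lemma tprime_tpow:
  assumes P: "tprime P" and I: "tideal G T I" and le: "fam_le (tpow G T I n) P"
  shows "fam_le I P"
  using le
proof (induction n)
  case 0
  \<comment> \<open>Power zero is the unit family, so here \<open>P\<close> contains
    everything.\<close>
  then show ?case using tideal_le_unit_fam[OF I] by (auto simp: fam_le_def)
next
  case (Suc n)
  have "a \<otimes>\<^bsub>TR G T L\<^esub> b \<in> P L" if "a \<in> tpow G T I n L" "b \<in> I L" for L a b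
    using Suc.prems tprodI[where I = "tpow G T I n" and J = I, OF that] by (auto simp: fam_le_def)
  then have "fam_le (tpow G T I n) P \<or> fam_le I P"
    using P tideal_tpow[OF I] I unfolding tprime_def by blast
  then show ?case using Suc.IH by blast
qed

lemma mem_tsum_pair:
  assumes P: "tideal G T P" and A: "tideal G T A" and a: "a \<in> tsum {P, A} L"
  shows "\<exists>p\<in>P L. \<exists>a'\<in>A L. a = p \<oplus>\<^bsub>rng (orb L)\<^esub> a'"
proof -
  have L: "subgroup L G" using a by (auto simp: tsum_def split: if_splits)
  interpret R: cring "rng (orb L)" by (rule cring_rng[OF is_gset_orb[OF L]])
  have "a \<in> genideal (rng (orb L)) (P L \<union> A L)" using a L by (simp add: tsum_def TR_def)
  then have "a \<in> P L <+>\<^bsub>rng (orb L)\<^esub> A L"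
    by (simp add: R.union_genideal[OF tidealD(2)[OF P L] tidealD(2)[OF A L]])
  then show ?thesis by (auto simp: set_add_def set_mult_def)
qed

text \<open>In the expansion of \<open>(p + a')(q + b')\<close> every term but \<open>a' b'\<close>
  has a factor in \<open>P\<close>. Writing the elements this way depends on sums of ideals being
  levelwise.\<close>

lemma tsum_pair_mult:
  assumes P: "tideal G T P" and A: "tideal G T A" and B: "tideal G T B"
    and AB: "\<And>L a b. a \<in> A L \<Longrightarrow> b \<in> B L \<Longrightarrow> a \<otimes>\<^bsub>TR G T L\<^esub> b \<in> P L"
    and a: "a \<in> tsum {P, A} L" and b: "b \<in> tsum {P, B} L"
  shows "a \<otimes>\<^bsub>rng (orb L)\<^esub> b \<in> P L"
proof -
  obtain p a' where pa: "p \<in> P L" "a' \<in> A L" "a = p \<oplus>\<^bsub>rng (orb L)\<^esub> a'"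
    using mem_tsum_pair[OF P A a] by blast
  obtain q b' where qb: "q \<in> P L" "b' \<in> B L" "b = q \<oplus>\<^bsub>rng (orb L)\<^esub> b'"
    using mem_tsum_pair[OF P B b] by blast
  have L: "subgroup L G" using tideal_carrier[OF P pa(1)] by blast
  note c = tideal_carrier[OF P pa(1), THEN conjunct2] tideal_carrier[OF A pa(2), THEN conjunct2]
    tideal_carrier[OF P qb(1), THEN conjunct2] tideal_carrier[OF B qb(2), THEN conjunct2]
  interpret R: cring "rng (orb L)" by (rule cring_rng[OF is_gset_orb[OF L]])
  interpret ideal "P L" "rng (orb L)" by (rule tidealD(2)[OF P L])
  have "a \<otimes>\<^bsub>rng (orb L)\<^esub> b = p \<otimes>\<^bsub>rng (orb L)\<^esub> (q \<oplus>\<^bsub>rng (orb L)\<^esub> b') \<oplus>\<^bsub>rng (orb L)\<^esub>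
      (a' \<otimes>\<^bsub>rng (orb L)\<^esub> q \<oplus>\<^bsub>rng (orb L)\<^esub> a' \<otimes>\<^bsub>rng (orb L)\<^esub> b')"
    unfolding pa(3) qb(3) using c by (simp add: R.l_distr R.r_distr R.a_ac)
  moreover have "p \<otimes>\<^bsub>rng (orb L)\<^esub> (q \<oplus>\<^bsub>rng (orb L)\<^esub> b') \<in> P L"
    using pa(1) c by (intro I_r_closed) auto
  moreover have "a' \<otimes>\<^bsub>rng (orb L)\<^esub> q \<in> P L" using qb(1) c by (intro I_l_closed) auto
  moreover have "a' \<otimes>\<^bsub>rng (orb L)\<^esub> b' \<in> P L" using AB[OF pa(2) qb(2)] by (simp add: TR_def)
  ultimately show ?thesis by simp
qed

lemma ex_tprime:
  assumes H0: "subgroup H0 G" and x: "x \<in> carrier (rng (orb H0))" and I: "tideal G T I"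
    and nle: "\<And>n. \<not> fam_le (tpow G T (tgen G T H0 x) n) I"
  shows "\<exists>P. tprime P \<and> fam_le I P \<and> x \<notin> P H0"
proof -
  \<comment> \<open>For an ideal \<open>Q\<close> this says that no power of the ideal of
    \<open>x\<close> lies in \<open>Q\<close>, but through the finite sets of generators, so that it
    can be checked on unions of chains. Exponent zero is included.\<close>
  define good where "good = (\<lambda>Q. \<forall>n. \<exists>L. subgroup L G \<and> \<not> orbit_norm_prods H0 x n L \<subseteq> Q L)"
  define \<A> where "\<A> = {Q. tideal G T Q \<and> fam_le I Q \<and> good Q}"
  have good_iff: "good Q \<longleftrightarrow> (\<forall>n. \<not> fam_le (tpow G T (tgen G T H0 x) n) Q)" if "tideal G T Q" for Q
    unfolding good_def tpow_tgen_le_iff[OF H0 x that] by blast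
  have "I \<in> \<A>" using I nle good_iff[OF I] by (simp add: \<A>_def fam_le_def)
  have "\<exists>P\<in>\<A>. \<forall>Q\<in>\<A>. fam_le P Q \<longrightarrow> Q = P"
  proof (rule predicate_Zorn)
    show "partial_order_on \<A> (relation_of fam_le \<A>)"
      by (rule partial_order_on_relation_ofI) (auto simp: fam_le_def fun_eq_iff)
    fix C assume C: "C \<in> Chains (relation_of fam_le \<A>)"
    then have CA: "C \<subseteq> \<A>" and chain: "\<And>P Q. P \<in> C \<Longrightarrow> Q \<in> C \<Longrightarrow> fam_le P Q \<or> fam_le Q P"
      by (auto simp: Chains_def relation_of_def)
    show "\<exists>u\<in>\<A>. \<forall>a\<in>C. fam_le a u"
    proof (cases "C = {}")
      case True
      then show ?thesis using \<open>I \<in> \<A>\<close> by blast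
    next
      case False
      let ?U = "\<lambda>H. \<Union>Q\<in>C. Q H"
      have U: "tideal G T ?U"
        by (rule tideal_UN_chain) (use CA chain False in \<open>auto simp: \<A>_def\<close>)
      have le: "fam_le Q ?U" if "Q \<in> C" for Q using that by (auto simp: fam_le_def)
      \<comment> \<open>Finitely many elements of the union already lie in one member of the
        chain.\<close>
      have upper: "\<exists>Q\<in>C. \<forall>(L, y)\<in>F. y \<in> Q L" if "finite F" "\<forall>(L, y)\<in>F. y \<in> ?U L" for F
        using that
      proof (induction F rule: finite_induct)
        case empty
        then show ?case using False by auto
      next
        case (insert z F)
        obtain L y where z: "z = (L, y)" by fastforce
        obtain Q where Q: "Q \<in> C" "\<forall>(L, y)\<in>F. y \<in> Q L" using insert by auto
        obtain R where R: "R \<in> C" "y \<in> R L" using insert.prems z by auto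
        show ?case
        proof (cases "fam_le Q R")
          case True
          have "y' \<in> R L'" if "(L', y') \<in> F" for L' y'
            using bspec[OF Q(2) that] True by (auto simp: fam_le_def)
          then show ?thesis using R z by (intro bexI[of _ R]) auto
        next
          case False
          then have "fam_le R Q" using chain Q(1) R(1) by blast
          then show ?thesis using Q R z by (auto simp: fam_le_def intro!: bexI[of _ Q])
        qed
      qed
      have "good ?U"
        unfolding good_def
      proof (rule ccontr)
        assume "\<not> (\<forall>n. \<exists>L. subgroup L G \<and> \<not> orbit_norm_prods H0 x n L \<subseteq> ?U L)"
        then obtain n where n: "\<And>L. subgroup L G \<Longrightarrow> orbit_norm_prods H0 x n L \<subseteq> ?U L" by blast
        \<comment> \<open>There are finitely many subgroups, each with finitely many products, so
          \<open>?F\<close> is finite: a power contained in the union is contained in one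
          member.\<close>
        let ?F = "Sigma {L. subgroup L G} (orbit_norm_prods H0 x n)"
        have "finite {L. subgroup L G}"
          by (rule finite_subset[of _ "Pow (carrier G)"]) (auto dest: subgroup.subset simp: finite_G)
        then have "finite ?F" using finite_orbit_norm_prods[OF _ H0 x] by auto
        moreover have "\<forall>(L, y)\<in>?F. y \<in> ?U L" using n by blast
        ultimately obtain Q where Q: "Q \<in> C" "\<forall>(L, y)\<in>?F. y \<in> Q L" using upper by blast
        then have "good Q" using CA by (auto simp: \<A>_def)
        then obtain L where "subgroup L G" "\<not> orbit_norm_prods H0 x n L \<subseteq> Q L" unfolding good_def by blast
        then show False using Q(2) by blast
      qed
      moreover obtain Q where "Q \<in> C" using False by blast
      then have "fam_le I ?U" using CA le unfolding \<A>_def fam_le_def by blast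
      ultimately show ?thesis using U le unfolding \<A>_def by (intro bexI[of _ ?U]) auto
    qed
  qed
  then obtain P where PA: "P \<in> \<A>" and max: "\<And>Q. Q \<in> \<A> \<Longrightarrow> fam_le P Q \<Longrightarrow> Q = P" by blast
  then have P: "tideal G T P" and IP: "fam_le I P" and gP: "good P" by (auto simp: \<A>_def)
  \<comment> \<open>By maximality, adjoining an ideal not below \<open>P\<close> brings some power
    of the ideal of \<open>x\<close> into the sum.\<close>
  have big: "\<exists>n. \<forall>L. subgroup L G \<longrightarrow> orbit_norm_prods H0 x n L \<subseteq> tsum {P, A} L"
    if A: "tideal G T A" "\<not> fam_le A P" for A
  proof -
    have up: "fam_le P (tsum {P, A})" "fam_le A (tsum {P, A})" and t: "tideal G T (tsum {P, A})"
      using tsum_upper[of "{P, A}"] tideal_tsum[of "{P, A}"] P A(1) by auto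
    have "tsum {P, A} \<noteq> P" using up(2) A(2) by auto
    then have "tsum {P, A} \<notin> \<A>" using max up(1) by blast
    then have "\<not> good (tsum {P, A})" using t up(1) IP unfolding \<A>_def fam_le_def by blast
    then show ?thesis unfolding good_def by blast
  qed
  have "fam_le A P \<or> fam_le B P"
    if A: "tideal G T A" and B: "tideal G T B" and AB: "\<And>L a b. a \<in> A L \<Longrightarrow> b \<in> B L \<Longrightarrow> a \<otimes>\<^bsub>TR G T L\<^esub> b \<in> P L" for A B
  proof (rule ccontr)
    assume "\<not> (fam_le A P \<or> fam_le B P)"
    then obtain m n where m: "\<And>L. subgroup L G \<Longrightarrow> orbit_norm_prods H0 x m L \<subseteq> tsum {P, A} L"
      and n: "\<And>L. subgroup L G \<Longrightarrow> orbit_norm_prods H0 x n L \<subseteq> tsum {P, B} L"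
      using big[OF A] big[OF B] by blast
    \<comment> \<open>A product of \<open>m + n\<close> norms splits into a factor in
      \<open>P + A\<close> and a factor in \<open>P + B\<close>, hence lies in \<open>P\<close>;
      this contradicts \<open>good P\<close>.\<close>
    obtain L where L: "subgroup L G" "\<not> orbit_norm_prods H0 x (m + n) L \<subseteq> P L" using gP unfolding good_def by blast
    then obtain a where a: "a \<in> orbit_norm_prods H0 x (m + n) L" "a \<notin> P L" by blast
    then obtain b c where "b \<in> orbit_norm_prods H0 x m L" "c \<in> orbit_norm_prods H0 x n L" "a = b \<otimes>\<^bsub>rng (orb L)\<^esub> c"
      using orbit_norm_prods_add[OF L(1) x a(1)] by blast
    then show False using tsum_pair_mult[OF P A B AB, of b L c] m[OF L(1)] n[OF L(1)] a(2) by blast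
  qed
  then have "tprime P" using P unfolding tprime_def by blast
  moreover have "x \<notin> P H0"
  proof
    assume "x \<in> P H0"
    then have "fam_le (tgen G T H0 x) P" by (rule tgen_least[OF P])
    \<comment> \<open>The first power is the product of the unit family with the ideal of
      \<open>x\<close>, hence below that ideal.\<close>
    moreover have "fam_le (tpow G T (tgen G T H0 x) 1) (tgen G T H0 x)"
    proof -
      note t = tideal_tgen[OF H0 x]
      have "a \<otimes>\<^bsub>TR G T L\<^esub> b \<in> tgen G T H0 x L" if "a \<in> unit_fam G T L" "b \<in> tgen G T H0 x L" for L a b
      proof -
        have "subgroup L G" "a \<in> carrier (rng (orb L))"
          using that(1) by (auto simp: unit_fam_def TR_def split: if_splits)
        then show ?thesis using ideal.I_l_closed[OF tidealD(2)[OF t]] that(2) by (simp add: TR_def)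
      qed
      then show ?thesis using tprod_least[OF t] by simp
    qed
    ultimately have "fam_le (tpow G T (tgen G T H0 x) 1) P" by (auto simp: fam_le_def)
    then show False using gP good_iff[OF P] by blast
  qed
  ultimately show ?thesis using IP by blast
qed

text \<open>Krull's description of the radical; the prime produced by \<open>ex_tprime\<close> gives
  the harder inclusion. Inserting the unit family keeps the index set visibly nonempty and confines
  the intersection to the carriers. From here on the radical is seen to be a Tambara ideal.\<close>

lemma tsqrt_eq_primes:
  assumes I: "tideal G T I"
  shows "tsqrt G T I = (\<lambda>H. \<Inter>P\<in>insert (unit_fam G T) {P. tprime P \<and> fam_le I P}. P H)"
proof
  fix H
  show "tsqrt G T I H = (\<Inter>P\<in>insert (unit_fam G T) {P. tprime P \<and> fam_le I P}. P H)"
  proof (cases "subgroup H G")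
    case H: True
    have "x \<in> tsqrt G T I H \<longleftrightarrow> (\<forall>P. tprime P \<and> fam_le I P \<longrightarrow> x \<in> P H)"
      if x: "x \<in> carrier (rng (orb H))" for x
    proof
      assume "x \<in> tsqrt G T I H"
      then obtain n where n: "fam_le (tpow G T (tgen G T H x) n) I"
        using H by (auto simp: tsqrt_def)
      show "\<forall>P. tprime P \<and> fam_le I P \<longrightarrow> x \<in> P H"
      proof (intro allI impI)
        fix P assume P: "tprime P \<and> fam_le I P"
        then have "fam_le (tpow G T (tgen G T H x) n) P" using n by (auto simp: fam_le_def)
        then have "fam_le (tgen G T H x) P" using tprime_tpow P tideal_tgen[OF H x] by blast
        then show "x \<in> P H" using tgen_self[of x H] by (auto simp: fam_le_def)
      qed
    next
      assume *: "\<forall>P. tprime P \<and> fam_le I P \<longrightarrow> x \<in> P H"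
      then obtain n where n: "fam_le (tpow G T (tgen G T H x) n) I"
        using ex_tprime[OF H x I] by blast
      \<comment> \<open>The exponent obtained from \<open>ex_tprime\<close> may be zero, while
        \<open>tsqrt\<close> asks for at least one; powers decrease, so \<open>Suc n\<close>
        serves.\<close>
      have "fam_le (tpow G T (tgen G T H x) (Suc n)) (tpow G T (tgen G T H x) n)"
      proof -
        note t = tideal_tpow[OF tideal_tgen[OF H x], of n]
        have "a \<otimes>\<^bsub>TR G T L\<^esub> b \<in> tpow G T (tgen G T H x) n L"
          if "a \<in> tpow G T (tgen G T H x) n L" "b \<in> tgen G T H x L" for L a b
          using ideal.I_r_closed[OF tidealD(2)[OF t]] tideal_carrier[OF t that(1)]
            tideal_carrier[OF tideal_tgen[OF H x] that(2)] that(1) by (simp add: TR_def)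
        then show ?thesis using tprod_least[OF t] by simp
      qed
      then have "fam_le (tpow G T (tgen G T H x) (Suc n)) I" using n by (auto simp: fam_le_def)
      then show "x \<in> tsqrt G T I H"
        using H x by (auto simp: tsqrt_def TR_def simp del: tpow.simps intro!: exI[of _ "Suc n"])
    qed
    moreover have "tsqrt G T I H \<subseteq> carrier (rng (orb H))" by (auto simp: tsqrt_def TR_def)
    ultimately show ?thesis using H by (auto simp: unit_fam_def TR_def)
  qed (simp add: tsqrt_def unit_fam_def)
qed

lemma tideal_tsqrt: "tideal G T I \<Longrightarrow> tideal G T (tsqrt G T I)"
  unfolding tsqrt_eq_primes
  by (rule tideal_INT) (auto simp: tideal_unit_fam tprime_def)

lemma tsqrt_upper: "tideal G T I \<Longrightarrow> fam_le I (tsqrt G T I)"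
  unfolding tsqrt_eq_primes using tideal_le_unit_fam[of I] by (auto simp: fam_le_def)

lemma tsqrt_le_prime: "tideal G T I \<Longrightarrow> tprime P \<Longrightarrow> fam_le I P \<Longrightarrow> fam_le (tsqrt G T I) P"
  unfolding tsqrt_eq_primes by (auto simp: fam_le_def)

lemma tsqrt_mono: "fam_le I J \<Longrightarrow> fam_le (tsqrt G T I) (tsqrt G T J)"
  unfolding fam_le_def tsqrt_def by (auto, meson order_trans)

lemma fam_le_antisym: "fam_le I J \<Longrightarrow> fam_le J I \<Longrightarrow> I = J"
  by (auto simp: fam_le_def fun_eq_iff)

lemma fam_le_trans: "fam_le I J \<Longrightarrow> fam_le J K \<Longrightarrow> fam_le I K"
  by (auto simp: fam_le_def)

lemma radicalI: "tideal G T I \<Longrightarrow> fam_le (tsqrt G T I) I \<Longrightarrow> I \<in> RadId G T"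
  unfolding RadId_def radical_def using tsqrt_upper fam_le_antisym by blast

text \<open>A prime above \<open>I\<close> is also above its radical, so the second radical is an
  intersection over at least the same primes.\<close>

lemma tsqrt_in_RadId:
  assumes I: "tideal G T I"
  shows "tsqrt G T I \<in> RadId G T"
proof (rule radicalI[OF tideal_tsqrt[OF I]])
  let ?A = "insert (unit_fam G T) {P. tprime P \<and> fam_le I P}"
    and ?B = "insert (unit_fam G T) {P. tprime P \<and> fam_le (tsqrt G T I) P}"
  have sub: "?A \<subseteq> ?B" using tsqrt_le_prime[OF I] by blast
  show "fam_le (tsqrt G T (tsqrt G T I)) (tsqrt G T I)"
    unfolding fam_le_def
  proof
    fix H
    have "tsqrt G T (tsqrt G T I) H = (\<Inter>P\<in>?B. P H)"
      by (rule fun_cong[OF tsqrt_eq_primes[OF tideal_tsqrt[OF I]]])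
    also have "\<dots> \<subseteq> (\<Inter>P\<in>?A. P H)" using sub by (rule INF_superset_mono) simp
    also have "\<dots> = tsqrt G T I H" by (rule fun_cong[OF tsqrt_eq_primes[OF I], symmetric])
    finally show "tsqrt G T (tsqrt G T I) H \<subseteq> tsqrt G T I H" .
  qed
qed

section \<open>Joins and meets of radical ideals, tested on primes\<close>

lemma RadIdD: "I \<in> RadId G T \<Longrightarrow> tideal G T I" "I \<in> RadId G T \<Longrightarrow> tsqrt G T I = I"
  by (auto simp: RadId_def radical_def)

lemma rjoin_eq: "rjoin G T S = tsqrt G T (tsum S)"
  by (simp add: rjoin_def tsum_def)

lemma rjoin_in_RadId: "S \<subseteq> RadId G T \<Longrightarrow> rjoin G T S \<in> RadId G T"
  unfolding rjoin_eq by (intro tsqrt_in_RadId tideal_tsum) (auto dest: RadIdD)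

text \<open>Passing from the sum to its radical does not affect containment in a prime, and a sum
  lies in \<open>P\<close> as soon as its summands do.\<close>

lemma rjoin_le_prime_iff:
  assumes S: "S \<subseteq> RadId G T" and P: "tprime P"
  shows "fam_le (rjoin G T S) P \<longleftrightarrow> (\<forall>I\<in>S. fam_le I P)"
proof
  have t: "tideal G T I" if "I \<in> S" for I using S RadIdD(1) that by blast
  note s = tideal_tsum[OF t]
  show "\<forall>I\<in>S. fam_le I P" if "fam_le (rjoin G T S) P"
    using tsum_upper[OF t] tsqrt_upper[OF s] that unfolding rjoin_eq by (blast intro: fam_le_trans)
  show "fam_le (rjoin G T S) P" if "\<forall>I\<in>S. fam_le I P"
    unfolding rjoin_eq using P that by (intro tsqrt_le_prime[OF s P] tsum_least) (auto simp: tprime_def)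
qed

lemma unit_fam_in_RadId: "unit_fam G T \<in> RadId G T"
  by (rule radicalI[OF tideal_unit_fam tideal_le_unit_fam[OF tideal_tsqrt[OF tideal_unit_fam]]])

lemma rmeet_in_RadId:
  assumes "I \<in> RadId G T" "J \<in> RadId G T"
  shows "rmeet I J \<in> RadId G T"
proof (rule radicalI)
  have "rmeet I J = (\<lambda>H. \<Inter>K\<in>{I, J}. K H)" by (auto simp: rmeet_def)
  then show "tideal G T (rmeet I J)" using tideal_INT[of "{I, J}"] RadIdD(1) assms by auto
  have "fam_le (tsqrt G T (rmeet I J)) I" "fam_le (tsqrt G T (rmeet I J)) J"
    using tsqrt_mono[of "rmeet I J" I] tsqrt_mono[of "rmeet I J" J] RadIdD(2)[OF assms(1)] RadIdD(2)[OF assms(2)]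
    by (auto simp: fam_le_def rmeet_def)
  then show "fam_le (tsqrt G T (rmeet I J)) (rmeet I J)" by (auto simp: fam_le_def rmeet_def)
qed

text \<open>Products of elements of \<open>I\<close> and \<open>J\<close> lie in the intersection,
  so primality applies.\<close>

lemma rmeet_le_prime_iff:
  assumes I: "tideal G T I" and J: "tideal G T J" and P: "tprime P"
  shows "fam_le (rmeet I J) P \<longleftrightarrow> fam_le I P \<or> fam_le J P"
proof
  assume le: "fam_le (rmeet I J) P"
  have "a \<otimes>\<^bsub>TR G T L\<^esub> b \<in> P L" if a: "a \<in> I L" and b: "b \<in> J L" for L a b
  proof -
    have c: "subgroup L G" "a \<in> carrier (rng (orb L))" "b \<in> carrier (rng (orb L))"
      using tideal_carrier[OF I a] tideal_carrier[OF J b] by auto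
    have "a \<otimes>\<^bsub>rng (orb L)\<^esub> b \<in> I L \<inter> J L"
      using ideal.I_r_closed[OF tidealD(2)[OF I c(1)] a c(3)] ideal.I_l_closed[OF tidealD(2)[OF J c(1)] b c(2)] by blast
    then show ?thesis using le by (auto simp: fam_le_def rmeet_def TR_def)
  qed
  then show "fam_le I P \<or> fam_le J P" using P I J unfolding tprime_def by blast
qed (auto simp: fam_le_def rmeet_def)

text \<open>The two tests on primes say that not lying below \<open>P\<close> respects joins and
  binary meets; properness gives the value one at the top.\<close>

lemma is_point_of_prime:
  assumes P: "tprime P" and proper: "\<not> fam_le (unit_fam G T) P"
  shows "is_point G T (\<lambda>I. I \<in> RadId G T \<and> \<not> fam_le I P)"
  unfolding is_point_def
proof (intro conjI allI impI ballI)
  show "rjoin G T S \<in> RadId G T \<and> \<not> fam_le (rjoin G T S) P \<longleftrightarrow> (\<exists>I\<in>S. I \<in> RadId G T \<and> \<not> fam_le I P)"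
    if "S \<subseteq> RadId G T" for S
    using rjoin_in_RadId[OF that] rjoin_le_prime_iff[OF that P] that by blast
  show "rmeet I J \<in> RadId G T \<and> \<not> fam_le (rmeet I J) P \<longleftrightarrow>
      (I \<in> RadId G T \<and> \<not> fam_le I P) \<and> J \<in> RadId G T \<and> \<not> fam_le J P"
    if "I \<in> RadId G T" "J \<in> RadId G T" for I J
    using rmeet_in_RadId[OF that] rmeet_le_prime_iff[OF RadIdD(1) RadIdD(1) P, OF that] that by blast
qed (simp_all add: unit_fam_in_RadId proper)

lemma point_mono:
  assumes p: "is_point G T p" and "p I" "I \<in> RadId G T" "J \<in> RadId G T" "fam_le I J"
  shows "p J"
proof -
  have "rmeet I J = I" using assms(5) by (auto simp: rmeet_def fam_le_def fun_eq_iff)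
  then show ?thesis using assms unfolding is_point_def by metis
qed

text \<open>An element of \<open>I\<close> outside the radical ideal \<open>J\<close> is missed by
  some prime above \<open>J\<close>; the point of this prime lies in \<open>U(I)\<close> but not in
  \<open>U(J)\<close>.\<close>

lemma Uopen_subset_iff:
  assumes I: "I \<in> RadId G T" and J: "J \<in> RadId G T"
  shows "Uopen G T I \<subseteq> Uopen G T J \<longleftrightarrow> fam_le I J"
proof
  assume sub: "Uopen G T I \<subseteq> Uopen G T J"
  show "fam_le I J"
  proof (rule ccontr)
    assume "\<not> fam_le I J"
    then obtain H x where x: "x \<in> I H" "x \<notin> J H" by (auto simp: fam_le_def)
    then have H: "subgroup H G" and xc: "x \<in> carrier (rng (orb H))"
      using tideal_carrier[OF RadIdD(1)[OF I]] by auto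
    have "x \<notin> tsqrt G T J H" using x(2) RadIdD(2)[OF J] by simp
    then obtain P where P: "tprime P" "fam_le J P" "x \<notin> P H"
      using H xc unfolding tsqrt_eq_primes[OF RadIdD(1)[OF J]] by (auto simp: unit_fam_def TR_def)
    have "\<not> fam_le (unit_fam G T) P" using P(3) H xc by (auto simp: fam_le_def unit_fam_def TR_def)
    then have "is_point G T (\<lambda>I. I \<in> RadId G T \<and> \<not> fam_le I P)" by (rule is_point_of_prime[OF P(1)])
    moreover have "\<not> fam_le I P" using x(1) P(3) by (auto simp: fam_le_def)
    ultimately have "(\<lambda>I. I \<in> RadId G T \<and> \<not> fam_le I P) \<in> Uopen G T J"
      using sub I by (auto simp: Uopen_def)
    then show False using P(2) by (simp add: Uopen_def)
  qed
next
  assume "fam_le I J"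
  then show "Uopen G T I \<subseteq> Uopen G T J" using point_mono I J by (auto simp: Uopen_def)
qed

text \<open>Hence a union of sets \<open>U(I)\<close> is again of this form, so that every open set
  is reached.\<close>

lemma Uopen_rjoin: "S \<subseteq> RadId G T \<Longrightarrow> Uopen G T (rjoin G T S) = \<Union>(Uopen G T ` S)"
  by (auto simp: Uopen_def is_point_def)

lemma radid_spatial: "radid_spatial G T"
  unfolding radid_spatial_def
proof
  have "inj_on (Uopen G T) (RadId G T)"
  proof (rule inj_onI)
    fix I J assume "I \<in> RadId G T" "J \<in> RadId G T" "Uopen G T I = Uopen G T J"
    then show "I = J"
      using Uopen_subset_iff[of I J] Uopen_subset_iff[of J I] by (auto intro: fam_le_antisym)
  qed
  moreover have "Uopen G T ` RadId G T = pt_opens G T"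
  proof (intro equalityI subsetI)
    fix U assume "U \<in> Uopen G T ` RadId G T"
    then have "\<Union>{U} \<in> pt_opens G T" unfolding pt_opens_def by blast
    then show "U \<in> pt_opens G T" by simp
  next
    fix U assume "U \<in> pt_opens G T"
    then obtain F where F: "F \<subseteq> Uopen G T ` RadId G T" "U = \<Union>F" unfolding pt_opens_def by blast
    then obtain S where S: "S \<subseteq> RadId G T" "F = Uopen G T ` S" by (auto simp: subset_image_iff)
    then have "U = Uopen G T (rjoin G T S)" using F(2) Uopen_rjoin by simp
    then show "U \<in> Uopen G T ` RadId G T" using rjoin_in_RadId[OF S(1)] by blast
  qed
  ultimately show "bij_betw (Uopen G T) (RadId G T) (pt_opens G T)" by (simp add: bij_betw_def)
  show "\<forall>a\<in>RadId G T. \<forall>b\<in>RadId G T. fam_le a b \<longleftrightarrow> Uopen G T a \<subseteq> Uopen G T b"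
    using Uopen_subset_iff by blast
qed

end

theorem theorem5p5:
  fixes G :: "('g, 'b) monoid_scheme" and T :: "('g, 'x, 'r) tamb"
  assumes "group G" and "finite (carrier G)"
    and "infinite (UNIV :: 'x set)"
    and "tambara G T"
  shows "radid_spatial G T"
proof -
  interpret tambara_functor G T
    using assms by (simp add: tambara_functor_def tambara_functor_axioms_def)
  show ?thesis by (rule radid_spatial)
qed

end
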